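(* Let $E\subset\mathbb{C}$ be a regular compact set with connected complement $\overline{\mathbb{C}}\setminus E$, let $\mu\in\mathcal{B}(\partial E)$, and let $\beta=\{\{\beta_{n,k}\}_{k=1}^n\}_{n=1}^\infty$ be a triangular table of points with all $\beta_{n,k}\in\partial E$. Let $m\in\mathbb{N}$ be fixed and let $f\in\mathcal{A}(E)$ be such that $\varrho_{\max}<R_{m,\mu}<\infty$, where $R_{m,\mu}=R_{m,\mu}(f)$. Suppose that $D_{m,\mu}=E_\mu(R_{m,\mu})$ is connected. Let $Q$ be the monic polynomial whose zeros are the poles of $f$ in $D_{m,\mu}$ (counted with multiplicity), and let $\pi_{n,m}^{\beta,f}=P_{n,m}^{\beta,f}/Q_{n,m}^{\beta,f}$ be the $\beta$-multipoint Padé approximant of $f$ of order $(n,m)$, with $P_{n,m}^{\beta,f}$ and $Q_{n,m}^{\beta,f}$ coprime and $Q_{n,m}^{\beta,f}$ normalized with respect to $D_{m,\mu}$. Suppose that $\Lambda=\{n_k\}_{k=1}^\infty$, $n_1<n_2<\cdots$, is a sequence of positive integers such that for every nonempty compact set $K\subset D_{m,\mu}\setminus E$ $$\lim_{n\to\infty,\,n\in\Lambda}\big\|QfQ_{n,m}^{\beta,f}-QP_{n,m}^{\beta,f}\big\|_K^{1/n}=\frac{\|e^{-U^\mu}\|_K}{R_{m,\mu}},$$ and such that $$\limsup_{k\to\infty}\frac{n_{k+1}}{n_k}<\infty.$$ Then there is at least one point $z_0\in\partial D_{m,\mu}$ such that for every $r>0$, with $V_{z_0}(r)$ the disk centered at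 $z_0$ of radius $r$, $$\limsup_{n\to\infty,\,n\in\Lambda}\mu_{P_{n,m}^{\beta,f}}\big(V_{z_0}(r)\big)>0.$$
   Context: Notation. $\Pi_n$ is the set of complex polynomials of degree $\le n$. For a nonempty compact set $K$, $\|g\|_K$ denotes the supremum of $|g|$ on $K$. A compact set $E$ with connected complement is regular if $\overline{\mathbb{C}}\setminus E$ is regular for the Dirichlet problem. Measures and potentials. $\mathcal{B}(E)$ (resp. $\mathcal{B}(\partial E)$) is the set of positive Borel measures of total mass $1$ supported on $E$ (resp. $\partial E$). $U^\mu(z)=\int\log\frac{1}{|z-t|}\,d\mu(t)$ is the logarithmic potential. For a polynomial $p$ of positive degree, $\mu_p$ is its normalized zero counting measure: $\mu_p(F)$ is the number of zeros of $p$ in $F$ (with multiplicity) divided by $\deg p$. Functions. $f\in\mathcal{A}(E)$ means that $f$ is holomorphic in some open neighborhood of $E$. For an open set $B$, $f\in\mathcal{M}_m(B)$ means that $f$ is (continues to be) meromorphic in $B$ with at most $m$ poles there, counted with multiplicity. Level sets. For $\mu\in\mathcal{B}(E)$ put $\rho_{\min}=\inf_{z\in E}e^{-U^\mu(z)}$, $\varrho_{\max}=\max_{z\in E}e^{-U^\mu(z)}$, and, for $r>\rho_{\min}$, $E_\mu(r)=\{z\in\mathbb{C}: e^{-U^\mu(z)}<r\}$, which is an open set, containing $E$ when $r>\varrho_{\max}$. Put $R_{m,\mu}(f)=\sup\{r: f\in\mathcal{M}_m(E_\mu(r))\}$ and $D_{m,\mu}(f)=E_\mu(R_{m,\mu}(f))$.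 The function $f$ is identified with its meromorphic continuation to $D_{m,\mu}$. Multipoint Padé approximants. Put $\omega_n(z)=\prod_{k=1}^n(z-\beta_{n,k})$. For nonnegative integers $n,m$, $\pi_{n,m}^{\beta,f}$ is the rational function $p/q$, where $p\in\Pi_n$, $q\in\Pi_m$, $q\not\equiv0$, are such that $(fq-p)/\omega_{n+m+1}\in\mathcal{A}(E)$. Such $p,q$ exist and the rational function $p/q$ is unique. Write $\pi_{n,m}^{\beta,f}=P_{n,m}^{\beta,f}/Q_{n,m}^{\beta,f}$ with $P_{n,m}^{\beta,f}$, $Q_{n,m}^{\beta,f}$ without common divisors. The normalization of $Q_{n,m}^{\beta,f}$ with respect to $D_{m,\mu}$ is $$Q_{n,m}^{\beta,f}(z)=\prod_k(z-\alpha'_{n,k})\prod_k\big(1-z/\alpha''_{n,k}\big),$$ where $\alpha'_{n,k}$ and $\alpha''_{n,k}$ are the zeros of $Q_{n,m}^{\beta,f}$ lying in $D_{m,\mu}$ and outside $D_{m,\mu}$, respectively; this determines $P_{n,m}^{\beta,f}$ as well (the formula presupposes that no $\alpha''_{n,k}$ equals $0$). *)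

theory Defs
  imports "HOL-Complex_Analysis.Complex_Analysis" "HOL-Probability.Probability_Measure"
begin

definition sup_norm :: "complex set \<Rightarrow> (complex \<Rightarrow> 'a::real_normed_vector) \<Rightarrow> real" where
  "sup_norm K g = (SUP z\<in>K. norm (g z))"

section \<open>The Dirichlet problem on the Riemann sphere\<close>

text \<open>The extended plane is the one-point compactification of the plane: \<open>None\<close> is the point at
  infinity, \<open>Some z\<close> the finite point \<open>z\<close>.\<close>

abbreviation riemann_sphere :: "complex option topology" where
  "riemann_sphere \<equiv> Alexandroff_compactification euclidean"

definition sphere_compl :: "complex set \<Rightarrow> complex option set" where
  "sphere_compl E = topspace riemann_sphere - Some ` E"

text \<open>Twice continuously differentiable with vanishing Laplacian; \<open>ux\<close>, \<open>uxy\<close> and so on are the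
  partial derivatives of \<open>u\<close> with respect to the real and imaginary parts.\<close>

definition harmonic_on :: "(complex \<Rightarrow> real) \<Rightarrow> complex set \<Rightarrow> bool" where
  "harmonic_on u S \<longleftrightarrow> open S \<and>
     (\<exists>ux uy uxx uxy uyx uyy.
        (\<forall>z\<in>S. (u has_derivative (\<lambda>h. ux z * Re h + uy z * Im h)) (at z)
              \<and> (ux has_derivative (\<lambda>h. uxx z * Re h + uxy z * Im h)) (at z)
              \<and> (uy has_derivative (\<lambda>h. uyx z * Re h + uyy z * Im h)) (at z)
              \<and> uxx z + uyy z = 0)
        \<and> continuous_on S uxx \<and> continuous_on S uxy
        \<and> continuous_on S uyx \<and> continuous_on S uyy)"

definition chart_infinity :: "complex \<Rightarrow> complex option" where
  "chart_infinity w = (if w = 0 then None else Some (1 / w))"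

definition sphere_harmonic_on :: "(complex option \<Rightarrow> real) \<Rightarrow> complex option set \<Rightarrow> bool" where
  "sphere_harmonic_on u \<Omega> \<longleftrightarrow>
     harmonic_on (u \<circ> Some) (Some -` \<Omega>) \<and>
     harmonic_on (u \<circ> chart_infinity) (chart_infinity -` \<Omega>)"

definition dirichlet_regular :: "complex option set \<Rightarrow> bool" where
  "dirichlet_regular \<Omega> \<longleftrightarrow>
     (\<forall>\<phi>. continuous_map (subtopology riemann_sphere (riemann_sphere frontier_of \<Omega>)) euclideanreal \<phi> \<longrightarrow>
        (\<exists>u. continuous_map (subtopology riemann_sphere (riemann_sphere closure_of \<Omega>)) euclideanreal u
           \<and> sphere_harmonic_on u \<Omega>
           \<and> (\<forall>x \<in> riemann_sphere frontier_of \<Omega>. u x = \<phi> x)))"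

section \<open>Measures, potentials and level sets\<close>

text \<open>Intended for compact \<open>K\<close>, where vanishing off \<open>K\<close> is the same as having support in \<open>K\<close>.\<close>

definition unit_measures :: "complex set \<Rightarrow> complex measure set" where
  "unit_measures K = {\<mu>. prob_space \<mu> \<and> sets \<mu> = sets borel \<and> emeasure \<mu> (- K) = 0}"

text \<open>The kernel is \<open>\<infinity>\<close> on the diagonal (where \<open>ln (1 / 0)\<close> would be \<open>0\<close>), and the potential is
  an extended real, the integral of the positive part minus the integral of the negative part; the
  Bochner integral would be \<open>0\<close> at points of infinite potential. Note that \<open>e2ennreal\<close> maps negative
  arguments to \<open>0\<close>. For \<open>\<mu>\<close> with bounded support the subtrahend is finite.\<close>

definition log_kernel :: "complex \<Rightarrow> complex \<Rightarrow> ereal" where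
  "log_kernel z t = (if t = z then \<infinity> else ereal (ln (1 / norm (z - t))))"

definition log_potential :: "complex measure \<Rightarrow> complex \<Rightarrow> ereal" where
  "log_potential \<mu> z =
     enn2ereal (\<integral>\<^sup>+ t. e2ennreal (log_kernel z t) \<partial>\<mu>) -
     enn2ereal (\<integral>\<^sup>+ t. e2ennreal (- log_kernel z t) \<partial>\<mu>)"

definition exp_neg_potential :: "complex measure \<Rightarrow> complex \<Rightarrow> real" where
  "exp_neg_potential \<mu> z =
     (if log_potential \<mu> z = \<infinity> then 0 else exp (- real_of_ereal (log_potential \<mu> z)))"

definition rho_min :: "complex set \<Rightarrow> complex measure \<Rightarrow> real" where
  "rho_min E \<mu> = (INF z\<in>E. exp_neg_potential \<mu> z)"

text \<open>For compact \<open>E\<close> the supremum is a maximum, since \<open>exp_neg_potential \<mu>\<close> is upper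
  semicontinuous.\<close>

definition rho_max :: "complex set \<Rightarrow> complex measure \<Rightarrow> real" where
  "rho_max E \<mu> = (SUP z\<in>E. exp_neg_potential \<mu> z)"

definition level_set :: "complex measure \<Rightarrow> ereal \<Rightarrow> complex set" where
  "level_set \<mu> r = {z. ereal (exp_neg_potential \<mu> z) < r}"

section \<open>Meromorphic continuation\<close>

text \<open>\<open>f\<close> matters only near \<open>E\<close>. If \<open>B\<close> contains \<open>E\<close>, the condition says that \<open>F\<close> agrees with \<open>f\<close>
  in a neighbourhood of \<open>E\<close>.\<close>

definition meromorphic_continuation ::
    "(complex \<Rightarrow> complex) \<Rightarrow> complex set \<Rightarrow> complex set \<Rightarrow> (complex \<Rightarrow> complex) \<Rightarrow> bool" where
  "meromorphic_continuation f E B F \<longleftrightarrow>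
     F meromorphic_on B \<and> (\<exists>U. open U \<and> E \<inter> B \<subseteq> U \<and> (\<forall>z\<in>U. F z = f z))"

definition poles_in :: "(complex \<Rightarrow> complex) \<Rightarrow> complex set \<Rightarrow> complex set" where
  "poles_in F B = {z\<in>B. is_pole F z}"

definition pole_order :: "(complex \<Rightarrow> complex) \<Rightarrow> complex \<Rightarrow> nat" where
  "pole_order F z = nat (- zorder F z)"

definition in_M :: "nat \<Rightarrow> (complex \<Rightarrow> complex) \<Rightarrow> complex set \<Rightarrow> complex set \<Rightarrow> bool" where
  "in_M m f E B \<longleftrightarrow>
     (\<exists>F. meromorphic_continuation f E B F \<and>
          finite (poles_in F B) \<and> (\<Sum>z\<in>poles_in F B. pole_order F z) \<le> m)"

definition R_mero :: "nat \<Rightarrow> complex set \<Rightarrow> complex measure \<Rightarrow> (complex \<Rightarrow> complex) \<Rightarrow> ereal" where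
  "R_mero m E \<mu> f = (SUP r \<in> {r::real. rho_min E \<mu> < r \<and> in_M m f E (level_set \<mu> (ereal r))}. ereal r)"

definition D_mero :: "nat \<Rightarrow> complex set \<Rightarrow> complex measure \<Rightarrow> (complex \<Rightarrow> complex) \<Rightarrow> complex set" where
  "D_mero m E \<mu> f = level_set \<mu> (R_mero m E \<mu> f)"

definition pole_poly :: "(complex \<Rightarrow> complex) \<Rightarrow> complex set \<Rightarrow> complex poly" where
  "pole_poly F B = (\<Prod>z\<in>poles_in F B. [:- z, 1:] ^ pole_order F z)"

section \<open>Multipoint Pade approximants\<close>

definition omega_poly :: "(nat \<Rightarrow> nat \<Rightarrow> complex) \<Rightarrow> nat \<Rightarrow> complex poly" where
  "omega_poly \<beta> n = (\<Prod>k=1..n. [:- \<beta> n k, 1:])"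

text \<open>\<open>h\<close> is the quotient \<open>(f q - p) / \<omega>\<close> with the removable singularities at the zeros of
  \<open>\<omega>\<close> filled in.\<close>

definition pade_pair ::
    "(nat \<Rightarrow> nat \<Rightarrow> complex) \<Rightarrow> (complex \<Rightarrow> complex) \<Rightarrow> complex set \<Rightarrow> nat \<Rightarrow> nat
      \<Rightarrow> complex poly \<Rightarrow> complex poly \<Rightarrow> bool" where
  "pade_pair \<beta> f E n m p q \<longleftrightarrow>
     degree p \<le> n \<and> degree q \<le> m \<and> q \<noteq> 0 \<and>
     (\<exists>h U. open U \<and> E \<subseteq> U \<and> h holomorphic_on U \<and>
        (\<forall>z\<in>U. f z * poly q z - poly p z = poly (omega_poly \<beta> (n + m + 1)) z * h z))"

text \<open>\<open>P / Q\<close> is a representation in lowest terms of the rational function \<open>p / q\<close>.\<close>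

definition pade_approximant ::
    "(nat \<Rightarrow> nat \<Rightarrow> complex) \<Rightarrow> (complex \<Rightarrow> complex) \<Rightarrow> complex set \<Rightarrow> nat \<Rightarrow> nat
      \<Rightarrow> complex poly \<Rightarrow> complex poly \<Rightarrow> bool" where
  "pade_approximant \<beta> f E n m P Q \<longleftrightarrow>
     Q \<noteq> 0 \<and> coprime P Q \<and> (\<exists>p q. pade_pair \<beta> f E n m p q \<and> P * q = p * Q)"

text \<open>If \<open>Q\<close> has a zero at the origin and the origin is not in \<open>D\<close>, this is false: the factor for
  that zero on the right-hand side is then \<open>1\<close>.\<close>

definition normalized_wrt :: "complex set \<Rightarrow> complex poly \<Rightarrow> bool" where
  "normalized_wrt D Q \<longleftrightarrow>
     Q = (\<Prod>\<alpha>\<in>#{#\<alpha> \<in># proots Q. \<alpha> \<in> D#}. [:- \<alpha>, 1:]) *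
         (\<Prod>\<alpha>\<in>#{#\<alpha> \<in># proots Q. \<alpha> \<notin> D#}. [:1, - (1 / \<alpha>):])"

text \<open>For constant \<open>p\<close> (including \<open>p = 0\<close>) the value is \<open>0\<close>.\<close>

definition zero_measure :: "complex poly \<Rightarrow> complex set \<Rightarrow> real" where
  "zero_measure p F = real (size {#z \<in># proots p. z \<in> F#}) / real (degree p)"

end

(* Suppose that every boundary point z0 of D has a disc in which P_n has only o(n) zeros (n in the
   sequence). Write phi = exp(-U) for the potential U of the measure and F for the meromorphic function.

   Normalize the denominators as q_n and let p_n be the corresponding numerators. By the Bernstein-Walsh
   inequality p_n grows at most exponentially on bounded sets, and F q_n - p_n tends to 0 geometrically
   inside D, so p_n is neither large nor small at suitable points of D near z0. Dividing out the few zeros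
   and taking n-th roots, Montel's theorem and the maximum principle show that p_n is subexponential near
   z0, hence (maximum principle again) on a connected neighbourhood Omega of the closure of D.

   For consecutive indices n, n' the polynomial p_n q_n' - p_n' q_n is geometrically small on a disc in D
   and subexponential on Omega, so by a three circles argument it is geometrically small on compact
   subsets of Omega. As n'/n is bounded, telescoping p_n / q_n on circles that stay away from all zeros
   of the q_n bounds p_n near the closure of D. Limits of subsequences give a holomorphic H and a polynomial
   q of degree at most m with F q = H. So f continues meromorphically, with at most m poles, to a
   neighbourhood of the closure of D. By the minimum principle for phi this neighbourhood contains
   {phi < r} for some r > R, which contradicts the definition of R. *)
theory Submission
  imports Defs "HOL-Computational_Algebra.Fundamental_Theorem_Algebra"
begin

text \<open>The difficulty is that the zeros of the denominators may lie anywhere: they may cluster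
  at the boundary of D, and if 0 is outside D the factors 1 - z/alpha may be huge. The denominators
  are therefore rescaled (\<open>scaled_poly\<close>) so that their coefficients stay bounded and
  yet none of them is small on a whole disc. Boundedness permits passing to limits; the second
  property gives the lower bound for p_n and prevents the limit q from vanishing. No quotient is
  formed before growth is under control: p_n q_n' - p_n' q_n is a polynomial, so the zeros of the
  denominators do not disturb the propagation of decay. Only afterwards is a circle chosen, one for
  all late indices. Around each zero of the k-th denominator, radii within exp(-d k) are excluded;
  the excluded lengths have a finite sum with small tails. Dividing on the circle costs exp(d m (n +
  n')), which for small d is beaten by the decay exp(-delta n). Bounded n'/n is what allows
  everything belonging to n' to be measured in n, both in the growth of the differences and in this
  cost.\<close>

section \<open>Growth of polynomials\<close>

text \<open>On the unit circle the reflected polynomial at \<open>w\<close> has the modulus of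
  \<open>p\<close> at \<open>inverse w\<close>, and the maximum principle extends the bound inwards.
  Evaluated inside, it controls the growth of \<open>p\<close> outside the disc; evaluated at 0, its
  leading coefficient.\<close>

lemma reflect_poly_bound:
  fixes p :: "complex poly"
  assumes "\<And>z. norm z = 1 \<Longrightarrow> norm (poly p z) \<le> M" and "norm z \<le> 1"
  shows "norm (poly (reflect_poly p) z) \<le> M"
proof (rule maximum_modulus_frontier[of "poly (reflect_poly p)" "cball 0 1"])
  fix w :: complex assume "w \<in> frontier (cball 0 1)"
  then have w: "norm w = 1" by simp
  then have "w \<noteq> 0" by auto
  then show "norm (poly (reflect_poly p) w) \<le> M"
    using assms(1)[of "inverse w"] w
    by (simp add: poly_reflect_poly_nz norm_mult norm_power norm_inverse)
qed (use assms(2) in \<open>auto intro!: holomorphic_intros continuous_intros\<close>)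

text \<open>After rescaling to the unit disc, the reflected polynomial at \<open>inverse w0\<close>
  is the value at \<open>w0\<close> divided by \<open>w0 ^ degree p\<close>.\<close>

lemma bernstein_walsh:
  fixes p :: "complex poly"
  assumes "0 < s" and le: "\<And>z. norm (z - c) = s \<Longrightarrow> norm (poly p z) \<le> M"
    and "degree p \<le> n" and z: "s \<le> norm (z - c)"
  shows "norm (poly p z) \<le> M * (norm (z - c) / s) ^ n"
proof -
  define g where "g = pcompose p [:c, of_real s:]"
  have g: "poly g w = poly p (c + of_real s * w)" for w
    by (simp add: g_def poly_pcompose mult.commute)
  have dg: "degree g = degree p" using \<open>0 < s\<close> by (simp add: g_def degree_pcompose)
  have gM: "norm (poly g w) \<le> M" if "norm w = 1" for w
    using le[of "c + of_real s * w"] that \<open>0 < s\<close> by (simp add: g norm_mult)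
  have M0: "0 \<le> M" using gM[of 1] norm_ge_zero order_trans by (metis norm_one)
  define w0 where "w0 = (z - c) / of_real s"
  have w0: "1 \<le> norm w0" "norm w0 = norm (z - c) / s" using z \<open>0 < s\<close>
    by (auto simp: w0_def norm_divide)
  then have nz: "w0 \<noteq> 0" by auto
  have "norm (poly (reflect_poly g) (inverse w0)) \<le> M"
    using gM w0(1) by (intro reflect_poly_bound) (auto simp: norm_inverse inverse_le_1_iff)
  then have "norm (poly g w0) / norm w0 ^ degree p \<le> M"
    using nz by (simp add: poly_reflect_poly_nz norm_mult norm_power norm_inverse dg divide_inverse mult.commute power_inverse)
  then have "norm (poly g w0) \<le> M * norm w0 ^ degree p"
    using nz by (simp add: field_simps)
  also have "\<dots> \<le> M * norm w0 ^ n"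
    using M0 w0 assms(3) by (intro mult_left_mono power_increasing) auto
  finally show ?thesis using w0 \<open>0 < s\<close> by (simp add: g w0_def)
qed

text \<open>Cauchy's estimate for the leading coefficient: rescaling the circle to radius 1 turns
  the leading coefficient 1 into \<open>t ^ degree p\<close>, which the maximum on the circle
  dominates.\<close>

lemma monic_large_point:
  fixes p :: "complex poly"
  assumes "lead_coeff p = 1" and "0 < t"
  obtains w where "w \<in> cball c t" "t ^ degree p \<le> norm (poly p w)"
proof -
  have "compact (sphere c t)" "sphere c t \<noteq> {}" using assms by auto
  moreover have "continuous_on (sphere c t) (\<lambda>z. norm (poly p z))" by (intro continuous_intros)
  ultimately obtain w where w: "w \<in> sphere c t" "\<And>z. z \<in> sphere c t \<Longrightarrow> norm (poly p z) \<le> norm (poly p w)"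
    using continuous_attains_sup by metis
  define g where "g = pcompose p [:c, of_real t:]"
  have gM: "norm (poly g z) \<le> norm (poly p w)" if "norm z = 1" for z
    using w(2)[of "c + of_real t * z"] that \<open>0 < t\<close>
    by (simp add: g_def poly_pcompose norm_mult dist_norm mult.commute)
  have "lead_coeff g = of_real t ^ degree p"
    unfolding g_def using assms by (subst lead_coeff_comp) auto
  then have "norm (poly (reflect_poly g) 0) = t ^ degree p"
    using \<open>0 < t\<close> by (simp add: poly_0_coeff_0 norm_power)
  then have "t ^ degree p \<le> norm (poly p w)"
    using reflect_poly_bound[of g "norm (poly p w)" 0] gM by simp
  then show thesis using w(1) that[of w] by auto
qed

lemma norm_prod_mset_le:
  fixes g :: "'a \<Rightarrow> complex"
  assumes "\<And>a. a \<in># Z \<Longrightarrow> norm (g a) \<le> B"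
  shows "norm (\<Prod>a\<in>#Z. g a) \<le> B ^ size Z"
  using assms
proof (induction Z)
  case (add x Z)
  have "norm (g x) \<le> B" using add.prems by simp
  moreover from this have "0 \<le> B" using norm_ge_zero order_trans by blast
  ultimately show ?case using add by (auto simp: norm_mult intro!: mult_mono)
qed simp

lemma norm_prod_mset_ge:
  fixes g :: "'a \<Rightarrow> complex"
  assumes "\<And>a. a \<in># Z \<Longrightarrow> B \<le> norm (g a)" "0 \<le> B"
  shows "B ^ size Z \<le> norm (\<Prod>a\<in>#Z. g a)"
  using assms
proof (induction Z)
  case (add x Z)
  then show ?case by (auto simp: norm_mult intro!: mult_mono)
qed simp

lemma poly_prod_linear: "poly (\<Prod>a\<in>#Z. [:- a, 1:]) z = (\<Prod>a\<in>#Z. z - a)" for z :: complex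
  by (simp add: poly_prod_mset image_mset.compositionality o_def)

lemma prod_linear_monic: "lead_coeff (\<Prod>a\<in>#Z. [:- a, 1:]) = (1 :: complex)"
proof (induction Z)
  case (add x Z)
  then show ?case using lead_coeff_mult[of "[:- x, 1:]" "\<Prod>a\<in>#Z. [:- a, 1:]"] by simp
qed simp

lemma degree_prod_linear: "degree (\<Prod>a\<in>#Z. [:- a, 1:] :: complex poly) = size Z"
proof (induction Z)
  case (add x Z)
  have "(\<Prod>a\<in>#Z. [:- a, 1:] :: complex poly) \<noteq> 0" using prod_linear_monic[of Z] by auto
  then show ?case using add degree_mult_eq[of "[:- x, 1:]" "\<Prod>a\<in>#Z. [:- a, 1:]"] by simp
qed simp

section \<open>Normalized denominators\<close>

text \<open>With \<open>D \<subseteq> cball 0 A\<close> this differs from the normalization with respect to \<open>D\<close> by a constant factor of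
  modulus at most \<open>A ^ size Z\<close>, but it is bounded below away from the zeros, uniformly on \<open>cball 0 (A / 2)\<close>.\<close>

definition zero_factor :: "real \<Rightarrow> complex \<Rightarrow> complex poly" where
  "zero_factor A a = (if norm a \<le> A then [:- a, 1:] else [:1, - (1 / a):])"

definition scaled_poly :: "real \<Rightarrow> complex multiset \<Rightarrow> complex poly" where
  "scaled_poly A Z = (\<Prod>a\<in>#Z. zero_factor A a)"

lemma poly_scaled_poly: "poly (scaled_poly A Z) z = (\<Prod>a\<in>#Z. poly (zero_factor A a) z)"
  by (simp add: scaled_poly_def poly_prod_mset image_mset.compositionality o_def)

lemma degree_scaled_poly_le: "degree (scaled_poly A Z) \<le> size Z"
proof (induction Z)
  case (add a Z)
  have "degree (zero_factor A a) \<le> 1" by (auto simp: zero_factor_def)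
  then show ?case using add degree_mult_le[of "zero_factor A a" "scaled_poly A Z"]
    by (simp add: scaled_poly_def)
qed (simp add: scaled_poly_def)

text \<open>Both coefficients of every factor have modulus at most \<open>A\<close>, and each new
  coefficient is a sum of at most two products. The bound does not depend on the zeros, so a
  sequence of such polynomials has a subsequence with convergent coefficients.\<close>

lemma coeff_scaled_poly_le:
  assumes "1 \<le> A"
  shows "norm (coeff (scaled_poly A Z) i) \<le> (2 * A) ^ size Z"
proof (induction Z arbitrary: i)
  case empty
  then show ?case by (simp add: scaled_poly_def)
next
  case (add a Z)
  let ?p = "scaled_poly A Z"
  have *: "norm (coeff ([:c0, c1:] * ?p) i) \<le> (2 * A) * (2 * A) ^ size Z"
    if "norm c0 \<le> A" "norm c1 \<le> A" for c0 c1
  proof -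
    have "coeff ([:c0, c1:] * ?p) i = c0 * coeff ?p i + (case i of 0 \<Rightarrow> 0 | Suc j \<Rightarrow> c1 * coeff ?p j)"
      by (simp add: coeff_pCons split: nat.split)
    also have "norm \<dots> \<le> A * (2 * A) ^ size Z + A * (2 * A) ^ size Z"
      using that add assms
      by (intro norm_triangle_mono) (auto simp: norm_mult split: nat.split intro!: mult_mono)
    finally show ?thesis by (simp add: algebra_simps)
  qed
  have "\<exists>c0 c1. zero_factor A a = [:c0, c1:] \<and> norm c0 \<le> A \<and> norm c1 \<le> A"
  proof (cases "norm a \<le> A")
    case True
    then show ?thesis using assms by (intro exI[of _ "-a"] exI[of _ 1]) (auto simp: zero_factor_def)
  next
    case False
    then have "norm (1 / a) \<le> 1" using assms by (simp add: norm_divide divide_simps)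
    then show ?thesis using assms False
      by (intro exI[of _ 1] exI[of _ "-(1/a)"]) (auto simp: zero_factor_def)
  qed
  then show ?case using * by (auto simp: scaled_poly_def)
qed

lemma norm_scaled_poly_le:
  assumes "1 \<le> A" "norm z \<le> B"
  shows "norm (poly (scaled_poly A Z) z) \<le> (A + B) ^ size Z"
  unfolding poly_scaled_poly
proof (rule norm_prod_mset_le)
  fix a assume "a \<in># Z"
  show "norm (poly (zero_factor A a) z) \<le> A + B"
  proof (cases "norm a \<le> A")
    case True
    then show ?thesis using assms norm_triangle_ineq4[of z a] by (simp add: zero_factor_def)
  next
    case False
    then have "norm z * 1 \<le> norm z * norm a" using assms by (intro mult_left_mono) auto
    then have "norm (z / a) \<le> norm z" using False assms by (simp add: norm_divide divide_simps)
    then have "norm (1 - z / a) \<le> A + B" using assms norm_triangle_ineq4[of 1 "z / a"] by simp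
    then show ?thesis using False by (simp add: zero_factor_def)
  qed
qed

text \<open>The gap between the radii \<open>A / 2\<close> and \<open>A\<close> keeps
  \<open>z / a\<close> in the disc of radius 1/2.\<close>

lemma far_zero_factor_ge:
  assumes "1 \<le> A" "norm z \<le> A / 2" "A < norm a"
  shows "1 / 2 \<le> norm (poly (zero_factor A a) z)"
proof -
  have "norm (z / a) \<le> 1 / 2" using assms by (simp add: norm_divide divide_simps)
  then have "1 / 2 \<le> norm (1 - z / a)" using norm_triangle_ineq2[of 1 "z / a"] by simp
  then show ?thesis using assms by (simp add: zero_factor_def)
qed

lemma norm_scaled_poly_ge:
  assumes "1 \<le> A" "norm z \<le> A / 2" "0 \<le> \<delta>" "\<delta> \<le> 1 / 2" "\<And>a. a \<in># Z \<Longrightarrow> \<delta> \<le> norm (z - a)"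
  shows "\<delta> ^ size Z \<le> norm (poly (scaled_poly A Z) z)"
  unfolding poly_scaled_poly
proof (rule norm_prod_mset_ge)
  fix a assume a: "a \<in># Z"
  show "\<delta> \<le> norm (poly (zero_factor A a) z)"
  proof (cases "norm a \<le> A")
    case True
    then show ?thesis using assms(5)[OF a] by (simp add: zero_factor_def)
  next
    case False
    then show ?thesis using far_zero_factor_ge[of A z a] assms by simp
  qed
qed (fact assms)

text \<open>The zeros in \<open>cball 0 A\<close> form a monic polynomial, which is large somewhere
  on the circle; the remaining factors are at least 1/2 on the whole disc. The bound is thus
  independent of the position of the zeros, even if they lie in the disc itself.\<close>

lemma scaled_poly_large_point:
  assumes "1 \<le> A" "cball c t \<subseteq> cball 0 (A / 2)" "0 < t" "t \<le> 1 / 2"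
  obtains w where "w \<in> cball c t" "t ^ size Z \<le> norm (poly (scaled_poly A Z) w)"
proof -
  define Z1 Z2 where "Z1 = {#a \<in># Z. norm a \<le> A#}" and "Z2 = {#a \<in># Z. \<not> norm a \<le> A#}"
  have Z: "Z = Z1 + Z2" by (simp add: Z1_def Z2_def)
  have s1: "scaled_poly A Z1 = (\<Prod>a\<in>#Z1. [:- a, 1:])"
    unfolding scaled_poly_def
    by (rule arg_cong[of _ _ prod_mset], rule image_mset_cong) (simp add: zero_factor_def Z1_def)
  have "lead_coeff (\<Prod>a\<in>#Z1. [:- a, 1:]) = 1" "degree (\<Prod>a\<in>#Z1. [:- a, 1:]) = size Z1"
    by (fact prod_linear_monic degree_prod_linear)+
  then obtain w where w: "w \<in> cball c t" "t ^ size Z1 \<le> norm (poly (scaled_poly A Z1) w)"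
    using monic_large_point[of "scaled_poly A Z1" t c] assms(3) unfolding s1 by metis
  have "norm w \<le> A / 2" using w(1) assms(2) by auto
  then have "t ^ size Z2 \<le> norm (poly (scaled_poly A Z2) w)"
    unfolding poly_scaled_poly using assms
    by (intro norm_prod_mset_ge order_trans[OF _ far_zero_factor_ge]) (auto simp: Z2_def)
  then have "t ^ size Z1 * t ^ size Z2 \<le> norm (poly (scaled_poly A Z1) w) * norm (poly (scaled_poly A Z2) w)"
    using w assms by (intro mult_mono) auto
  then show thesis using w(1) that[of w] by (simp add: Z scaled_poly_def norm_mult power_add)
qed

section \<open>Polynomials with few zeros in a disc\<close>

text \<open>With \<open>N k\<close> tending to infinity, this says that the limsup of the
  \<open>N k\<close>-th roots of the sup norms on \<open>S\<close> is at most 1;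
  \<open>geometric_decay\<close> says that it is less than 1.\<close>

definition subexponential :: "(nat \<Rightarrow> nat) \<Rightarrow> (nat \<Rightarrow> complex \<Rightarrow> complex) \<Rightarrow> complex set \<Rightarrow> bool" where
  "subexponential N g S \<longleftrightarrow>
     (\<forall>\<epsilon>>0. \<forall>\<^sub>F k in sequentially. \<forall>z\<in>S. norm (g k z) \<le> exp (\<epsilon> * real (N k)))"

definition geometric_decay :: "(nat \<Rightarrow> nat) \<Rightarrow> (nat \<Rightarrow> complex \<Rightarrow> complex) \<Rightarrow> complex set \<Rightarrow> bool" where
  "geometric_decay N g S \<longleftrightarrow>
     (\<exists>\<delta>>0. \<forall>\<^sub>F k in sequentially. \<forall>z\<in>S. norm (g k z) \<le> exp (- \<delta> * real (N k)))"

lemma divide_out_zeros: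
  fixes p :: "complex poly"
  assumes "p \<noteq> 0"
  obtains g where "p = (\<Prod>a\<in>#{#a \<in># proots p. a \<in> S#}. [:- a, 1:]) * g" "\<And>a. a \<in> S \<Longrightarrow> poly g a \<noteq> 0"
proof
  define g where "g = smult (lead_coeff p) (\<Prod>a\<in>#{#a \<in># proots p. a \<notin> S#}. [:- a, 1:])"
  have "smult (lead_coeff p) (\<Prod>a\<in>#proots p. [:- a, 1:]) = (\<Prod>a\<in>#{#a \<in># proots p. a \<in> S#}. [:- a, 1:]) * g"
    unfolding g_def mult_smult_right prod_mset.union[symmetric] image_mset_union[symmetric]
    by (simp flip: multiset_partition)
  then show "p = (\<Prod>a\<in>#{#a \<in># proots p. a \<in> S#}. [:- a, 1:]) * g"
    by (simp add: complex_poly_decompose_multiset)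
  show "poly g a \<noteq> 0" if "a \<in> S" for a
    using assms that by (auto simp: g_def poly_prod_linear prod_mset_zero_iff)
qed

text \<open>On the circle of radius \<open>2 * r\<close> each divided factor has modulus at least
  \<open>r\<close>, and the maximum principle carries the bound for the quotient inwards.\<close>

lemma quotient_bound_disc:
  fixes g :: "complex poly"
  assumes "\<And>z. z \<in> cball z0 (2 * r) \<Longrightarrow> norm (poly ((\<Prod>a\<in>#Y. [:- a, 1:]) * g) z) \<le> M"
    and Y: "\<And>a. a \<in># Y \<Longrightarrow> a \<in> ball z0 r" and "0 < r" and z: "z \<in> cball z0 (2 * r)"
  shows "norm (poly g z) \<le> M / r ^ size Y"
proof (rule maximum_modulus_frontier[of "poly g" "cball z0 (2 * r)"])
  fix w assume "w \<in> frontier (cball z0 (2 * r))"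
  then have w: "dist z0 w = 2 * r" using \<open>0 < r\<close> by simp
  have "r \<le> norm (w - a)" if "a \<in># Y" for a
    using w Y[OF that] dist_triangle[of z0 w a] by (simp add: dist_norm norm_minus_commute)
  then have "r ^ size Y \<le> norm (\<Prod>a\<in>#Y. w - a)" using \<open>0 < r\<close>
    by (intro norm_prod_mset_ge) auto
  then have "r ^ size Y * norm (poly g w) \<le> norm (\<Prod>a\<in>#Y. w - a) * norm (poly g w)"
    by (intro mult_right_mono) auto
  also have "\<dots> \<le> M" using assms(1)[of w] w by (simp add: poly_prod_linear norm_mult)
  finally show "norm (poly g w) \<le> M / r ^ size Y" using \<open>0 < r\<close> by (simp add: field_simps)
qed (use z in \<open>auto intro!: holomorphic_intros continuous_intros\<close>)

text \<open>The factors with zeros near \<open>c\<close> are divided out on the circle of radius \<open>s\<close>, the others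
  afterwards on the smaller disc, where they are bounded below.\<close>

lemma quotient_bound_small_disc:
  fixes g :: "complex poly"
  assumes "\<And>z. z \<in> cball c s \<Longrightarrow> norm (poly ((\<Prod>a\<in>#Y. [:- a, 1:]) * g) z) \<le> M"
    and "0 < s" and z: "z \<in> cball c (s / 4)"
  shows "norm (poly g z) \<le> M * (4 / s) ^ size Y"
proof -
  define Y1 Y2 where "Y1 = {#a \<in># Y. a \<in> ball c (s / 2)#}" and "Y2 = {#a \<in># Y. a \<notin> ball c (s / 2)#}"
  have Y: "Y = Y1 + Y2" by (simp add: Y1_def Y2_def)
  have M0: "0 \<le> M" using assms(1)[of c] \<open>0 < s\<close>
    by (metis centre_in_cball less_eq_real_def norm_ge_zero order_trans)
  have "norm (poly ((\<Prod>a\<in>#Y1. [:- a, 1:]) * ((\<Prod>a\<in>#Y2. [:- a, 1:]) * g)) z) \<le> M"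
    if "z \<in> cball c (2 * (s / 2))" for z
    using assms(1)[of z] that by (simp add: Y mult.assoc)
  from quotient_bound_disc[of c "s / 2" Y1 _ M z, OF this]
  have "norm (poly ((\<Prod>a\<in>#Y2. [:- a, 1:]) * g) z) \<le> M / (s / 2) ^ size Y1"
    using \<open>0 < s\<close> z by (auto simp: Y1_def)
  moreover have "(s / 4) ^ size Y2 \<le> norm (\<Prod>a\<in>#Y2. z - a)"
  proof (rule norm_prod_mset_ge)
    fix a assume "a \<in># Y2"
    then have "s / 2 \<le> dist c a" by (auto simp: Y2_def)
    then show "s / 4 \<le> norm (z - a)" using z dist_triangle[of c a z] by (simp add: dist_norm)
  qed (use \<open>0 < s\<close> in simp)
  then have "(s / 4) ^ size Y2 * norm (poly g z) \<le> norm (poly ((\<Prod>a\<in>#Y2. [:- a, 1:]) * g) z)"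
    by (simp add: poly_prod_linear norm_mult mult_right_mono)
  ultimately have "(s / 4) ^ size Y2 * norm (poly g z) \<le> M / (s / 2) ^ size Y1" by linarith
  then have "norm (poly g z) \<le> M * (2 / s) ^ size Y1 * (4 / s) ^ size Y2"
    using \<open>0 < s\<close> by (simp add: field_simps)
  also have "\<dots> \<le> M * (4 / s) ^ size Y1 * (4 / s) ^ size Y2"
    using M0 \<open>0 < s\<close>
    by (intro mult_right_mono mult_left_mono power_mono) (auto simp: divide_simps)
  finally show ?thesis by (simp add: Y power_add mult.assoc)
qed

text \<open>By Montel's theorem a limit of the \<open>H k\<close> has modulus at most \<open>1\<close> on the disc around \<open>c\<close> and
  attains modulus \<open>1\<close> there, so it is constant.\<close>

lemma modulus_limit_one:
  fixes H :: "nat \<Rightarrow> complex \<Rightarrow> complex"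
  assumes hol: "\<And>k. H k holomorphic_on ball z0 r" and bd: "\<And>k z. z \<in> ball z0 r \<Longrightarrow> norm (H k z) \<le> B"
    and c: "cball c s \<subseteq> ball z0 r" "0 < t" "t < s"
    and up: "\<And>\<eta>. 0 < \<eta> \<Longrightarrow> \<forall>\<^sub>F k in sequentially. \<forall>z\<in>cball c s. norm (H k z) \<le> exp \<eta>"
    and low: "\<And>\<eta>. 0 < \<eta> \<Longrightarrow> \<forall>\<^sub>F k in sequentially. \<exists>z\<in>cball c t. exp (- \<eta>) \<le> norm (H k z)"
    and "0 < \<eta>" and K: "compact K" "K \<subseteq> ball z0 r"
  shows "\<forall>\<^sub>F k in sequentially. \<forall>z\<in>K. norm (H k z) \<le> exp \<eta>"
proof (rule ccontr)
  assume "\<not> ?thesis"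
  then obtain \<sigma> :: "nat \<Rightarrow> nat" where \<sigma>: "strict_mono \<sigma>" "\<And>k. \<not> (\<forall>z\<in>K. norm (H (\<sigma> k) z) \<le> exp \<eta>)"
    using not_eventually_sequentiallyD by blast
  obtain h \<rho> where h: "h holomorphic_on ball z0 r" "strict_mono (\<rho> :: nat \<Rightarrow> nat)"
      "\<And>x. x \<in> ball z0 r \<Longrightarrow> (\<lambda>n. H (\<sigma> (\<rho> n)) x) \<longlonglongrightarrow> h x"
      "\<And>K. compact K \<Longrightarrow> K \<subseteq> ball z0 r \<Longrightarrow> uniform_limit K ((\<lambda>k. H (\<sigma> k)) \<circ> \<rho>) h sequentially"
    using Montel[of "ball z0 r" "range H" "\<lambda>k. H (\<sigma> k)"] hol bd
    by (smt (verit, ccfv_threshold) imageE image_subset_iff open_ball rangeI subsetD)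
  define \<tau> where "\<tau> = \<sigma> \<circ> \<rho>"
  have \<tau>: "strict_mono \<tau>" using \<sigma>(1) h(2) by (simp add: \<tau>_def strict_mono_o)
  \<comment> \<open>The bound \<open>exp \<eta>\<close> survives the limit for every positive
    \<open>\<eta>\<close>; half of \<open>ln (norm (h z))\<close> refutes a value above 1.\<close>
  have le1: "norm (h z) \<le> 1" if z: "z \<in> cball c s" for z
  proof -
    have "norm (h z) \<le> exp \<eta>" if "0 < \<eta>" for \<eta>
    proof (rule tendsto_upperbound)
      show "(\<lambda>n. norm (H (\<tau> n) z)) \<longlonglongrightarrow> norm (h z)"
        using h(3)[of z] z c(1) by (auto simp: \<tau>_def o_def intro!: tendsto_norm)
      show "\<forall>\<^sub>F n in sequentially. norm (H (\<tau> n) z) \<le> exp \<eta>"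
        using eventually_subseq[OF \<tau> up[OF that]] by eventually_elim (use z in auto)
    qed simp
    from this[of "ln (norm (h z)) / 2"] show ?thesis
    proof (rule_tac ccontr)
      assume "\<not> norm (h z) \<le> 1"
      then have gt: "1 < norm (h z)" by simp
      then have "exp (ln (norm (h z))) = norm (h z)" by (subst exp_ln) linarith+
      moreover have "0 < ln (norm (h z))" using gt by (rule ln_gt_zero)
      ultimately have "exp (ln (norm (h z)) / 2) < norm (h z)"
        using exp_less_mono[of "ln (norm (h z)) / 2" "ln (norm (h z))"] by linarith
      then show False
        using \<open>0 < ln (norm (h z)) / 2 \<Longrightarrow> norm (h z) \<le> exp (ln (norm (h z)) / 2)\<close> \<open>0 < ln (norm (h z))\<close> by simp
    qed
  qed
  have "compact (cball c t)" "cball c t \<noteq> {}" "continuous_on (cball c t) (\<lambda>z. norm (h z))"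
    using c by (auto intro!: continuous_intros holomorphic_on_imp_continuous_on holomorphic_on_subset[OF h(1)])
  then obtain w where w: "w \<in> cball c t" "\<And>z. z \<in> cball c t \<Longrightarrow> norm (h z) \<le> norm (h w)"
    using continuous_attains_sup[of "cball c t" "\<lambda>z. norm (h z)"] by blast
  \<comment> \<open>If the maximum over \<open>cball c t\<close> were below some
    \<open>b < 1\<close>, uniform convergence would push \<open>H\<close> below \<open>b\<close>
    there, against \<open>low\<close> taken with \<open>- ln b\<close>.\<close>
  have hw: "1 \<le> norm (h w)"
  proof (rule ccontr)
    assume "\<not> ?thesis"
    then obtain b where b: "norm (h w) < b" "b < 1" using dense by (metis not_le)
    have b0: "0 < b" using b norm_ge_zero[of "h w"] by linarith
    have "cball c t \<subseteq> ball z0 r" using c by (meson less_imp_le subset_cball subset_trans)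
    then have "uniform_limit (cball c t) ((\<lambda>k. H (\<sigma> k)) \<circ> \<rho>) h sequentially"
      by (intro h(4)) auto
    then have "\<forall>\<^sub>F n in sequentially. \<forall>z\<in>cball c t. dist (H (\<tau> n) z) (h z) < b - norm (h w)"
      using b by (auto simp: uniform_limit_iff \<tau>_def)
    moreover have "\<forall>\<^sub>F n in sequentially. \<exists>z\<in>cball c t. exp (- (- ln b)) \<le> norm (H (\<tau> n) z)"
      using eventually_subseq[OF \<tau> low[of "- ln b"]] b b0 by simp
    ultimately have "\<forall>\<^sub>F n in sequentially. False"
    proof eventually_elim
      case (elim n)
      then obtain z where z: "z \<in> cball c t" "b \<le> norm (H (\<tau> n) z)" using b0 by auto
      then have "norm (H (\<tau> n) z) < b"
        using elim(1) w(2)[OF z(1)] norm_triangle_sub[of "H (\<tau> n) z" "h z"]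
        by (fastforce simp: dist_norm)
      then show False using z by simp
    qed
    then show False by simp
  qed
  have "h constant_on ball z0 r"
  proof (rule maximum_modulus_principle[OF h(1), of "ball c s" w])
    show "norm (h z) \<le> norm (h w)" if "z \<in> ball c s" for z using le1[of z] hw that by simp
    show "w \<in> ball c s" using w(1) c by auto
  qed (use c in auto)
  then have const: "norm (h z) \<le> 1" if "z \<in> ball z0 r" for z
    using le1[of w] w(1) c that unfolding constant_on_def
    by (metis less_eq_real_def mem_cball order_trans subsetD)
  \<comment> \<open>With \<open>norm (h z)\<close> at most 1, the tolerance
    \<open>exp \<eta> - 1\<close> leads to the bound \<open>exp \<eta>\<close> that
    \<open>\<sigma>\<close> was chosen to violate.\<close>
  have "\<forall>\<^sub>F n in sequentially. \<forall>z\<in>K. dist (H (\<tau> n) z) (h z) < exp \<eta> - 1"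
    using h(4)[OF K] \<open>0 < \<eta>\<close> by (auto simp: uniform_limit_iff \<tau>_def)
  then have "\<forall>\<^sub>F n in sequentially. False"
  proof eventually_elim
    case (elim n)
    have "norm (H (\<tau> n) z) \<le> exp \<eta>" if "z \<in> K" for z
      using elim const[of z] that K norm_triangle_sub[of "H (\<tau> n) z" "h z"]
      by (fastforce simp: dist_norm)
    then show False using \<sigma>(2)[of "\<rho> n"] by (auto simp: \<tau>_def)
  qed
  then show False by simp
qed

text \<open>The absolute value of the logarithm covers bases on both sides of 1. With
  \<open>j\<close> the number of zeros, it shows that multiplying or dividing by few factors costs
  only a subexponential amount.\<close>

lemma power_le_exp_linear:
  fixes x \<epsilon> n :: real
  assumes "0 < x" "real j \<le> \<epsilon> * n"
  shows "x ^ j \<le> exp (\<bar>ln x\<bar> * (\<epsilon> * n))"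
proof -
  have "x ^ j = exp (real j * ln x)" using assms by (simp add: exp_of_nat_mult)
  also have "real j * ln x \<le> (\<epsilon> * n) * \<bar>ln x\<bar>"
    using mult_left_mono[OF abs_ge_self[of "ln x"], of "real j"] mult_right_mono[OF assms(2), of "\<bar>ln x\<bar>"] by linarith
  finally show ?thesis by (simp add: mult.commute)
qed

text \<open>Without its zeros in the disc, \<open>p k\<close> has a holomorphic
  \<open>N k\<close>-th root there. These roots are uniformly bounded because \<open>p k\<close>
  grows at most exponentially, and on the small disc their moduli are asymptotically at most 1 and
  somewhere at least 1. So \<open>modulus_limit_one\<close> applies on the whole disc, and the few
  factors are then multiplied back.\<close>

lemma few_zeros_subexponential:
  fixes p :: "nat \<Rightarrow> complex poly" and N :: "nat \<Rightarrow> nat"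
  assumes N: "filterlim N at_top sequentially" and r: "0 < r" and C: "1 \<le> C"
    and bound: "\<forall>\<^sub>F k in sequentially. \<forall>z\<in>cball z0 (2 * r). norm (poly (p k) z) \<le> C ^ N k"
    and zeros: "\<And>\<epsilon>. 0 < \<epsilon> \<Longrightarrow>
      \<forall>\<^sub>F k in sequentially. real (size {#a \<in># proots (p k). a \<in> ball z0 r#}) \<le> \<epsilon> * real (N k)"
    and c: "cball c s \<subseteq> ball z0 r" "0 < s"
    and sub: "subexponential N (\<lambda>k. poly (p k)) (cball c s)"
    and l: "0 < l" and low: "\<forall>\<^sub>F k in sequentially. \<exists>w\<in>cball c (s / 8). l \<le> norm (poly (p k) w)"
  shows "subexponential N (\<lambda>k. poly (p k)) (cball z0 (r / 2))"
proof -
  define Y where "Y k = {#a \<in># proots (p k). a \<in> ball z0 r#}" for k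
  have "\<exists>g. p k \<noteq> 0 \<longrightarrow> p k = (\<Prod>a\<in>#Y k. [:- a, 1:]) * g \<and> (\<forall>a\<in>ball z0 r. poly g a \<noteq> 0)" for k
    unfolding Y_def by (metis divide_out_zeros)
  then obtain g where g: "\<And>k. p k \<noteq> 0 \<Longrightarrow> p k = (\<Prod>a\<in>#Y k. [:- a, 1:]) * g k"
      "\<And>k a. p k \<noteq> 0 \<Longrightarrow> a \<in> ball z0 r \<Longrightarrow> poly (g k) a \<noteq> 0" by metis
  have "\<exists>h. p k \<noteq> 0 \<longrightarrow> h holomorphic_on ball z0 r \<and> (\<forall>z\<in>ball z0 r. poly (g k) z = exp (h z))" for k
  proof (cases "p k = 0")
    case False
    have "contractible (ball z0 r)" by (simp add: convex_imp_contractible)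
    moreover have "poly (g k) holomorphic_on ball z0 r" by (intro holomorphic_intros)
    ultimately show ?thesis
      using contractible_imp_holomorphic_log[of "poly (g k)" "ball z0 r"] g(2)[OF False] by metis
  qed auto
  then obtain h where h: "\<And>k. p k \<noteq> 0 \<Longrightarrow> h k holomorphic_on ball z0 r"
      "\<And>k z. p k \<noteq> 0 \<Longrightarrow> z \<in> ball z0 r \<Longrightarrow> poly (g k) z = exp (h k z)" by metis
  define good where "good k \<longleftrightarrow> p k \<noteq> 0 \<and> 0 < N k \<and>
     (\<forall>z\<in>cball z0 (2 * r). norm (poly (p k) z) \<le> C ^ N k) \<and> size (Y k) \<le> N k" for k
  have ev_good: "\<forall>\<^sub>F k in sequentially. good k"
    using bound zeros[of 1, OF zero_less_one] low N[unfolded filterlim_at_top, rule_format, of 1]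
  proof eventually_elim
    case (elim k)
    then show ?case using l by (auto simp: good_def Y_def)
  qed
  \<comment> \<open>The default value 1 makes the hypotheses of \<open>modulus_limit_one\<close>
    hold for all \<open>k\<close>, not only eventually.\<close>
  define H where "H k = (if good k then (\<lambda>z. exp (h k z / of_nat (N k))) else (\<lambda>_. 1))" for k
  have holH: "H k holomorphic_on ball z0 r" for k
    using h(1)[of k] by (auto simp: H_def good_def intro!: holomorphic_intros)
  have Hpow: "norm (H k z) ^ N k = norm (poly (g k) z)" if "good k" "z \<in> ball z0 r" for k z
  proof -
    have "exp (h k z / of_nat (N k)) ^ N k = exp (h k z)"
      using that by (simp add: good_def flip: exp_of_nat_mult)
    then show ?thesis using that h(2)[of k z]
      by (simp add: H_def good_def del: norm_exp_eq_Re flip: norm_power)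
  qed
  have Hle: "norm (H k z) \<le> x" if "good k" "z \<in> ball z0 r" "norm (poly (g k) z) \<le> x ^ N k" "0 \<le> x" for k z x
    using that Hpow[of k z] by (metis good_def norm_ge_zero power_mono_iff)
  have Hge: "x \<le> norm (H k z)" if "good k" "z \<in> ball z0 r" "x ^ N k \<le> norm (poly (g k) z)" "0 \<le> x" for k z x
    using that Hpow[of k z] by (metis good_def norm_ge_zero power_mono_iff)
  \<comment> \<open>Dividing out at most \<open>N k\<close> factors costs at most
    \<open>max 1 (1 / r) ^ N k\<close>.\<close>
  define B where "B = C * max 1 (1 / r)"
  have B: "1 \<le> B" using C unfolding B_def by (metis max.cobounded1 mult_mono' mult_1 zero_le_one)
  have bdH: "norm (H k z) \<le> B" if z: "z \<in> ball z0 r" for k z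
  proof (cases "good k")
    case True
    have "norm (poly (g k) z) \<le> C ^ N k / r ^ size (Y k)"
    proof (rule quotient_bound_disc[of z0 r "Y k" "g k"])
      show "norm (poly ((\<Prod>a\<in>#Y k. [:- a, 1:]) * g k) z) \<le> C ^ N k" if "z \<in> cball z0 (2 * r)" for z
        using True that g(1)[of k] by (auto simp: good_def)
    qed (use r z in \<open>auto simp: Y_def\<close>)
    also have "\<dots> = C ^ N k * (1 / r) ^ size (Y k)" by (simp add: power_divide)
    also have "\<dots> \<le> C ^ N k * (max 1 (1 / r)) ^ N k"
      using C r True
      by (intro mult_left_mono order_trans[OF power_mono power_increasing]) (auto simp: good_def)
    finally show ?thesis using Hle[OF True z, of B] B by (simp add: B_def power_mult_distrib)
  qed (use B in \<open>simp add: H_def\<close>)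
  have prod_le: "norm (\<Prod>a\<in>#Y k. z - a) \<le> (2 * r) ^ size (Y k)" if "z \<in> ball z0 r" for k z
  proof (rule norm_prod_mset_le)
    fix a assume "a \<in># Y k"
    then show "norm (z - a) \<le> 2 * r"
      using that dist_triangle[of z a z0] by (simp add: Y_def dist_norm norm_minus_commute)
  qed
  have p_eq: "norm (poly (p k) z) = norm (\<Prod>a\<in>#Y k. z - a) * norm (poly (g k) z)" if "good k" for k z
  proof -
    have "poly (p k) z = poly ((\<Prod>a\<in>#Y k. [:- a, 1:]) * g k) z" using that g(1)[of k]
      by (simp add: good_def)
    then show ?thesis by (simp add: poly_prod_linear norm_mult)
  qed
  have up: "\<forall>\<^sub>F k in sequentially. \<forall>z\<in>cball c (s / 4). norm (H k z) \<le> exp \<eta>" if "0 < \<eta>" for \<eta>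
  proof -
    \<comment> \<open>The summand 1 pays for the growth of \<open>p k\<close> on the small disc, the
      logarithm for the divided factors; \<open>\<epsilon> * L = \<eta>\<close> is the total
      exponent.\<close>
    define L where "L = 1 + \<bar>ln (4 / s)\<bar>"
    define \<epsilon> where "\<epsilon> = \<eta> / L"
    have L: "0 < L" "0 < \<epsilon>" using that by (auto simp: L_def \<epsilon>_def add_pos_nonneg)
    show ?thesis
      using sub[unfolded subexponential_def, rule_format, OF L(2)] zeros[OF L(2)] ev_good
    proof eventually_elim
      case (elim k)
      show ?case
      proof
        fix z assume z: "z \<in> cball c (s / 4)"
        have "z \<in> cball c s" using z c(2) by simp
        then have zb: "z \<in> ball z0 r" using c by blast
        have "norm (poly (g k) z) \<le> exp (\<epsilon> * real (N k)) * (4 / s) ^ size (Y k)"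
          using elim(1) z c(2) g(1)[of k] elim(3)
          by (intro quotient_bound_small_disc[of c s "Y k" "g k"]) (auto simp: good_def)
        also have "\<dots> \<le> exp (\<epsilon> * real (N k)) * exp (\<bar>ln (4 / s)\<bar> * (\<epsilon> * real (N k)))"
          using c elim(2) by (intro mult_left_mono power_le_exp_linear) (auto simp: Y_def)
        also have "\<dots> = exp (L * \<epsilon> * real (N k))"
          by (simp add: L_def algebra_simps flip: exp_add)
        also have "\<dots> = exp \<eta> ^ N k" using L
          by (simp add: \<epsilon>_def mult.commute flip: exp_of_nat_mult)
        finally show "norm (H k z) \<le> exp \<eta>" using Hle[OF elim(3) zb] by simp
      qed
    qed
  qed
  \<comment> \<open>The factors are now estimated from above, by \<open>2 * r\<close> each. In the
    lower bound the summand 1 absorbs the constant \<open>l\<close>, in the final estimate it pays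
    for \<open>H k\<close>.\<close>
  define L where "L = 1 + \<bar>ln (2 * r)\<bar>"
  have L: "0 < L" by (simp add: L_def add_pos_nonneg)
  have lo: "\<forall>\<^sub>F k in sequentially. \<exists>z\<in>cball c (s / 8). exp (- \<eta>) \<le> norm (H k z)" if "0 < \<eta>" for \<eta>
  proof -
    define \<epsilon> where "\<epsilon> = \<eta> / L"
    have \<epsilon>: "0 < \<epsilon>" using that L by (auto simp: \<epsilon>_def)
    have "filterlim (\<lambda>k. real (N k)) at_top sequentially"
      using N filterlim_compose filterlim_real_sequentially by blast
    then have "\<forall>\<^sub>F k in sequentially. - ln l / \<epsilon> \<le> real (N k)"
      by (simp add: filterlim_at_top)
    then show ?thesis
      using low zeros[OF \<epsilon>] ev_good
    proof eventually_elim
      case (elim k)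
      obtain w where w: "w \<in> cball c (s / 8)" "l \<le> norm (poly (p k) w)" using elim(2) by blast
      have "w \<in> cball c s" using w(1) c(2) by simp
      then have wb: "w \<in> ball z0 r" using c by blast
      have "- ln l \<le> \<epsilon> * real (N k)" using elim(1) \<epsilon> by (simp add: field_simps)
      then have "exp (- \<epsilon> * real (N k)) \<le> l" using l
        by (metis exp_le_cancel_iff exp_ln minus_le_iff mult_minus_left)
      also have "l \<le> norm (\<Prod>a\<in>#Y k. w - a) * norm (poly (g k) w)" using w(2) p_eq[OF elim(4)]
        by simp
      also have "\<dots> \<le> exp (\<bar>ln (2 * r)\<bar> * (\<epsilon> * real (N k))) * norm (poly (g k) w)"
        using elim(3) r
        by (intro mult_right_mono order_trans[OF prod_le[OF wb] power_le_exp_linear]) (auto simp: Y_def)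
      finally have "exp (- \<epsilon> * real (N k)) * exp (- \<bar>ln (2 * r)\<bar> * (\<epsilon> * real (N k))) \<le> norm (poly (g k) w)"
        by (simp add: exp_minus field_simps)
      also have "exp (- \<epsilon> * real (N k)) * exp (- \<bar>ln (2 * r)\<bar> * (\<epsilon> * real (N k))) = exp (- L * \<epsilon> * real (N k))"
        by (simp add: L_def algebra_simps flip: exp_add)
      also have "\<dots> = exp (- \<eta>) ^ N k" using L
        by (simp add: \<epsilon>_def mult.commute flip: exp_of_nat_mult)
      finally show ?case using Hge[OF elim(4) wb] w(1) by (intro bexI[of _ w]) auto
    qed
  qed
  show ?thesis unfolding subexponential_def
  proof (intro allI impI)
    fix \<epsilon>0 :: real assume "0 < \<epsilon>0"
    define \<epsilon> where "\<epsilon> = \<epsilon>0 / L"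
    have \<epsilon>: "0 < \<epsilon>" using \<open>0 < \<epsilon>0\<close> L by (auto simp: \<epsilon>_def)
    have "\<forall>\<^sub>F k in sequentially. \<forall>z\<in>cball z0 (r / 2). norm (H k z) \<le> exp \<epsilon>"
    proof (rule modulus_limit_one[where ?z0.0 = z0 and r = r and c = c and s = "s / 4" and t = "s / 8"])
      show "cball c (s / 4) \<subseteq> ball z0 r" using c by (auto intro: subset_trans[OF subset_cball])
      show "cball z0 (r / 2) \<subseteq> ball z0 r" using r by auto
    qed (use holH bdH up lo \<epsilon> c in auto)
    then show "\<forall>\<^sub>F k in sequentially. \<forall>z\<in>cball z0 (r / 2). norm (poly (p k) z) \<le> exp (\<epsilon>0 * real (N k))"
      using zeros[OF \<epsilon>] ev_good
    proof eventually_elim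
      case (elim k)
      show ?case
      proof
        fix z assume z: "z \<in> cball z0 (r / 2)"
        then have zb: "z \<in> ball z0 r" using r by auto
        have "norm (poly (g k) z) \<le> exp \<epsilon> ^ N k"
          using Hpow[OF elim(3) zb] elim(1) z by (metis norm_ge_zero power_mono)
        then have "norm (poly (g k) z) \<le> exp (\<epsilon> * real (N k))"
          by (simp add: mult.commute flip: exp_of_nat_mult)
        moreover have "norm (\<Prod>a\<in>#Y k. z - a) \<le> exp (\<bar>ln (2 * r)\<bar> * (\<epsilon> * real (N k)))"
          using elim(2) r by (intro order_trans[OF prod_le[OF zb] power_le_exp_linear]) (auto simp: Y_def)
        ultimately have "norm (poly (p k) z) \<le> exp (\<bar>ln (2 * r)\<bar> * (\<epsilon> * real (N k))) * exp (\<epsilon> * real (N k))"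
          unfolding p_eq[OF elim(3)] by (intro mult_mono) auto
        also have "\<dots> = exp (L * \<epsilon> * real (N k))"
          by (simp add: L_def algebra_simps flip: exp_add)
        finally show "norm (poly (p k) z) \<le> exp (\<epsilon>0 * real (N k))" using L
          by (simp add: \<epsilon>_def)
      qed
    qed
  qed
qed

section \<open>Propagation of geometric decay\<close>

text \<open>The maximum principle for \<open>f w / (w - c) ^ J\<close> on the annulus between radii
  \<open>s\<close> and \<open>r\<close>. The integer \<open>J\<close> replaces the real exponent of
  Hadamard's theorem, so no logarithm of the modulus is needed; the choice of \<open>J\<close> is
  left to the application.\<close>

lemma three_circles_power:
  assumes hol: "f holomorphic_on cball c r" and "0 < s" "s \<le> t" "t \<le> r"
    and \<delta>: "\<And>z. z \<in> cball c s \<Longrightarrow> norm (f z) \<le> \<delta>" and M: "\<And>z. z \<in> cball c r \<Longrightarrow> norm (f z) \<le> M"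
    and z: "z \<in> cball c t"
  shows "norm (f z) \<le> max (\<delta> * (t / s) ^ J) (M * (t / r) ^ J)"
proof (cases "z \<in> cball c s")
  case True
  have "0 \<le> \<delta>" using \<delta>[OF True] norm_ge_zero order_trans by blast
  moreover have "1 \<le> (t / s) ^ J" using assms by (intro one_le_power) auto
  ultimately have "\<delta> * 1 \<le> \<delta> * (t / s) ^ J" by (intro mult_left_mono)
  then show ?thesis using \<delta>[OF True] by (simp add: max_def)
next
  case False
  define S where "S = cball c r - ball c s"
  define b where "b = max (\<delta> / s ^ J) (M / r ^ J)"
  have zS: "z \<in> S" using False z assms by (auto simp: S_def)
  have cl: "closed S" by (auto simp: S_def intro!: closed_Diff)
  have hS: "(\<lambda>w. f w / (w - c) ^ J) holomorphic_on S"
    using \<open>0 < s\<close>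
    by (auto simp: S_def intro!: holomorphic_intros holomorphic_on_subset[OF hol])
  have "norm (f z / (z - c) ^ J) \<le> b"
  proof (rule maximum_modulus_frontier[of "\<lambda>w. f w / (w - c) ^ J" S])
    show "(\<lambda>w. f w / (w - c) ^ J) holomorphic_on interior S"
      using hS interior_subset holomorphic_on_subset by blast
    show "continuous_on (closure S) (\<lambda>w. f w / (w - c) ^ J)"
      using hS cl holomorphic_on_imp_continuous_on by simp
    show "bounded S" by (auto simp: S_def intro: bounded_subset[of "cball c r"])
    fix w assume w: "w \<in> frontier S"
    have "ball c r - cball c s \<subseteq> interior S" by (rule interior_maximal) (auto simp: S_def)
    then have "w \<in> S" "w \<notin> ball c r - cball c s" using w cl by (auto simp: frontier_def)
    then have "norm (w - c) = r \<or> norm (w - c) = s" using assms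
      by (auto simp: S_def dist_norm norm_minus_commute)
    then show "norm (f w / (w - c) ^ J) \<le> b"
    proof
      assume *: "norm (w - c) = r"
      then have "norm (f w) \<le> M" using M[of w] by (simp add: dist_norm norm_minus_commute)
      then have "norm (f w / (w - c) ^ J) \<le> M / r ^ J" using * assms
        by (simp add: norm_divide norm_power divide_right_mono)
      then show ?thesis by (simp add: b_def)
    next
      assume *: "norm (w - c) = s"
      then have "norm (f w) \<le> \<delta>" using \<delta>[of w] by (simp add: dist_norm norm_minus_commute)
      then have "norm (f w / (w - c) ^ J) \<le> \<delta> / s ^ J" using * assms
        by (simp add: norm_divide norm_power divide_right_mono)
      then show ?thesis by (simp add: b_def)
    qed
  qed (fact zS)
  then have le: "norm (f z) \<le> b * norm (z - c) ^ J"
  proof -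
    have "0 < norm (z - c)" using zS \<open>0 < s\<close> by (auto simp: S_def)
    then show ?thesis using \<open>norm (f z / (z - c) ^ J) \<le> b\<close>
      by (simp add: norm_divide norm_power pos_divide_le_eq)
  qed
  have "0 \<le> \<delta>" using \<delta>[of c] \<open>0 < s\<close>
    by (metis centre_in_cball less_imp_le norm_ge_zero order_trans)
  then have "0 \<le> b" using \<open>0 < s\<close> by (simp add: b_def le_max_iff_disj)
  then have "b * norm (z - c) ^ J \<le> b * t ^ J"
    using z by (intro mult_left_mono power_mono) (auto simp: dist_norm norm_minus_commute)
  also have "\<dots> = max (\<delta> * (t / s) ^ J) (M * (t / r) ^ J)"
    using assms by (simp add: b_def max_mult_distrib_right power_divide)
  finally show ?thesis using le by simp
qed

lemma geometric_decay_mono: "geometric_decay N g S \<Longrightarrow> T \<subseteq> S \<Longrightarrow> geometric_decay N g T"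
  unfolding geometric_decay_def by (fast elim: eventually_mono)

lemma subexponential_mono: "subexponential N g S \<Longrightarrow> T \<subseteq> S \<Longrightarrow> subexponential N g T"
  unfolding subexponential_def by (fast elim: eventually_mono)

lemma geometric_decay_Un:
  assumes "geometric_decay N g S" "geometric_decay N g T"
  shows "geometric_decay N g (S \<union> T)"
proof -
  obtain \<delta>1 \<delta>2 where *: "\<delta>1 > 0" "\<forall>\<^sub>F k in sequentially. \<forall>z\<in>S. norm (g k z) \<le> exp (- \<delta>1 * real (N k))"
      "\<delta>2 > 0" "\<forall>\<^sub>F k in sequentially. \<forall>z\<in>T. norm (g k z) \<le> exp (- \<delta>2 * real (N k))"
    using assms unfolding geometric_decay_def by blast
  have "\<forall>\<^sub>F k in sequentially. \<forall>z\<in>S \<union> T. norm (g k z) \<le> exp (- min \<delta>1 \<delta>2 * real (N k))"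
    using *(2,4)
  proof eventually_elim
    case (elim k)
    have "exp (- \<delta>1 * real (N k)) \<le> exp (- min \<delta>1 \<delta>2 * real (N k))"
      "exp (- \<delta>2 * real (N k)) \<le> exp (- min \<delta>1 \<delta>2 * real (N k))"
      by (auto intro!: mult_right_mono)
    then show ?case using elim by (metis Un_iff order_trans)
  qed
  then show ?thesis using *(1,3) unfolding geometric_decay_def
    by (intro exI[of _ "min \<delta>1 \<delta>2"]) auto
qed

lemma geometric_decay_UN:
  assumes "finite I" "\<And>i. i \<in> I \<Longrightarrow> geometric_decay N g (S i)"
  shows "geometric_decay N g (\<Union>i\<in>I. S i)"
  using assms
proof (induction I)
  case empty
  then show ?case by (auto simp: geometric_decay_def intro: exI[of _ 1])
qed (simp add: geometric_decay_Un)

lemma subexponential_Un: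
  assumes "subexponential N g S" "subexponential N g T"
  shows "subexponential N g (S \<union> T)"
  unfolding subexponential_def
proof (intro allI impI)
  fix \<epsilon> :: real assume "0 < \<epsilon>"
  then show "\<forall>\<^sub>F k in sequentially. \<forall>z\<in>S \<union> T. norm (g k z) \<le> exp (\<epsilon> * real (N k))"
    using assms unfolding subexponential_def by (auto intro: eventually_elim2)
qed

lemma subexponential_UN:
  assumes "finite I" "\<And>i. i \<in> I \<Longrightarrow> subexponential N g (S i)"
  shows "subexponential N g (\<Union>i\<in>I. S i)"
  using assms by (induction I) (auto simp: subexponential_Un, simp add: subexponential_def)

text \<open>With \<open>J\<close> about \<open>\<theta> * N k\<close>, a small
  \<open>\<theta>\<close> leaves part of the decay on the inner disc, while any positive
  \<open>\<theta>\<close> makes \<open>(t / r) ^ J\<close> decay geometrically and beat the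
  subexponential growth on the outer disc.\<close>

lemma geometric_decay_larger_disc:
  fixes N :: "nat \<Rightarrow> nat"
  assumes N: "filterlim N at_top sequentially" and hol: "\<And>k. T k holomorphic_on cball c r"
    and sub: "subexponential N T (cball c r)" and geo: "geometric_decay N T (cball c s)"
    and "0 < s" "s \<le> t" "t < r"
  shows "geometric_decay N T (cball c t)"
proof -
  obtain \<delta> where \<delta>: "0 < \<delta>" "\<forall>\<^sub>F k in sequentially. \<forall>z\<in>cball c s. norm (T k z) \<le> exp (- \<delta> * real (N k))"
    using geo unfolding geometric_decay_def by blast
  define a b where "a = ln (t / s)" and "b = ln (r / t)"
  have a: "0 \<le> a" and b: "0 < b" using assms by (auto simp: a_def b_def)
  \<comment> \<open>At most half of \<open>\<delta>\<close> is spent on \<open>(t / s) ^ J\<close>;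
    the summand 1 covers \<open>a = 0\<close>, the case \<open>s = t\<close>.\<close>
  define \<theta> where "\<theta> = \<delta> / (2 * (a + 1))"
  have \<theta>: "0 < \<theta>" using a \<delta> by (simp add: \<theta>_def)
  have \<theta>a: "\<theta> * a \<le> \<delta> / 2" using a \<delta> by (simp add: \<theta>_def field_simps)
  define \<epsilon> where "\<epsilon> = \<theta> * b / 2"
  have \<epsilon>: "0 < \<epsilon>" using \<theta> b by (simp add: \<epsilon>_def)
  have "filterlim (\<lambda>k. real (N k)) at_top sequentially"
    using N filterlim_compose filterlim_real_sequentially by blast
  \<comment> \<open>Rounding \<open>J\<close> up costs an extra exponent of at most
    \<open>a\<close>, which is absorbed into \<open>\<delta> / 4 * N k\<close>.\<close>
  then have "\<forall>\<^sub>F k in sequentially. 4 * a / \<delta> \<le> real (N k)"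
    by (simp add: filterlim_at_top)
  then have "\<forall>\<^sub>F k in sequentially. \<forall>z\<in>cball c t. norm (T k z) \<le> exp (- min (\<delta> / 4) \<epsilon> * real (N k))"
    using \<delta>(2) sub[unfolded subexponential_def, rule_format, OF \<epsilon>]
  proof eventually_elim
    case (elim k)
    define J where "J = nat \<lceil>\<theta> * real (N k)\<rceil>"
    have J: "\<theta> * real (N k) \<le> real J" "real J \<le> \<theta> * real (N k) + 1"
      using \<theta> by (auto simp: J_def)
    have ts: "(t / s) ^ J = exp (real J * a)" "(t / r) ^ J = exp (- real J * b)"
      using assms by (auto simp: a_def b_def exp_of_nat_mult exp_minus power_divide field_simps)
    have "exp (- \<delta> * real (N k)) * (t / s) ^ J \<le> exp (- min (\<delta> / 4) \<epsilon> * real (N k))"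
    proof -
      have "real J * a \<le> (\<theta> * real (N k) + 1) * a" using J a by (intro mult_right_mono)
      also have "\<dots> = (\<theta> * a) * real (N k) + a" by (simp add: algebra_simps)
      also have "\<dots> \<le> \<delta> / 2 * real (N k) + \<delta> / 4 * real (N k)"
        using \<theta>a elim(1) \<delta> by (intro add_mono mult_right_mono) (auto simp: field_simps)
      finally have "- \<delta> * real (N k) + real J * a \<le> - (\<delta> / 4) * real (N k)"
        by (simp add: algebra_simps)
      also have "\<dots> \<le> - min (\<delta> / 4) \<epsilon> * real (N k)" by (intro mult_right_mono) auto
      finally show ?thesis by (simp add: ts flip: exp_add)
    qed
    moreover have "exp (\<epsilon> * real (N k)) * (t / r) ^ J \<le> exp (- min (\<delta> / 4) \<epsilon> * real (N k))"
    proof -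
      have "\<theta> * real (N k) * b \<le> real J * b" using J b by (intro mult_right_mono) auto
      then have "\<epsilon> * real (N k) - real J * b \<le> - \<epsilon> * real (N k)"
        by (simp add: \<epsilon>_def algebra_simps)
      also have "\<dots> \<le> - min (\<delta> / 4) \<epsilon> * real (N k)" by (intro mult_right_mono) auto
      finally show ?thesis by (simp add: ts flip: exp_add)
    qed
    ultimately show ?case
      using three_circles_power[OF hol[of k] \<open>0 < s\<close> \<open>s \<le> t\<close> less_imp_le[OF \<open>t < r\<close>],
          of "exp (- \<delta> * real (N k))" "exp (\<epsilon> * real (N k))" _ J] elim(2,3)
      by (meson max.boundedI order_trans)
  qed
  then show ?thesis using \<delta>(1) \<epsilon> unfolding geometric_decay_def
    by (intro exI[of _ "min (\<delta> / 4) \<epsilon>"]) auto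
qed

text \<open>The points with a disc of decay around them form an open subset of
  \<open>\<Omega>\<close> that is also relatively closed, by enlarging discs; connectedness makes it
  all of \<open>\<Omega>\<close>. Compactness of \<open>L\<close> then leaves finitely many rates,
  hence a common one.\<close>

lemma geometric_decay_propagates:
  fixes N :: "nat \<Rightarrow> nat"
  assumes N: "filterlim N at_top sequentially" and \<Omega>: "open \<Omega>" "connected \<Omega>"
    and hol: "\<And>k. T k holomorphic_on \<Omega>" and sub: "subexponential N T \<Omega>"
    and c0: "c0 \<in> \<Omega>" "0 < s0" "geometric_decay N T (cball c0 s0)"
    and L: "compact L" "L \<subseteq> \<Omega>"
  shows "geometric_decay N T L"
proof -
  define G where "G = {z\<in>\<Omega>. \<exists>s>0. geometric_decay N T (cball z s)}"
  have "open G" unfolding open_contains_ball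
  proof
    fix z assume "z \<in> G"
    then obtain s where s: "0 < s" "geometric_decay N T (cball z s)" and z: "z \<in> \<Omega>"
      by (auto simp: G_def)
    obtain e where e: "0 < e" "ball z e \<subseteq> \<Omega>" using \<Omega> z open_contains_ball by blast
    have "geometric_decay N T (cball w (s / 2))" if "w \<in> ball z (s / 2)" for w
      by (rule geometric_decay_mono[OF s(2)]) (use that in \<open>auto simp: cball_subset_cball_iff dist_commute\<close>)
    then have "ball z (min e (s / 2)) \<subseteq> G" using e s
      by (auto simp: G_def intro!: exI[of _ "s / 2"])
    then show "\<exists>e>0. ball z e \<subseteq> G" using e s by (intro exI[of _ "min e (s / 2)"]) auto
  qed
  moreover have "open (\<Omega> - G)" unfolding open_contains_ball
  proof
    fix z assume z: "z \<in> \<Omega> - G"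
    then obtain e where e: "0 < e" "cball z e \<subseteq> \<Omega>" using \<Omega> open_contains_cball
      by blast
    \<comment> \<open>For \<open>w\<close> within \<open>\<rho>\<close> of \<open>z\<close>, the
      disc of radius \<open>3 * \<rho>\<close> about \<open>w\<close> stays in
      \<open>\<Omega>\<close>, and the one of radius \<open>2 * \<rho>\<close> already contains
      \<open>cball z \<rho>\<close>.\<close>
    define \<rho> where "\<rho> = e / 4"
    have \<rho>: "0 < \<rho>" "e = 4 * \<rho>" using e by (auto simp: \<rho>_def)
    have "w \<notin> G" if w: "w \<in> ball z \<rho>" for w
    proof
      assume "w \<in> G"
      then obtain s where s: "0 < s" "geometric_decay N T (cball w s)" by (auto simp: G_def)
      have sub3: "cball w (3 * \<rho>) \<subseteq> \<Omega>"
        using e w \<rho> by (intro subset_trans[OF _ e(2)]) (auto simp: cball_subset_cball_iff dist_commute)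
      have "geometric_decay N T (cball w (2 * \<rho>))"
      proof (rule geometric_decay_larger_disc[OF N])
        show "T k holomorphic_on cball w (3 * \<rho>)" for k using hol sub3 holomorphic_on_subset by blast
        show "subexponential N T (cball w (3 * \<rho>))" using sub sub3 subexponential_mono by blast
        show "geometric_decay N T (cball w (min s \<rho>))" by (rule geometric_decay_mono[OF s(2)]) auto
      qed (use s \<rho> in auto)
      then have "geometric_decay N T (cball z \<rho>)"
        by (rule geometric_decay_mono) (use w \<rho> in \<open>auto simp: cball_subset_cball_iff dist_commute\<close>)
      then show False using z \<rho> by (auto simp: G_def)
    qed
    then have "ball z \<rho> \<subseteq> \<Omega> - G" using e \<rho> by auto
    then show "\<exists>e>0. ball z e \<subseteq> \<Omega> - G" using \<rho> by blast
  qed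
  moreover have "c0 \<in> G" using c0 by (auto simp: G_def)
  ultimately have "\<Omega> - G = {}" using connectedD[OF \<Omega>(2), of G "\<Omega> - G"] c0
    by (auto simp: G_def)
  then have "\<forall>z\<in>L. \<exists>s>0. geometric_decay N T (cball z s)" using L by (auto simp: G_def)
  then obtain s where s: "\<And>z. z \<in> L \<Longrightarrow> 0 < s z" "\<And>z. z \<in> L \<Longrightarrow> geometric_decay N T (cball z (s z))" by metis
  have "\<exists>C'\<subseteq>L. finite C' \<and> L \<subseteq> (\<Union>z\<in>C'. ball z (s z))"
    by (rule compactE_image[OF L(1), of L "\<lambda>z. ball z (s z)"]) (use s(1) in auto)
  then obtain C' where C': "C' \<subseteq> L" "finite C'" "L \<subseteq> (\<Union>z\<in>C'. ball z (s z))"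
    by blast
  have "geometric_decay N T (\<Union>z\<in>C'. cball z (s z))"
    using C' s(2) by (intro geometric_decay_UN) auto
  then show ?thesis by (rule geometric_decay_mono) (use C' in \<open>auto dest!: subsetD\<close>)
qed

section \<open>Bounds on circles avoiding the zeros of the denominators\<close>

text \<open>The radii to be avoided at stage \<open>k\<close> form a set of measure at most \<open>2 m exp (- d k)\<close>, so from
  some stage on they do not cover \<open>{a..b}\<close>.\<close>

lemma radius_avoiding_zeros:
  fixes Z :: "nat \<Rightarrow> complex multiset" and a b d :: real
  assumes size: "\<And>k. size (Z k) \<le> m" and "0 < d" "a < b"
  obtains t k0 where "a \<le> t" "t \<le> b"
    "\<And>k x w. k0 \<le> k \<Longrightarrow> x \<in># Z k \<Longrightarrow> dist z0 w = t \<Longrightarrow> exp (- d * real k) \<le> norm (w - x)"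
proof -
  define q where "q = exp (- d)"
  have q: "0 < q" "q < 1" using \<open>0 < d\<close> by (auto simp: q_def)
  \<comment> \<open>The excluded lengths from stage \<open>k0\<close> on sum to at most
    \<open>2 * m * q ^ k0 / (1 - q)\<close>, which must be less than \<open>b - a\<close>;
    \<open>2 * m + 1\<close> avoids division by zero for \<open>m = 0\<close>.\<close>
  obtain k0 where k0: "q ^ k0 < (b - a) * (1 - q) / (2 * real m + 1)"
    using real_arch_pow_inv[of "(b - a) * (1 - q) / (2 * real m + 1)" q] q \<open>a < b\<close> by auto
  define J where "J k = (\<Union>x\<in>set_mset (Z k). {dist z0 x - q ^ k <..< dist z0 x + q ^ k})" for k
  have "open (J k)" for k by (auto simp: J_def)
  then have J_meas: "J k \<in> sets lborel" "(\<Union>k. J (k + k0)) \<in> sets lborel" for k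
    by (auto intro!: borel_open)
  have J_le: "emeasure lborel (J k) \<le> ennreal (2 * real m * q ^ k)" for k
  proof -
    have "emeasure lborel (J k) \<le> (\<Sum>x\<in>set_mset (Z k). emeasure lborel {dist z0 x - q ^ k <..< dist z0 x + q ^ k})"
      unfolding J_def by (rule emeasure_subadditive_finite) auto
    also have "\<dots> = (\<Sum>x\<in>set_mset (Z k). ennreal (2 * q ^ k))"
      using q by (intro sum.cong) auto
    also have "\<dots> = ennreal (real (card (set_mset (Z k))) * (2 * q ^ k))"
      using q by (simp add: ennreal_mult ennreal_of_nat_eq_real_of_nat)
    also have "\<dots> \<le> ennreal (2 * real m * q ^ k)"
    proof (rule ennreal_leI)
      have "card (set_mset (Z k)) \<le> size (Z k)"
        by (metis mset_set_set_mset_msubset size_mset_mono size_mset_set)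
      then have "real (card (set_mset (Z k))) \<le> real m" using size[of k] by linarith
      then have "real (card (set_mset (Z k))) * (2 * q ^ k) \<le> real m * (2 * q ^ k)"
        using q by (intro mult_right_mono) auto
      then show "real (card (set_mset (Z k))) * (2 * q ^ k) \<le> 2 * real m * q ^ k" by simp
    qed
    finally show ?thesis .
  qed
  have "\<not> {a..b} \<subseteq> (\<Union>k. J (k + k0))"
  proof
    assume "{a..b} \<subseteq> (\<Union>k. J (k + k0))"
    then have "emeasure lborel {a..b} \<le> emeasure lborel (\<Union>k. J (k + k0))"
      using J_meas by (intro emeasure_mono)
    also have "\<dots> \<le> (\<Sum>k. emeasure lborel (J (k + k0)))"
      using J_meas(1) by (intro emeasure_subadditive_countably) auto
    also have "\<dots> \<le> (\<Sum>k. ennreal (2 * real m * q ^ (k + k0)))"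
      by (intro suminf_le J_le) auto
    also have "\<dots> = ennreal (2 * real m * q ^ k0 * (1 / (1 - q)))"
    proof (rule suminf_ennreal_eq)
      have "(\<lambda>k. (2 * real m * q ^ k0) * q ^ k) sums (2 * real m * q ^ k0 * (1 / (1 - q)))"
        using q by (intro sums_mult geometric_sums) auto
      then show "(\<lambda>k. 2 * real m * q ^ (k + k0)) sums (2 * real m * q ^ k0 * (1 / (1 - q)))"
        by (simp add: power_add mult_ac)
    qed (use q in auto)
    finally have "ennreal (b - a) \<le> ennreal (2 * real m * q ^ k0 * (1 / (1 - q)))"
      using \<open>a < b\<close> by simp
    then have "b - a \<le> 2 * real m * q ^ k0 * (1 / (1 - q))"
      using q by (subst (asm) ennreal_le_iff) auto
    then have "(b - a) * (1 - q) \<le> 2 * real m * q ^ k0" using q by (simp add: field_simps)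
    also have "\<dots> \<le> (2 * real m + 1) * q ^ k0" using q by (intro mult_right_mono) auto
    finally show False using k0 by (simp add: field_simps)
  qed
  then obtain t where "t \<in> {a..b}" "t \<notin> (\<Union>k. J (k + k0))" by blast
  then have t: "a \<le> t" "t \<le> b" "\<And>k. t \<notin> J (k + k0)" by auto
  show thesis
  proof (rule that[of t k0])
    fix k x w assume "k0 \<le> k" "x \<in># Z k" "dist z0 w = t"
    then have "t \<notin> {dist z0 x - q ^ k <..< dist z0 x + q ^ k}"
      using t(3)[of "k - k0"] by (auto simp: J_def)
    then have "q ^ k \<le> \<bar>dist z0 w - dist z0 x\<bar>" using \<open>dist z0 w = t\<close> by auto
    also have "\<dots> \<le> norm (w - x)"
      using norm_triangle_ineq3[of "z0 - w" "z0 - x"] by (simp add: dist_norm norm_minus_commute)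
    also have "q ^ k = exp (- d * real k)" by (simp add: q_def mult.commute flip: exp_of_nat_mult)
    finally show "exp (- d * real k) \<le> norm (w - x)" .
  qed (fact t)+
qed

lemma telescoping_bound:
  fixes u :: "nat \<Rightarrow> complex"
  assumes step: "\<And>k. k0 \<le> k \<Longrightarrow> norm (u k - u (Suc k)) \<le> q ^ k" and q: "0 < q" "q < 1" and "k0 \<le> k"
  shows "norm (u k) \<le> norm (u k0) + 1 / (1 - q)"
proof -
  have "norm (u k) \<le> norm (u k0) + (\<Sum>i\<in>{k0..<k}. q ^ i)"
    using \<open>k0 \<le> k\<close>
  proof (induction k rule: dec_induct)
    case (step j)
    have "norm (u (Suc j)) \<le> norm (u j) + norm (u j - u (Suc j))"
      by (metis norm_minus_commute norm_triangle_sub)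
    then show ?case using step assms(1)[of j] by simp
  qed simp
  also have "(\<Sum>i\<in>{k0..<k}. q ^ i) \<le> (\<Sum>i. q ^ i)"
    using q by (intro sum_le_suminf summable_geometric) auto
  also have "\<dots> = 1 / (1 - q)" using q by (intro suminf_geometric) auto
  finally show ?thesis by simp
qed

text \<open>The numerator of \<open>p k / q k - p (Suc k) / q (Suc k)\<close>. Unlike that
  difference it has no poles, so decay can be propagated past the zeros of the denominators.\<close>

definition cross_difference ::
    "(nat \<Rightarrow> complex poly) \<Rightarrow> (nat \<Rightarrow> complex poly) \<Rightarrow> nat \<Rightarrow> complex \<Rightarrow> complex" where
  "cross_difference p q k w = poly (p k) w * poly (q (Suc k)) w - poly (p (Suc k)) w * poly (q k) w"

text \<open>On a circle that keeps its distance from the zeros, consecutive quotients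
  \<open>p k / q k\<close> differ by a summable amount, so they are bounded there. Multiplying by
  the bounded denominators bounds \<open>p k\<close> on the circle, and the maximum principle fills
  the disc.\<close>

lemma numerators_locally_bounded:
  fixes p :: "nat \<Rightarrow> complex poly" and N :: "nat \<Rightarrow> nat" and c :: real
  assumes N: "strict_mono N" and ratio: "\<forall>\<^sub>F k in sequentially. real (N (Suc k)) \<le> c * real (N k)"
    and c: "1 \<le> c" and size: "\<And>k. size (Z k) \<le> m" and A: "1 \<le> A"
    and \<rho>: "0 < \<rho>" "cball z0 \<rho> \<subseteq> cball 0 (A / 2)"
    and geo: "geometric_decay N (cross_difference p (\<lambda>k. scaled_poly A (Z k))) (cball z0 \<rho>)"
  obtains t B where "0 < t" "t \<le> \<rho>" "\<forall>\<^sub>F k in sequentially. \<forall>w\<in>cball z0 t. norm (poly (p k) w) \<le> B"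
proof -
  let ?q = "\<lambda>k. scaled_poly A (Z k)"
  obtain \<delta> where \<delta>: "0 < \<delta>" and decay: "\<forall>\<^sub>F k in sequentially. \<forall>w\<in>cball z0 \<rho>.
      norm (cross_difference p ?q k w) \<le> exp (- \<delta> * real (N k))"
    using geo unfolding geometric_decay_def by blast
  \<comment> \<open>Dividing by the denominators of index \<open>k\<close> and \<open>Suc k\<close>
    costs the exponent \<open>d * m * (N k + N (Suc k))\<close>, at most
    \<open>d * m * (1 + c) * N k\<close>; this \<open>d\<close> keeps it within half of the
    decay.\<close>
  define d where "d = \<delta> / (2 * (real m + 1) * (1 + c))"
  have d: "0 < d" using \<delta> c by (simp add: d_def)
  have dm: "d * real m * (1 + c) \<le> \<delta> / 2" using \<delta> c by (simp add: d_def divide_simps)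
  have kN: "k \<le> N k" for k using N by (simp add: strict_mono_imp_increasing)
  obtain t k0 where t: "\<rho> / 2 \<le> t" "t \<le> \<rho>"
      "\<And>k x w. k0 \<le> k \<Longrightarrow> x \<in># Z k \<Longrightarrow> dist z0 w = t \<Longrightarrow> exp (- d * real k) \<le> norm (w - x)"
    using radius_avoiding_zeros[of Z m d "\<rho> / 2" \<rho> z0] size d \<rho> by auto
  have "filterlim (\<lambda>k. real k) at_top sequentially" by (rule filterlim_real_sequentially)
  \<comment> \<open>From here on the guaranteed distance \<open>exp (- d * real k)\<close> is at
    most 1/2, as \<open>norm_scaled_poly_ge\<close> requires.\<close>
  then have "\<forall>\<^sub>F k in sequentially. ln 2 / d \<le> real k" by (simp add: filterlim_at_top)
  then have "\<forall>\<^sub>F k in sequentially. real (N (Suc k)) \<le> c * real (N k) \<and> ln 2 / d \<le> real k \<and>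
      (\<forall>w\<in>cball z0 \<rho>. norm (cross_difference p ?q k w) \<le> exp (- \<delta> * real (N k)))"
    using ratio decay by eventually_elim auto
  then obtain k1 where k1: "\<And>k. k1 \<le> k \<Longrightarrow> real (N (Suc k)) \<le> c * real (N k)" "\<And>k. k1 \<le> k \<Longrightarrow> ln 2 / d \<le> real k"
      "\<And>k w. k1 \<le> k \<Longrightarrow> w \<in> cball z0 \<rho> \<Longrightarrow> norm (cross_difference p ?q k w) \<le> exp (- \<delta> * real (N k))"
    unfolding eventually_sequentially by blast
  define K where "K = max k0 k1"
  have q_ge: "exp (- d * real m * real (N k)) \<le> norm (poly (?q k) w)" if k: "K \<le> k" and w: "dist z0 w = t" for k w
  proof -
    have "ln 2 \<le> d * real k" using k1(2)[of k] k d by (simp add: K_def field_simps)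
    then have "exp (- d * real k) \<le> exp (- ln 2)" by simp
    also have "exp (- ln (2 :: real)) = 1 / 2" by (simp add: exp_minus)
    finally have half: "exp (- d * real k) \<le> 1 / 2" .
    have le1: "exp (- d * real k) \<le> 1" using d by simp
    have "exp (- d * real m * real (N k)) \<le> exp (- d * real m * real k)"
      using kN[of k] d by (auto intro!: mult_left_mono)
    also have "\<dots> = exp (- d * real k) ^ m" by (simp add: mult_ac flip: exp_of_nat_mult)
    also have "\<dots> \<le> exp (- d * real k) ^ size (Z k)" using le1 size[of k]
      by (intro power_decreasing) auto
    also have "\<dots> \<le> norm (poly (?q k) w)"
      using t(3)[of k _ w] k w half \<rho>(2) t(2) A by (intro norm_scaled_poly_ge) (auto simp: K_def)
    finally show ?thesis .
  qed
  have "compact (sphere z0 t)" by simp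
  moreover have "continuous_on (sphere z0 t) (\<lambda>w. poly (p K) w)" by (intro continuous_intros)
  ultimately have "compact ((\<lambda>w. poly (p K) w) ` sphere z0 t)"
    by (rule compact_continuous_image[rotated])
  then have "bounded ((\<lambda>w. poly (p K) w) ` sphere z0 t)" by (rule compact_imp_bounded)
  then have "\<exists>M. \<forall>w\<in>sphere z0 t. norm (poly (p K) w) \<le> M"
    by (auto simp: bounded_iff)
  then obtain M where M: "\<And>w. w \<in> sphere z0 t \<Longrightarrow> norm (poly (p K) w) \<le> M"
    by blast
  define q0 where "q0 = exp (- \<delta> / 2)"
  have q0: "0 < q0" "q0 < 1" using \<delta> by (auto simp: q0_def)
  define B0 where "B0 = M / exp (- d * real m * real (N K)) + 1 / (1 - q0)"
  have quot: "norm (poly (p k) w / poly (?q k) w) \<le> B0" if k: "K \<le> k" and w: "dist z0 w = t" for k w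
  proof -
    define u where "u k = poly (p k) w / poly (?q k) w" for k
    have nz: "poly (?q k) w \<noteq> 0" if "K \<le> k" for k
      using q_ge[OF that w] by (metis exp_gt_zero norm_zero not_le)
    have "norm (u k) \<le> norm (u K) + 1 / (1 - q0)"
    proof (rule telescoping_bound[OF _ q0 k])
      fix k assume k: "K \<le> k"
      have "u k - u (Suc k) = cross_difference p ?q k w / (poly (?q k) w * poly (?q (Suc k)) w)"
        using nz[of k] nz[of "Suc k"] k by (simp add: u_def cross_difference_def divide_simps mult.commute)
      then have "norm (u k - u (Suc k)) = norm (cross_difference p ?q k w) / (norm (poly (?q k) w) * norm (poly (?q (Suc k)) w))"
        by (simp add: norm_divide norm_mult)
      also have "\<dots> \<le> exp (- \<delta> * real (N k)) / (exp (- d * real m * real (N k)) * exp (- d * real m * real (N (Suc k))))"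
        using k1(3)[of k w] q_ge[OF _ w] k w t(2)
        by (intro frac_le mult_mono mult_pos_pos) (auto simp: K_def)
      also have "\<dots> = exp (- \<delta> * real (N k) + d * real m * real (N k) + d * real m * real (N (Suc k)))"
        by (simp add: algebra_simps flip: exp_add exp_diff)
      also have "\<dots> \<le> exp (- (\<delta> / 2) * real k)"
      proof -
        have "d * real m * real (N (Suc k)) \<le> d * real m * (c * real (N k))"
          using k1(1)[of k] k d by (intro mult_left_mono) (auto simp: K_def)
        then have "- \<delta> * real (N k) + d * real m * real (N k) + d * real m * real (N (Suc k))
            \<le> - \<delta> * real (N k) + (d * real m * (1 + c)) * real (N k)" by (simp add: algebra_simps)
        also have "\<dots> \<le> - \<delta> * real (N k) + (\<delta> / 2) * real (N k)" using dm
          by (intro add_left_mono mult_right_mono) auto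
        also have "\<dots> = - (\<delta> / 2) * real (N k)" by (simp add: algebra_simps)
        also have "\<dots> \<le> - (\<delta> / 2) * real k" using kN[of k] \<delta>
          by (auto intro!: mult_left_mono)
        finally show ?thesis by simp
      qed
      also have "\<dots> = q0 ^ k" by (simp add: q0_def mult.commute flip: exp_of_nat_mult)
      finally show "norm (u k - u (Suc k)) \<le> q0 ^ k" .
    qed
    also have "norm (u K) \<le> M / exp (- d * real m * real (N K))"
      unfolding u_def norm_divide using M[of w] q_ge[OF _ w, of K] w
      by (intro frac_le) (auto intro: order_trans[OF norm_ge_zero])
    finally show ?thesis by (simp add: u_def B0_def)
  qed
  have B0: "0 \<le> B0"
  proof -
    have "dist z0 (z0 + of_real t) = t" using t \<rho> by (simp add: dist_norm)
    then show ?thesis using quot[of K] by (meson norm_ge_zero order_refl order_trans)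
  qed
  have "norm (poly (p k) w) \<le> B0 * (2 * A) ^ m" if k: "K \<le> k" and w: "w \<in> cball z0 t" for k w
  proof (rule maximum_modulus_frontier[of "poly (p k)" "cball z0 t"])
    fix w assume "w \<in> frontier (cball z0 t)"
    then have w: "dist z0 w = t" using t \<rho> by simp
    have "norm w \<le> A / 2" using w t(2) \<rho>(2) by auto
    then have "norm (poly (?q k) w) \<le> (A + A / 2) ^ size (Z k)" using A by (intro norm_scaled_poly_le)
    also have "\<dots> \<le> (2 * A) ^ size (Z k)" using A by (intro power_mono) auto
    also have "\<dots> \<le> (2 * A) ^ m" using A size[of k] by (intro power_increasing) auto
    finally have "norm (poly (?q k) w) \<le> (2 * A) ^ m" .
    moreover have "poly (?q k) w \<noteq> 0" using q_ge[OF k w] by (metis exp_gt_zero norm_zero not_le)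
    then have "norm (poly (p k) w) = norm (poly (p k) w / poly (?q k) w) * norm (poly (?q k) w)"
      by (simp add: norm_divide)
    ultimately show "norm (poly (p k) w) \<le> B0 * (2 * A) ^ m" using quot[OF k w] B0
      by (auto intro!: mult_mono)
  qed (use w in \<open>auto intro!: holomorphic_intros continuous_intros\<close>)
  then have "\<forall>\<^sub>F k in sequentially. \<forall>w\<in>cball z0 t. norm (poly (p k) w) \<le> B0 * (2 * A) ^ m"
    unfolding eventually_sequentially by blast
  then show thesis using that[of t] t \<rho> by simp
qed

text \<open>Bolzano-Weierstrass, applied to one coefficient index after another.\<close>

lemma bounded_coeffs_convergent_subsequence:
  fixes a :: "nat \<Rightarrow> nat \<Rightarrow> complex"
  assumes "\<And>k i. norm (a k i) \<le> B"
  obtains r l where "strict_mono (r :: nat \<Rightarrow> nat)" "\<And>i. i \<le> (m :: nat) \<Longrightarrow> (\<lambda>k. a (r k) i) \<longlonglongrightarrow> l i"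
proof -
  have "\<exists>r l. strict_mono (r :: nat \<Rightarrow> nat) \<and> (\<forall>i<n. (\<lambda>k. a (r k) i) \<longlonglongrightarrow> l i)" for n
  proof (induction n)
    case 0
    then show ?case by (auto intro: strict_mono_id)
  next
    case (Suc n)
    then obtain r l where r: "strict_mono (r :: nat \<Rightarrow> nat)" "\<And>i. i < n \<Longrightarrow> (\<lambda>k. a (r k) i) \<longlonglongrightarrow> l i" by blast
    have "bounded (range (\<lambda>k. a (r k) n))" using assms by (auto simp: bounded_iff)
    then obtain x s where s: "strict_mono (s :: nat \<Rightarrow> nat)" "((\<lambda>k. a (r k) n) \<circ> s) \<longlonglongrightarrow> x"
      using bounded_imp_convergent_subsequence by blast
    have "(\<lambda>k. a ((r \<circ> s) k) i) \<longlonglongrightarrow> (l(n := x)) i" if "i < Suc n" for i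
      using that s(2) LIMSEQ_subseq_LIMSEQ[OF r(2)[of i] s(1)] by (cases "i = n") (auto simp: o_def)
    then show ?case using strict_mono_o[OF r(1) s(1)] by blast
  qed
  from this[of "Suc m"] that show thesis by (metis less_Suc_eq_le)
qed

section \<open>Continuation across the boundary\<close>

text \<open>The quotients \<open>p k / scaled_poly A (Z k)\<close> approximate \<open>F\<close> only on \<open>D'\<close>, which in the application is \<open>D\<close>
  without \<open>E\<close> and without the zeros and singularities of \<open>F\<close>; it has to reach every boundary point of \<open>D\<close>.\<close>

locale approximation_data =
  fixes p :: "nat \<Rightarrow> complex poly" and Z :: "nat \<Rightarrow> complex multiset" and N :: "nat \<Rightarrow> nat"
    and A c :: real and m :: nat and D D' :: "complex set" and F :: "complex \<Rightarrow> complex"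
  assumes N: "strict_mono N" and ratio: "\<forall>\<^sub>F k in sequentially. real (N (Suc k)) \<le> c * real (N k)"
    and c: "1 \<le> c" and degree_p: "\<And>k. degree (p k) \<le> N k" and size_Z: "\<And>k. size (Z k) \<le> m"
    and A: "1 \<le> A" and D: "open D" "connected D" "D \<noteq> {}" "D \<subseteq> ball 0 (A / 4)"
    and D': "open D'" "D' \<subseteq> D" "\<And>U. open U \<Longrightarrow> U \<inter> frontier D \<noteq> {} \<Longrightarrow> U \<inter> D' \<noteq> {}"
    and F: "continuous_on D' F" "\<And>z. z \<in> D' \<Longrightarrow> F z \<noteq> 0"
    and approx: "\<And>z. z \<in> D' \<Longrightarrow> \<exists>s>0. geometric_decay N
        (\<lambda>k w. F w * poly (scaled_poly A (Z k)) w - poly (p k) w) (cball z s)"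
    and few: "\<And>z0. z0 \<in> frontier D \<Longrightarrow> \<exists>r>0. \<forall>\<epsilon>>0. \<forall>\<^sub>F k in sequentially.
        real (size {#a \<in># proots (p k). a \<in> ball z0 r#}) \<le> \<epsilon> * real (N k)"
begin

abbreviation "q k \<equiv> scaled_poly A (Z k)"

lemma N_at_top: "filterlim N at_top sequentially"
  using N by (rule filterlim_subseq)

lemma eventually_N_ge: "\<forall>\<^sub>F k in sequentially. x \<le> real (N k)"
proof -
  have "filterlim (\<lambda>k. real (N k)) at_top sequentially"
    using N_at_top filterlim_compose filterlim_real_sequentially by blast
  then show ?thesis by (simp add: filterlim_at_top)
qed

lemma q_le: assumes "norm w \<le> A" shows "norm (poly (q k) w) \<le> (2 * A) ^ m"
proof -
  have "norm (poly (q k) w) \<le> (A + A) ^ size (Z k)" using A assms by (intro norm_scaled_poly_le)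
  also have "\<dots> \<le> (A + A) ^ m" using A size_Z[of k] by (intro power_increasing) auto
  also have "\<dots> = (2 * A) ^ m" by simp
  finally show ?thesis .
qed

text \<open>On a compact disc in \<open>D'\<close> the continuous \<open>F\<close> is bounded, and
  so are the denominators; hence \<open>p k\<close>, which differs from \<open>F * q k\<close> by a
  small error, is bounded as well.\<close>

lemma approximation_disc:
  assumes "z \<in> D'" "0 < e"
  obtains s \<delta> B where "0 < s" "s \<le> e" "cball z s \<subseteq> D'" "0 < \<delta>"
    "\<forall>\<^sub>F k in sequentially. \<forall>w\<in>cball z s. norm (F w * poly (q k) w - poly (p k) w) \<le> exp (- \<delta> * real (N k))"
    "1 \<le> B" "\<forall>\<^sub>F k in sequentially. \<forall>w\<in>cball z s. norm (poly (p k) w) \<le> B"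
proof -
  obtain s1 where s1: "0 < s1" "geometric_decay N (\<lambda>k w. F w * poly (q k) w - poly (p k) w) (cball z s1)"
    using approx assms by blast
  obtain s2 where s2: "0 < s2" "cball z s2 \<subseteq> D'" using D'(1) assms open_contains_cball by blast
  define s where "s = min e (min s1 s2)"
  have s: "0 < s" "s \<le> e" using s1 s2 assms by (auto simp: s_def)
  have sD: "cball z s \<subseteq> D'" by (rule subset_trans[OF subset_cball s2(2)]) (simp add: s_def)
  have "geometric_decay N (\<lambda>k w. F w * poly (q k) w - poly (p k) w) (cball z s)"
    by (rule geometric_decay_mono[OF s1(2) subset_cball]) (simp add: s_def)
  then obtain \<delta> where \<delta>: "0 < \<delta>" "\<forall>\<^sub>F k in sequentially. \<forall>w\<in>cball z s.
      norm (F w * poly (q k) w - poly (p k) w) \<le> exp (- \<delta> * real (N k))"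
    unfolding geometric_decay_def by blast
  have "compact (F ` cball z s)"
    by (rule compact_continuous_image[OF continuous_on_subset[OF F(1) sD]]) simp
  then have "\<exists>M. \<forall>w\<in>cball z s. norm (F w) \<le> M"
    using compact_imp_bounded[of "F ` cball z s"] by (auto simp: bounded_iff)
  then obtain M where M: "\<And>w. w \<in> cball z s \<Longrightarrow> norm (F w) \<le> M" by blast
  have "0 \<le> M" using M[of z] s by (metis centre_in_cball less_imp_le norm_ge_zero order_trans)
  have "\<forall>\<^sub>F k in sequentially. \<forall>w\<in>cball z s. norm (poly (p k) w) \<le> M * (2 * A) ^ m + 1"
    using \<delta>(2)
  proof eventually_elim
    case (elim k)
    show ?case
    proof
      fix w assume w: "w \<in> cball z s"
      then have "w \<in> ball 0 (A / 4)" using sD D' D by blast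
      then have "norm (F w * poly (q k) w) \<le> M * (2 * A) ^ m"
        using M[OF w] q_le[of w k] A \<open>0 \<le> M\<close> by (auto simp: norm_mult intro!: mult_mono)
      moreover have "norm (F w * poly (q k) w - poly (p k) w) \<le> 1"
        using bspec[OF elim w] \<delta>(1) by (rule_tac order_trans) auto
      ultimately show "norm (poly (p k) w) \<le> M * (2 * A) ^ m + 1"
        using norm_triangle_sub[of "poly (p k) w" "F w * poly (q k) w"] by (simp add: norm_minus_commute)
    qed
  qed
  moreover have "1 \<le> M * (2 * A) ^ m + 1" using \<open>0 \<le> M\<close> A by simp
  ultimately show thesis using that s sD \<delta> by blast
qed

lemma bounded_imp_subexponential:
  assumes "\<forall>\<^sub>F k in sequentially. \<forall>w\<in>S. norm (g k w) \<le> B"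
  shows "subexponential N g S"
  unfolding subexponential_def
proof (intro allI impI)
  fix \<epsilon> :: real assume \<epsilon>: "0 < \<epsilon>"
  show "\<forall>\<^sub>F k in sequentially. \<forall>z\<in>S. norm (g k z) \<le> exp (\<epsilon> * real (N k))"
    using assms eventually_N_ge[of "B / \<epsilon>"]
  proof eventually_elim
    case (elim k)
    have "B \<le> \<epsilon> * real (N k)" using elim(2) \<epsilon> by (simp add: field_simps)
    then have "B \<le> exp (\<epsilon> * real (N k))"
      using exp_ge_add_one_self[of "\<epsilon> * real (N k)"] by linarith
    then show ?case using elim(1) by (meson order_trans)
  qed
qed

section \<open>Growth of the numerators across the frontier of \<open>D\<close>\<close>

lemma bounded_D: "bounded D"
  using D(4) bounded_ball bounded_subset by blast

lemma exists_point: obtains z where "z \<in> D'"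
proof -
  have "D \<noteq> UNIV" using bounded_D not_bounded_UNIV by metis
  then have "frontier D \<noteq> {}" using D(3) by (intro frontier_not_empty)
  then show thesis using D'(3)[of UNIV] that by auto
qed

text \<open>Bernstein-Walsh, starting from a disc in \<open>D'\<close> on which the numerators are
  bounded; \<open>2 * A\<close> bounds the distance from its centre to any point of
  \<open>cball 0 A\<close>.\<close>

lemma exponential_growth:
  obtains C where "1 \<le> C" "\<forall>\<^sub>F k in sequentially. \<forall>z\<in>cball 0 A. norm (poly (p k) z) \<le> C ^ N k"
proof -
  obtain z1 where z1: "z1 \<in> D'" by (rule exists_point)
  obtain s \<delta> B where disc: "0 < s" "s \<le> 1" "cball z1 s \<subseteq> D'" "0 < \<delta>"
      "\<forall>\<^sub>F k in sequentially. \<forall>w\<in>cball z1 s. norm (F w * poly (q k) w - poly (p k) w) \<le> exp (- \<delta> * real (N k))"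
      "1 \<le> B" "\<forall>\<^sub>F k in sequentially. \<forall>w\<in>cball z1 s. norm (poly (p k) w) \<le> B"
    by (rule approximation_disc[OF z1 zero_less_one])
  note s = disc(1,3) and B = disc(6,7)
  define C where "C = B * max 1 (2 * A / s)"
  have C: "B \<le> C" using B mult_left_mono[of 1 "max 1 (2 * A / s)" B] by (simp add: C_def)
  have "\<forall>\<^sub>F k in sequentially. \<forall>z\<in>cball 0 A. norm (poly (p k) z) \<le> C ^ N k"
    using B(2) eventually_N_ge[of 1]
  proof eventually_elim
    case (elim k)
    show ?case
    proof
      fix z :: complex assume z: "z \<in> cball 0 A"
      have N1: "1 \<le> N k" using elim(2) by simp
      show "norm (poly (p k) z) \<le> C ^ N k"
      proof (cases "z \<in> cball z1 s")
        case True
        then have "norm (poly (p k) z) \<le> C" using elim(1) C by (meson order_trans)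
        also have "\<dots> \<le> C ^ N k" using N1 B C by (intro self_le_power) auto
        finally show ?thesis .
      next
        case False
        have "norm (poly (p k) z) \<le> B * (norm (z - z1) / s) ^ N k"
          using False elim(1) s(1) degree_p[of k]
          by (intro bernstein_walsh) (auto simp: dist_norm norm_minus_commute)
        also have "\<dots> \<le> B ^ N k * (max 1 (2 * A / s)) ^ N k"
        proof (intro mult_mono power_mono)
          show "B \<le> B ^ N k" using B N1 by (intro self_le_power) auto
          have "norm (z - z1) \<le> 2 * A" using z z1 D' D A norm_triangle_ineq4[of z z1] by force
          then show "norm (z - z1) / s \<le> max 1 (2 * A / s)" using s(1)
            by (simp add: divide_right_mono le_max_iff_disj)
        qed (use B s in auto)
        finally show ?thesis by (simp add: C_def power_mult_distrib)
      qed
    qed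
  qed
  then show thesis using that[of C] B C by simp
qed

text \<open>\<open>D'\<close> supplies a disc close to \<open>z0\<close> where \<open>p k\<close> is
  bounded above and, since \<open>F\<close> has no zero there and the denominators are not small
  throughout, also bounded below at some point. From it \<open>few_zeros_subexponential\<close>
  reaches a full neighbourhood of \<open>z0\<close>.\<close>

lemma subexponential_near_frontier:
  assumes z0: "z0 \<in> frontier D"
  shows "\<exists>\<rho>>0. \<rho> \<le> A / 16 \<and> subexponential N (\<lambda>k. poly (p k)) (cball z0 \<rho>)"
proof -
  obtain C where C: "1 \<le> C" "\<forall>\<^sub>F k in sequentially. \<forall>z\<in>cball 0 A. norm (poly (p k) z) \<le> C ^ N k"
    by (rule exponential_growth)
  obtain r0 where r0: "0 < r0" "\<And>\<epsilon>. 0 < \<epsilon> \<Longrightarrow> \<forall>\<^sub>F k in sequentially.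
      real (size {#a \<in># proots (p k). a \<in> ball z0 r0#}) \<le> \<epsilon> * real (N k)"
    using few[OF z0] by blast
  \<comment> \<open>As \<open>norm z0\<close> is at most \<open>A / 4\<close>, the disc of radius
    \<open>2 * r\<close> stays in \<open>cball 0 A\<close>, where exponential growth is
    known.\<close>
  define r where "r = min r0 (A / 8)"
  have r: "0 < r" "r \<le> r0" "r \<le> A / 8" using r0 A by (auto simp: r_def)
  have "z0 \<in> closure D" using z0 by (simp add: frontier_def)
  have "ball z0 r \<inter> frontier D \<noteq> {}" using r(1) z0 by (metis centre_in_ball disjoint_iff)
  then obtain z where z: "z \<in> ball z0 r" "z \<in> D'" using D'(3)[of "ball z0 r"] by auto
  have "closure D \<subseteq> cball 0 (A / 4)" using D(4) by (intro closure_minimal) auto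
  then have nz0: "norm z0 \<le> A / 4" using \<open>z0 \<in> closure D\<close> by auto
  have e: "0 < min (1 / 2) (r - dist z0 z)" using z(1) by simp
  obtain s \<delta> B where disc: "0 < s" "s \<le> min (1 / 2) (r - dist z0 z)" "cball z s \<subseteq> D'" "0 < \<delta>"
      "\<forall>\<^sub>F k in sequentially. \<forall>w\<in>cball z s. norm (F w * poly (q k) w - poly (p k) w) \<le> exp (- \<delta> * real (N k))"
      "1 \<le> B" "\<forall>\<^sub>F k in sequentially. \<forall>w\<in>cball z s. norm (poly (p k) w) \<le> B"
    by (rule approximation_disc[OF z(2) e])
  note s = disc(1,2,3) and \<delta> = disc(4,5) and B = disc(7)
  define t where "t = s / 2"
  have t: "0 < t" "t < s" "t \<le> 1 / 2" using s by (auto simp: t_def)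
  have tsub: "cball z t \<subseteq> D'" using s(3) t by (meson less_imp_le subset_cball subset_trans)
  have tr: "cball z t \<subseteq> ball z0 r"
  proof
    fix w assume "w \<in> cball z t"
    then show "w \<in> ball z0 r" using s(2) t dist_triangle[of z0 w z] by auto
  qed
  have "compact (cball z t)" "cball z t \<noteq> {}" "continuous_on (cball z t) (\<lambda>w. norm (F w))"
    using t by (auto intro!: continuous_intros continuous_on_subset[OF F(1) tsub])
  then obtain w0 where w0: "w0 \<in> cball z t" "\<And>w. w \<in> cball z t \<Longrightarrow> norm (F w0) \<le> norm (F w)"
    using continuous_attains_inf[of "cball z t" "\<lambda>w. norm (F w)"] by blast
  have F0: "0 < norm (F w0)" using F(2) w0(1) tsub by auto
  \<comment> \<open>Half of the lower bound for \<open>F * q k\<close>; the other half absorbs the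
    approximation error.\<close>
  define l where "l = norm (F w0) * (t / 8) ^ m / 2"
  have l: "0 < l" using F0 t by (simp add: l_def)
  have "\<forall>\<^sub>F k in sequentially. \<exists>w\<in>cball z (t / 8). l \<le> norm (poly (p k) w)"
    using \<delta>(2) eventually_N_ge[of "- ln l / \<delta>"]
  proof eventually_elim
    case (elim k)
    have sub8: "cball z (t / 8) \<subseteq> cball z t" using t by (intro subset_cball) auto
    have "cball z (t / 8) \<subseteq> cball 0 (A / 2)"
      using sub8 tsub D' D A by (force)
    then obtain w where w: "w \<in> cball z (t / 8)" "(t / 8) ^ size (Z k) \<le> norm (poly (q k) w)"
      using scaled_poly_large_point[OF A, of z "t / 8" "Z k"] t by auto
    have "(t / 8) ^ m \<le> (t / 8) ^ size (Z k)" using t size_Z[of k] by (intro power_decreasing) auto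
    then have "norm (F w0) * (t / 8) ^ m \<le> norm (F w) * norm (poly (q k) w)"
      using order_trans[OF \<open>(t / 8) ^ m \<le> (t / 8) ^ size (Z k)\<close> w(2)] w0(2)[of w] w(1) sub8 t by (intro mult_mono) auto
    then have "2 * l \<le> norm (F w * poly (q k) w)" by (simp add: l_def norm_mult)
    moreover have "norm (F w * poly (q k) w - poly (p k) w) \<le> l"
    proof -
      have "- ln l \<le> \<delta> * real (N k)" using elim(2) \<delta>(1) by (simp add: field_simps)
      then have "exp (- \<delta> * real (N k)) \<le> exp (ln l)" by simp
      moreover have "w \<in> cball z s" using w(1) t by auto
      ultimately show ?thesis using bspec[OF elim(1), of w] l by (metis exp_ln order_trans)
    qed
    ultimately have "l \<le> norm (poly (p k) w)"
      using norm_triangle_sub[of "F w * poly (q k) w" "poly (p k) w"] by linarith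
    then show ?case using w(1) by blast
  qed
  moreover have "cball z t \<subseteq> cball z s" using t by (intro subset_cball) auto
  then have "subexponential N (\<lambda>k. poly (p k)) (cball z t)"
    using bounded_imp_subexponential[OF B] subexponential_mono by blast
  moreover have "\<forall>\<^sub>F k in sequentially. \<forall>w\<in>cball z0 (2 * r). norm (poly (p k) w) \<le> C ^ N k"
  proof -
    have "cball z0 (2 * r) \<subseteq> cball 0 A"
    proof
      fix w assume "w \<in> cball z0 (2 * r)"
      then show "w \<in> cball 0 A" using r(3) nz0 A norm_triangle_ineq2[of w z0]
        by (auto simp: dist_norm norm_minus_commute)
    qed
    then show ?thesis using C(2) by (auto elim!: eventually_mono)
  qed
  moreover have "\<forall>\<^sub>F k in sequentially. real (size {#a \<in># proots (p k). a \<in> ball z0 r#}) \<le> \<epsilon> * real (N k)" if "0 < \<epsilon>" for \<epsilon>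
    using r0(2)[OF that]
  proof eventually_elim
    case (elim k)
    have "{#a \<in># proots (p k). a \<in> ball z0 r#} \<subseteq># {#a \<in># proots (p k). a \<in> ball z0 r0#}"
      using r(2) by (intro filter_mset_mono_strong) auto
    then have "size {#a \<in># proots (p k). a \<in> ball z0 r#} \<le> size {#a \<in># proots (p k). a \<in> ball z0 r0#}"
      by (rule size_mset_mono)
    then show ?case using elim by linarith
  qed
  ultimately have "subexponential N (\<lambda>k. poly (p k)) (cball z0 (r / 2))"
    using few_zeros_subexponential[OF N_at_top r(1) C(1) _ _ tr t(1) _ l] by blast
  then show ?thesis using r by (intro exI[of _ "r / 2"]) auto
qed

lemma norm_le_on_D:
  assumes "\<And>z. z \<in> frontier D \<Longrightarrow> norm (poly P z) \<le> M" "z \<in> D"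
  shows "norm (poly P z) \<le> M"
  by (rule maximum_modulus_frontier[of "poly P" D]) (use assms bounded_D in \<open>auto intro!: holomorphic_intros continuous_intros\<close>)

text \<open>Each disc is centred on the frontier and so meets \<open>D\<close>, which links all of
  them.\<close>

lemma connected_D_Un_balls:
  assumes "S \<subseteq> frontier D" "\<And>z. z \<in> S \<Longrightarrow> 0 < \<rho> z"
  shows "connected (D \<union> (\<Union>z\<in>S. ball z (\<rho> z)))"
proof -
  have "connected (D \<union> ball z (\<rho> z))" if "z \<in> S" for z
  proof (rule connected_Un)
    have "z \<in> closure D" using assms that by (auto simp: frontier_def)
    then show "D \<inter> ball z (\<rho> z) \<noteq> {}"
      using assms(2)[OF that]
      by (metis Int_commute centre_in_ball disjoint_iff open_Int_closure_eq_empty open_ball)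
  qed (use D in auto)
  then have "connected (\<Union>(insert D ((\<lambda>z. D \<union> ball z (\<rho> z)) ` S)))"
    using D by (intro connected_Union) auto
  moreover have "\<Union>(insert D ((\<lambda>z. D \<union> ball z (\<rho> z)) ` S)) = D \<union> (\<Union>z\<in>S. ball z (\<rho> z))" by auto
  ultimately show ?thesis by simp
qed

lemma frontier_cover:
  assumes "\<And>z. z \<in> frontier D \<Longrightarrow> 0 < \<rho> z"
  obtains S where "finite S" "S \<subseteq> frontier D" "frontier D \<subseteq> (\<Union>z\<in>S. ball z (\<rho> z))"
proof -
  have "compact (frontier D)" using bounded_D by (simp add: compact_frontier_bounded)
  then show thesis
    by (rule compactE_image[of _ "frontier D" "\<lambda>z. ball z (\<rho> z)"]) (use assms that in auto)
qed

text \<open>By compactness finitely many discs cover the frontier, so their bounds hold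
  simultaneously; the maximum principle extends them over \<open>D\<close>. Radii of at most
  \<open>A / 16\<close> keep the union inside \<open>ball 0 (A / 2)\<close>.\<close>

lemma subexponential_domain:
  obtains \<Omega> where "open \<Omega>" "connected \<Omega>" "closure D \<subseteq> \<Omega>" "\<Omega> \<subseteq> ball 0 (A / 2)"
    "subexponential N (\<lambda>k. poly (p k)) \<Omega>"
proof -
  obtain \<rho> where \<rho>: "\<And>z. z \<in> frontier D \<Longrightarrow> 0 < \<rho> z" "\<And>z. z \<in> frontier D \<Longrightarrow> \<rho> z \<le> A / 16"
      "\<And>z. z \<in> frontier D \<Longrightarrow> subexponential N (\<lambda>k. poly (p k)) (cball z (\<rho> z))"
    using subexponential_near_frontier by metis
  obtain S where S: "finite S" "S \<subseteq> frontier D" "frontier D \<subseteq> (\<Union>z\<in>S. ball z (\<rho> z))"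
    using frontier_cover[of \<rho>] \<rho>(1) by blast
  define V where "V = (\<Union>z\<in>S. ball z (\<rho> z))"
  have subV: "subexponential N (\<lambda>k. poly (p k)) V" unfolding V_def
  proof (rule subexponential_UN[OF S(1)])
    show "subexponential N (\<lambda>k. poly (p k)) (ball z (\<rho> z))" if "z \<in> S" for z
      using \<rho>(3)[of z] S(2) that by (intro subexponential_mono[OF _ ball_subset_cball]) auto
  qed
  have "subexponential N (\<lambda>k. poly (p k)) D" unfolding subexponential_def
  proof (intro allI impI)
    fix \<epsilon> :: real assume "0 < \<epsilon>"
    then have "\<forall>\<^sub>F k in sequentially. \<forall>z\<in>V. norm (poly (p k) z) \<le> exp (\<epsilon> * real (N k))"
      using subV by (simp add: subexponential_def)
    then show "\<forall>\<^sub>F k in sequentially. \<forall>z\<in>D. norm (poly (p k) z) \<le> exp (\<epsilon> * real (N k))"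
    proof eventually_elim
      case (elim k)
      then show ?case using norm_le_on_D[of "p k" "exp (\<epsilon> * real (N k))"] S(3)
        by (metis V_def subsetD)
    qed
  qed
  then have "subexponential N (\<lambda>k. poly (p k)) (D \<union> V)" using subV
    by (rule subexponential_Un)
  moreover have "connected (D \<union> V)" unfolding V_def using S \<rho>
    by (intro connected_D_Un_balls) auto
  moreover have "closure D \<subseteq> D \<union> V" using S(3) D(1)
    by (auto simp: V_def frontier_def interior_open)
  moreover have "D \<union> V \<subseteq> ball 0 (A / 2)"
  proof -
    have cl: "closure D \<subseteq> cball 0 (A / 4)" using D(4) by (intro closure_minimal) auto
    have "ball z (\<rho> z) \<subseteq> ball 0 (A / 2)" if "z \<in> S" for z
    proof
      fix w assume w: "w \<in> ball z (\<rho> z)"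
      have "norm z \<le> A / 4" using cl S(2) that by (auto simp: frontier_def)
      then show "w \<in> ball 0 (A / 2)" using w \<rho>(2)[of z] S(2) that A norm_triangle_ineq2[of w z]
        by (auto simp: dist_norm norm_minus_commute)
    qed
    moreover have "D \<subseteq> ball 0 (A / 2)" using D(4) A
      by (rule_tac subset_trans[OF _ subset_ball]) auto
    ultimately show ?thesis by (auto simp: V_def)
  qed
  moreover have "open (D \<union> V)" using D by (auto simp: V_def)
  ultimately show thesis using that by blast
qed

section \<open>Differences of consecutive quotients\<close>

lemma cross_difference_subexponential:
  assumes sub: "subexponential N (\<lambda>k. poly (p k)) \<Omega>" and \<Omega>: "\<Omega> \<subseteq> ball 0 (A / 2)"
  shows "subexponential N (cross_difference p q) \<Omega>"
  unfolding subexponential_def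
proof (intro allI impI)
  fix \<epsilon>0 :: real assume "0 < \<epsilon>0"
  \<comment> \<open>Since \<open>N (Suc k)\<close> is at most \<open>c * N k\<close>, both
    numerators stay below \<open>exp (\<epsilon>0 / 2 * N k)\<close>; the other half of
    \<open>\<epsilon>0\<close> absorbs the bound for the denominators.\<close>
  define \<epsilon> where "\<epsilon> = \<epsilon>0 / (2 * c)"
  have \<epsilon>: "0 < \<epsilon>" "\<epsilon> * c = \<epsilon>0 / 2" "\<epsilon> \<le> \<epsilon>0 / 2"
    using \<open>0 < \<epsilon>0\<close> c by (auto simp: \<epsilon>_def divide_simps)
  let ?M = "(2 * A) ^ m"
  have ev: "\<forall>\<^sub>F k in sequentially. \<forall>z\<in>\<Omega>. norm (poly (p k) z) \<le> exp (\<epsilon> * real (N k))"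
    using sub \<epsilon>(1) by (simp add: subexponential_def)
  show "\<forall>\<^sub>F k in sequentially. \<forall>z\<in>\<Omega>. norm (cross_difference p q k z) \<le> exp (\<epsilon>0 * real (N k))"
    using ev eventually_sequentially_Suc[THEN iffD2, OF ev] ratio eventually_N_ge[of "2 * (2 * ?M) / \<epsilon>0"]
  proof eventually_elim
    case (elim k)
    show ?case
    proof
      fix z assume z: "z \<in> \<Omega>"
      have q: "norm (poly (q j) z) \<le> ?M" for j using z \<Omega> A by (intro q_le) force
      have "norm (poly (p k) z) \<le> exp (\<epsilon>0 / 2 * real (N k))"
        using mult_right_mono[OF \<epsilon>(3), of "real (N k)"]
        by (intro order_trans[OF bspec[OF elim(1) z]]) simp
      moreover have "norm (poly (p (Suc k)) z) \<le> exp (\<epsilon>0 / 2 * real (N k))"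
      proof -
        have "\<epsilon> * real (N (Suc k)) \<le> \<epsilon> * (c * real (N k))" using elim(3) \<epsilon>
          by (intro mult_left_mono) auto
        also have "\<dots> = (\<epsilon> * c) * real (N k)" by simp
        finally have "exp (\<epsilon> * real (N (Suc k))) \<le> exp (\<epsilon>0 / 2 * real (N k))"
          unfolding \<epsilon>(2) by simp
        then show ?thesis by (rule order_trans[OF bspec[OF elim(2) z]])
      qed
      ultimately have "norm (cross_difference p q k z) \<le> exp (\<epsilon>0 / 2 * real (N k)) * ?M + exp (\<epsilon>0 / 2 * real (N k)) * ?M"
        unfolding cross_difference_def using q
        by (intro order_trans[OF norm_triangle_ineq4] add_mono) (auto simp: norm_mult intro!: mult_mono)
      also have "\<dots> = exp (\<epsilon>0 / 2 * real (N k)) * (2 * ?M)" by simp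
      also have "\<dots> \<le> exp (\<epsilon>0 / 2 * real (N k)) * exp (\<epsilon>0 / 2 * real (N k))"
      proof (intro mult_left_mono)
        have "2 * ?M \<le> \<epsilon>0 / 2 * real (N k)" using elim(4) \<open>0 < \<epsilon>0\<close>
          by (simp add: field_simps)
        then show "2 * ?M \<le> exp (\<epsilon>0 / 2 * real (N k))"
          using exp_ge_add_one_self[of "\<epsilon>0 / 2 * real (N k)"] by linarith
      qed simp
      also have "\<dots> = exp (\<epsilon>0 * real (N k))" by (simp flip: exp_add)
      finally show "norm (cross_difference p q k z) \<le> exp (\<epsilon>0 * real (N k))" .
    qed
  qed
qed

text \<open>\<open>F\<close> cancels: the cross difference is a combination of the two approximation
  errors with the bounded denominators as coefficients.\<close>

lemma cross_difference_decay_disc: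
  obtains z s where "z \<in> D" "0 < s" "geometric_decay N (cross_difference p q) (cball z s)"
proof -
  obtain z where z: "z \<in> D'" by (rule exists_point)
  obtain s \<delta> B where disc: "0 < s" "s \<le> 1" "cball z s \<subseteq> D'" "0 < \<delta>"
      "\<forall>\<^sub>F k in sequentially. \<forall>w\<in>cball z s. norm (F w * poly (q k) w - poly (p k) w) \<le> exp (- \<delta> * real (N k))"
      "1 \<le> B" "\<forall>\<^sub>F k in sequentially. \<forall>w\<in>cball z s. norm (poly (p k) w) \<le> B"
    by (rule approximation_disc[OF z zero_less_one])
  note s = disc(1,3) and \<delta> = disc(4,5)
  let ?M = "(2 * A) ^ m"
  have "\<forall>\<^sub>F k in sequentially. \<forall>w\<in>cball z s. norm (cross_difference p q k w) \<le> exp (- (\<delta> / 2) * real (N k))"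
    using \<delta>(2) eventually_sequentially_Suc[THEN iffD2, OF \<delta>(2)] eventually_N_ge[of "2 * (2 * ?M) / \<delta>"]
  proof eventually_elim
    case (elim k)
    show ?case
    proof
      fix w assume w: "w \<in> cball z s"
      then have "w \<in> ball 0 (A / 4)" using s D' D by blast
      then have q: "norm (poly (q j) w) \<le> ?M" for j using A by (intro q_le) auto
      have "N k \<le> N (Suc k)" using N by (simp add: strict_mono_less_eq)
      then have "exp (- \<delta> * real (N (Suc k))) \<le> exp (- \<delta> * real (N k))" using \<delta>(1)
        by (auto intro!: mult_left_mono)
      then have 2: "norm (F w * poly (q (Suc k)) w - poly (p (Suc k)) w) \<le> exp (- \<delta> * real (N k))"
        by (rule order_trans[OF bspec[OF elim(2) w]])
      have "cross_difference p q k w = (F w * poly (q (Suc k)) w - poly (p (Suc k)) w) * poly (q k) w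
          - (F w * poly (q k) w - poly (p k) w) * poly (q (Suc k)) w"
        by (simp add: cross_difference_def algebra_simps)
      also have "norm \<dots> \<le> exp (- \<delta> * real (N k)) * ?M + exp (- \<delta> * real (N k)) * ?M"
        using elim(1) w 2 q
        by (intro order_trans[OF norm_triangle_ineq4] add_mono) (auto simp: norm_mult intro!: mult_mono)
      also have "\<dots> = exp (- \<delta> * real (N k)) * (2 * ?M)" by simp
      also have "\<dots> \<le> exp (- \<delta> * real (N k)) * exp (\<delta> / 2 * real (N k))"
      proof (intro mult_left_mono)
        have "2 * ?M \<le> \<delta> / 2 * real (N k)" using elim(3) \<delta>(1) by (simp add: field_simps)
        then show "2 * ?M \<le> exp (\<delta> / 2 * real (N k))"
          using exp_ge_add_one_self[of "\<delta> / 2 * real (N k)"] by linarith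
      qed simp
      also have "\<dots> = exp (- (\<delta> / 2) * real (N k))" by (simp flip: exp_add)
      finally show "norm (cross_difference p q k w) \<le> exp (- (\<delta> / 2) * real (N k))" .
    qed
  qed
  then have "geometric_decay N (cross_difference p q) (cball z s)"
    unfolding geometric_decay_def using \<delta>(1) by (intro exI[of _ "\<delta> / 2"]) auto
  then show thesis using that z D' s(1) by blast
qed

text \<open>Subexponential growth would not suffice for Montel's theorem. The decay of the cross
  differences is carried from a disc in \<open>D\<close> to the frontier points and yields genuine
  bounds around them.\<close>

lemma numerators_bounded:
  obtains \<Omega> B where "open \<Omega>" "closure D \<subseteq> \<Omega>" "\<forall>\<^sub>F k in sequentially. \<forall>w\<in>\<Omega>. norm (poly (p k) w) \<le> B"
proof -
  obtain \<Omega> where \<Omega>: "open \<Omega>" "connected \<Omega>" "closure D \<subseteq> \<Omega>" "\<Omega> \<subseteq> ball 0 (A / 2)"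
    "subexponential N (\<lambda>k. poly (p k)) \<Omega>" by (rule subexponential_domain)
  obtain z s where z: "z \<in> D" "0 < s" "geometric_decay N (cross_difference p q) (cball z s)"
    by (rule cross_difference_decay_disc)
  have decay: "geometric_decay N (cross_difference p q) L" if "compact L" "L \<subseteq> \<Omega>" for L
  proof (rule geometric_decay_propagates[OF N_at_top \<Omega>(1,2) _ _ _ z(2,3) that])
    show "cross_difference p q k holomorphic_on \<Omega>" for k
      unfolding cross_difference_def by (intro holomorphic_intros)
    show "z \<in> \<Omega>" using z(1) \<Omega>(3) closure_subset by blast
  qed (rule cross_difference_subexponential[OF \<Omega>(5,4)])
  have "\<exists>t>0. \<exists>B. \<forall>\<^sub>F k in sequentially. \<forall>w\<in>cball z0 t. norm (poly (p k) w) \<le> B" if z0: "z0 \<in> frontier D" for z0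
  proof -
    have "z0 \<in> \<Omega>" using z0 \<Omega>(3) by (auto simp: frontier_def)
    then obtain \<rho> where \<rho>: "0 < \<rho>" "cball z0 \<rho> \<subseteq> \<Omega>"
      using \<Omega>(1) open_contains_cball by blast
    then have "cball z0 \<rho> \<subseteq> cball 0 (A / 2)" using \<Omega>(4) ball_subset_cball by blast
    then obtain t B where "0 < t" "t \<le> \<rho>" "\<forall>\<^sub>F k in sequentially. \<forall>w\<in>cball z0 t. norm (poly (p k) w) \<le> B"
      by (rule numerators_locally_bounded[OF N ratio c size_Z A \<rho>(1) _ decay[OF compact_cball \<rho>(2)]])
    then show ?thesis by blast
  qed
  then have "\<forall>z0\<in>frontier D. \<exists>tB. 0 < fst tB \<and>
      (\<forall>\<^sub>F k in sequentially. \<forall>w\<in>cball z0 (fst tB). norm (poly (p k) w) \<le> snd tB)" by simp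
  then obtain tB where tB: "\<And>z0. z0 \<in> frontier D \<Longrightarrow> 0 < fst (tB z0) \<and>
      (\<forall>\<^sub>F k in sequentially. \<forall>w\<in>cball z0 (fst (tB z0)). norm (poly (p k) w) \<le> snd (tB z0))"
    unfolding bchoice_iff by blast
  define t where "t z0 = fst (tB z0)" for z0
  define B where "B z0 = snd (tB z0)" for z0
  have t: "\<And>z0. z0 \<in> frontier D \<Longrightarrow> 0 < t z0"
      "\<And>z0. z0 \<in> frontier D \<Longrightarrow> \<forall>\<^sub>F k in sequentially. \<forall>w\<in>cball z0 (t z0). norm (poly (p k) w) \<le> B z0"
    using tB by (auto simp: t_def B_def)
  obtain S where S: "finite S" "S \<subseteq> frontier D" "frontier D \<subseteq> (\<Union>z\<in>S. ball z (t z))"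
    using frontier_cover[of t] t(1) by blast
  define V where "V = (\<Union>z\<in>S. ball z (t z))"
  define M where "M = (\<Sum>z\<in>S. \<bar>B z\<bar>)"
  have "\<forall>\<^sub>F k in sequentially. \<forall>z\<in>S. \<forall>w\<in>cball z (t z). norm (poly (p k) w) \<le> B z"
    using S t(2) by (intro eventually_ball_finite) auto
  then have "\<forall>\<^sub>F k in sequentially. \<forall>w\<in>D \<union> V. norm (poly (p k) w) \<le> M"
  proof eventually_elim
    case (elim k)
    have V: "norm (poly (p k) w) \<le> M" if w: "w \<in> V" for w
    proof -
      obtain z where z: "z \<in> S" "w \<in> cball z (t z)" using w by (auto simp: V_def intro: less_imp_le)
      then have "norm (poly (p k) w) \<le> \<bar>B z\<bar>" using elim by force
      also have "\<dots> \<le> M" unfolding M_def using z(1) S(1) by (intro member_le_sum) auto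
      finally show ?thesis .
    qed
    have "norm (poly (p k) w) \<le> M" if "w \<in> D" for w
      using norm_le_on_D[OF _ that, of "p k"] V S(3) by (auto simp: V_def[symmetric])
    then show ?case using V by blast
  qed
  moreover have "closure D \<subseteq> D \<union> V" using S(3) D(1)
    by (auto simp: V_def frontier_def interior_open)
  moreover have "open (D \<union> V)" using D by (auto simp: V_def)
  ultimately show thesis using that by blast
qed

theorem holomorphic_numerator:
  obtains \<Omega> H Q where "open \<Omega>" "closure D \<subseteq> \<Omega>" "H holomorphic_on \<Omega>" "Q \<noteq> 0" "degree Q \<le> m"
    "\<And>z. z \<in> D' \<Longrightarrow> F z * poly Q z = H z"
proof -
  obtain \<Omega> B where \<Omega>: "open \<Omega>" "closure D \<subseteq> \<Omega>" and B: "\<forall>\<^sub>F k in sequentially. \<forall>w\<in>\<Omega>. norm (poly (p k) w) \<le> B"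
    by (rule numerators_bounded)
  obtain K where K: "\<And>k w. K \<le> k \<Longrightarrow> w \<in> \<Omega> \<Longrightarrow> norm (poly (p k) w) \<le> B"
    using B by (auto simp: eventually_sequentially)
  obtain H r1 where H: "H holomorphic_on \<Omega>" "strict_mono (r1 :: nat \<Rightarrow> nat)"
      "\<And>z. z \<in> \<Omega> \<Longrightarrow> (\<lambda>n. poly (p (r1 n + K)) z) \<longlonglongrightarrow> H z"
  proof (rule Montel[of \<Omega> "range (\<lambda>n. poly (p (n + K)))" "\<lambda>n. poly (p (n + K))"])
    show "h holomorphic_on \<Omega>" if "h \<in> range (\<lambda>n. poly (p (n + K)))" for h
      using that by (auto intro!: holomorphic_intros)
    show "\<exists>B. \<forall>h\<in>range (\<lambda>n. poly (p (n + K))). \<forall>z\<in>L. norm (h z) \<le> B" if "compact L" "L \<subseteq> \<Omega>" for L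
      using K that by (intro exI[of _ B]) auto
  qed (use \<Omega> in auto)
  have "norm (coeff (q k) i) \<le> (2 * A) ^ m" for k i
  proof -
    have "norm (coeff (q k) i) \<le> (2 * A) ^ size (Z k)" using A by (rule coeff_scaled_poly_le)
    also have "\<dots> \<le> (2 * A) ^ m" using A size_Z by (intro power_increasing) auto
    finally show ?thesis .
  qed
  then obtain r2 l where r2: "strict_mono (r2 :: nat \<Rightarrow> nat)"
      "\<And>i. i \<le> m \<Longrightarrow> (\<lambda>n. coeff (q (r1 (r2 n) + K)) i) \<longlonglongrightarrow> l i"
    using bounded_coeffs_convergent_subsequence[of "\<lambda>n i. coeff (q (r1 n + K)) i" "(2 * A) ^ m" m]
    by metis
  define \<tau> where "\<tau> n = r1 (r2 n) + K" for n
  have \<tau>: "strict_mono \<tau>" using H(2) r2(1) by (auto simp: strict_mono_def \<tau>_def)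
  define Q where "Q = (\<Sum>i\<le>m. monom (l i) i)"
  have polyQ: "poly Q z = (\<Sum>i\<le>m. l i * z ^ i)" for z by (simp add: Q_def poly_sum poly_monom)
  have polyq: "poly (q k) z = (\<Sum>i\<le>m. coeff (q k) i * z ^ i)" for k z
  proof -
    have "degree (q k) \<le> m" using degree_scaled_poly_le[of A "Z k"] size_Z[of k] by linarith
    then have "q k = (\<Sum>i\<le>m. monom (coeff (q k) i) i)" by (rule poly_as_sum_of_monoms'[symmetric])
    then show ?thesis by (metis (no_types, lifting) poly_sum poly_monom sum.cong)
  qed
  have lim: "(\<lambda>n. poly (q (\<tau> n)) z) \<longlonglongrightarrow> poly Q z" for z
    unfolding polyQ polyq using r2(2) by (intro tendsto_intros) (auto simp: \<tau>_def)
  \<comment> \<open>Otherwise all coefficients tend to 0 along \<open>\<tau>\<close>. But inside the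
    unit disc the sum of their moduli bounds the denominator, which somewhere in
    \<open>cball 0 (1 / 2)\<close> is at least \<open>(1 / 2) ^ m\<close>.\<close>
  have "Q \<noteq> 0"
  proof
    assume "Q = 0"
    have "l i = 0" if "i \<le> m" for i
    proof -
      have "coeff Q i = l i" using that by (simp add: Q_def coeff_sum sum.delta)
      then show ?thesis using \<open>Q = 0\<close> by simp
    qed
    then have "(\<lambda>n. \<Sum>i\<le>m. norm (coeff (q (\<tau> n)) i)) \<longlonglongrightarrow> (\<Sum>i\<le>m. norm (0 :: complex))"
      using r2(2) by (intro tendsto_intros) (auto simp: \<tau>_def)
    then have "\<forall>\<^sub>F n in sequentially. (\<Sum>i\<le>m. norm (coeff (q (\<tau> n)) i)) < (1 / 2) ^ m"
      by (intro order_tendstoD(2)) auto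
    then obtain n where n: "(\<Sum>i\<le>m. norm (coeff (q (\<tau> n)) i)) < (1 / 2) ^ m"
      by (meson eventually_happens sequentially_bot)
    obtain w where w: "w \<in> cball 0 (1 / 2)" "(1 / 2) ^ size (Z (\<tau> n)) \<le> norm (poly (q (\<tau> n)) w)"
      by (rule scaled_poly_large_point[OF A, of 0 "1 / 2" "Z (\<tau> n)"]) (use A in auto)
    have "norm (poly (q (\<tau> n)) w) \<le> (\<Sum>i\<le>m. norm (coeff (q (\<tau> n)) i))"
      unfolding polyq
    proof (rule sum_norm_le)
      fix i
      have "norm w ^ i \<le> 1" using w(1) by (intro power_le_one) auto
      then show "norm (coeff (q (\<tau> n)) i * w ^ i) \<le> norm (coeff (q (\<tau> n)) i)"
        by (simp add: norm_mult norm_power mult_left_le)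
    qed
    moreover have "(1 / 2 :: real) ^ m \<le> (1 / 2) ^ size (Z (\<tau> n))" using size_Z
      by (intro power_decreasing) auto
    ultimately show False using n w(2) by linarith
  qed
  moreover have "degree Q \<le> m"
    unfolding Q_def by (intro degree_sum_le) (auto intro: order_trans[OF degree_monom_le])
  moreover have "F z * poly Q z = H z" if z: "z \<in> D'" for z
  proof -
    have "z \<in> \<Omega>" using z D' \<Omega>(2) closure_subset by blast
    then have "((\<lambda>n. poly (p (r1 n + K)) z) \<circ> r2) \<longlonglongrightarrow> H z"
      using LIMSEQ_subseq_LIMSEQ[OF H(3) r2(1)] by blast
    then have 1: "(\<lambda>n. poly (p (\<tau> n)) z) \<longlonglongrightarrow> H z"
      by (simp add: o_def \<tau>_def)
    obtain s \<delta> B where disc: "0 < s" "s \<le> 1" "cball z s \<subseteq> D'" "0 < \<delta>"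
      "\<forall>\<^sub>F k in sequentially. \<forall>w\<in>cball z s. norm (F w * poly (q k) w - poly (p k) w) \<le> exp (- \<delta> * real (N k))"
      "1 \<le> B" "\<forall>\<^sub>F k in sequentially. \<forall>w\<in>cball z s. norm (poly (p k) w) \<le> B"
      by (rule approximation_disc[OF z zero_less_one])
    note s = disc(1) and \<delta> = disc(4,5)
    have "(\<lambda>k. F z * poly (q k) z - poly (p k) z) \<longlonglongrightarrow> 0"
    proof (rule Lim_null_comparison)
      show "\<forall>\<^sub>F k in sequentially. norm (F z * poly (q k) z - poly (p k) z) \<le> exp (- \<delta>) ^ k"
        using \<delta>(2)
      proof eventually_elim
        case (elim k)
        have "k \<le> N k" using N by (rule strict_mono_imp_increasing)
        then have "exp (- \<delta> * real (N k)) \<le> exp (- \<delta> * real k)" using \<delta>(1)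
          by (auto intro!: mult_left_mono)
        also have "\<dots> = exp (- \<delta>) ^ k" by (simp add: mult.commute flip: exp_of_nat_mult)
        finally show ?case using s by (intro order_trans[OF bspec[OF elim, of z]]) auto
      qed
      show "(\<lambda>k. exp (- \<delta>) ^ k) \<longlonglongrightarrow> 0" using \<delta>(1)
        by (intro LIMSEQ_realpow_zero) auto
    qed
    from LIMSEQ_subseq_LIMSEQ[OF this \<tau>]
    have "(\<lambda>n. F z * poly (q (\<tau> n)) z - poly (p (\<tau> n)) z) \<longlonglongrightarrow> 0"
      by (simp add: o_def)
    moreover have "(\<lambda>n. F z * poly (q (\<tau> n)) z - poly (p (\<tau> n)) z) \<longlonglongrightarrow> F z * poly Q z - H z"
      using 1 lim by (intro tendsto_intros)
    ultimately show ?thesis using LIMSEQ_unique by fastforce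
  qed
  ultimately show thesis using that \<Omega> H(1) by blast
qed

end

section \<open>Logarithmic potentials\<close>

locale compactly_supported_measure = prob_space \<mu> for \<mu> :: "complex measure" +
  fixes K :: "complex set" and M :: real
  assumes sets_eq: "sets \<mu> = sets borel" and null: "emeasure \<mu> (- K) = 0"
    and closed_K: "closed K" and K_bounded: "K \<subseteq> cball 0 M" and M: "0 \<le> M"
begin

abbreviation "\<phi> \<equiv> exp_neg_potential \<mu>"

definition pos_part :: "complex \<Rightarrow> ennreal" where
  "pos_part z = (\<integral>\<^sup>+ t. e2ennreal (log_kernel z t) \<partial>\<mu>)"

text \<open>The integral of log^+, since \<open>ennreal\<close> sends negative numbers to 0. At
  \<open>t = z\<close> the convention \<open>ln 0 = 0\<close> agrees with the vanishing negative
  part of the infinite kernel.\<close>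

definition neg_part :: "complex \<Rightarrow> ennreal" where
  "neg_part z = (\<integral>\<^sup>+ t. ennreal (ln (norm (z - t))) \<partial>\<mu>)"

lemma borel_measurable_mu [measurable_cong]: "sets \<mu> = sets borel"
  by (rule sets_eq)

lemma log_kernel_measurable [measurable]: "log_kernel z \<in> borel_measurable borel"
  unfolding log_kernel_def[abs_def] by measurable

lemma AE_K: "AE t in \<mu>. t \<in> K"
proof (rule AE_I)
  show "{t \<in> space \<mu>. t \<notin> K} \<subseteq> - K" by auto
  show "- K \<in> sets \<mu>" using closed_K by (auto simp: sets_eq)
qed (fact null)

lemma K_nonempty: "K \<noteq> {}"
  using null emeasure_space_1 sets_eq_imp_space_eq[OF sets_eq] by auto

lemma neg_log_kernel: "e2ennreal (- log_kernel z t) = ennreal (ln (norm (z - t)))"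
proof (cases "t = z")
  case True
  then show ?thesis by (simp add: log_kernel_def e2ennreal_neg)
next
  case False
  then show ?thesis by (simp add: log_kernel_def ln_div)
qed

lemma potential_eq: "log_potential \<mu> z = enn2ereal (pos_part z) - enn2ereal (neg_part z)"
  by (simp add: log_potential_def pos_part_def neg_part_def neg_log_kernel)

text \<open>log^+ of the modulus is 1-Lipschitz, because the derivative of the logarithm is at most
  1 on the part that is not cut off.\<close>

lemma ln_norm_diff_le:
  fixes z w t :: complex
  shows "ennreal (ln (norm (w - t))) \<le> ennreal (ln (norm (z - t))) + ennreal (norm (w - z))"
proof (cases "norm (w - t) \<le> 1")
  case True
  then have "ln (norm (w - t)) \<le> 0" by (cases "w = t") auto
  then show ?thesis by (simp add: ennreal_neg)
next
  case w: False
  have tri: "norm (w - t) \<le> norm (w - z) + norm (z - t)" using norm_triangle_ineq[of "w - z" "z - t"]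
    by simp
  show ?thesis
  proof (cases "1 \<le> norm (z - t)")
    case True
    have "ln (norm (w - t)) - ln (norm (z - t)) \<le> (norm (w - t) - norm (z - t)) / norm (z - t)"
      using w True by (intro ln_diff_le) auto
    also have "\<dots> \<le> norm (w - z) / norm (z - t)" using tri by (intro divide_right_mono) auto
    also have "\<dots> \<le> norm (w - z)" using True by (simp add: divide_le_eq mult_le_cancel_left1)
    finally have "ln (norm (w - t)) \<le> ln (norm (z - t)) + norm (w - z)" by simp
    then show ?thesis using True by (simp flip: ennreal_plus add: ennreal_leI)
  next
    case False
    have "ln (norm (w - t)) \<le> norm (w - t) - 1" using w by (intro ln_le_minus_one) auto
    also have "\<dots> \<le> norm (w - z)" using tri False by simp
    finally show ?thesis by (meson add_increasing ennreal_leI zero_le)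
  qed
qed

lemma neg_part_lipschitz: "neg_part w \<le> neg_part z + ennreal (norm (w - z))"
proof -
  have "neg_part w \<le> (\<integral>\<^sup>+ t. ennreal (ln (norm (z - t))) + ennreal (norm (w - z)) \<partial>\<mu>)"
    unfolding neg_part_def by (intro nn_integral_mono ln_norm_diff_le)
  also have "\<dots> = neg_part z + ennreal (norm (w - z))"
    unfolding neg_part_def by (subst nn_integral_add) (auto simp: emeasure_space_1)
  finally show ?thesis .
qed

lemma neg_part_le: "neg_part z \<le> ennreal (ln (norm z + M + 1))"
proof -
  have "neg_part z \<le> (\<integral>\<^sup>+ t. ennreal (ln (norm z + M + 1)) \<partial>\<mu>)"
    unfolding neg_part_def
  proof (rule nn_integral_mono_AE, use AE_K in eventually_elim)
    case (elim t)
    have "norm (z - t) \<le> norm z + M + 1" using elim K_bounded norm_triangle_ineq4[of z t] by force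
    then show ?case
    proof (cases "z = t")
      case False
      then show ?thesis using \<open>norm (z - t) \<le> norm z + M + 1\<close>
        by (intro ennreal_leI ln_mono) auto
    qed simp
  qed
  also have "\<dots> = ennreal (ln (norm z + M + 1))" by (simp add: emeasure_space_1)
  finally show ?thesis .
qed

lemma neg_part_finite: "neg_part z < \<infinity>"
  using neg_part_le le_less_trans ennreal_less_top by (metis infinity_ennreal_def)

lemma phi_nonneg: "0 \<le> \<phi> z"
  by (simp add: exp_neg_potential_def)

text \<open>\<open>\<phi> z < r\<close> means that the potential exceeds \<open>- ln r\<close>. In
  extended reals this includes the points of infinite potential, and finiteness of
  \<open>neg_part\<close> makes the difference meaningful.\<close>

lemma phi_less_iff:
  assumes "0 < r"
  shows "\<phi> z < r \<longleftrightarrow> enn2ereal (neg_part z) - ereal (ln r) < enn2ereal (pos_part z)"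
proof -
  obtain b where b: "0 \<le> b" "neg_part z = ennreal b" using neg_part_finite[of z]
    by (cases "neg_part z") auto
  show ?thesis
  proof (cases "pos_part z")
    case (real a)
    have U: "log_potential \<mu> z = ereal (a - b)" using real b by (simp add: potential_eq)
    have "\<phi> z = exp (b - a)" by (simp add: exp_neg_potential_def U)
    then have "\<phi> z < r \<longleftrightarrow> b - a < ln r" using assms
      by (metis exp_less_cancel_iff exp_ln)
    then show ?thesis using real b by (auto simp: algebra_simps)
  next
    case top
    then have U: "log_potential \<mu> z = \<infinity>" using b by (simp add: potential_eq)
    then show ?thesis using top b assms by (simp add: exp_neg_potential_def)
  qed
qed

lemma phi_le: "\<phi> z \<le> norm z + M + 1"
proof -
  have pos: "0 < norm z + M + 1" using M by (simp add: add_nonneg_pos)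
  have ln0: "0 \<le> ln (norm z + M + 1)" using M by (intro ln_ge_zero) auto
  obtain b where b: "0 \<le> b" "neg_part z = ennreal b" using neg_part_finite[of z]
    by (cases "neg_part z") auto
  have ble: "b \<le> ln (norm z + M + 1)" using neg_part_le[of z] b ln0 by (simp add: ennreal_le_iff)
  show ?thesis
  proof (cases "pos_part z")
    case (real a)
    have U: "log_potential \<mu> z = ereal (a - b)" using real b by (simp add: potential_eq)
    have "\<phi> z = exp (b - a)" by (simp add: exp_neg_potential_def U)
    also have "\<dots> \<le> exp (ln (norm z + M + 1))" using real ble by simp
    finally show ?thesis using pos by simp
  next
    case top
    then have U: "log_potential \<mu> z = \<infinity>" using b by (simp add: potential_eq)
    then show ?thesis using pos by (simp add: exp_neg_potential_def)
  qed
qed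

text \<open>The value infinity on the diagonal makes the kernel continuous into the extended reals,
  which is the pointwise convergence needed for Fatou's lemma.\<close>

lemma log_kernel_tendsto:
  assumes "w \<longlonglongrightarrow> z"
  shows "(\<lambda>j. log_kernel (w j) t) \<longlonglongrightarrow> log_kernel z t"
proof (cases "t = z")
  case True
  have "\<forall>\<^sub>F j in sequentially. ereal x < log_kernel (w j) t" for x
  proof -
    have "\<forall>\<^sub>F j in sequentially. dist (w j) z < exp (- x)" using assms
      by (intro tendstoD) auto
    then show ?thesis
    proof eventually_elim
      case (elim j)
      show ?case
      proof (cases "t = w j")
        case False
        then have "ln (norm (w j - t)) < ln (exp (- x))" using elim True
          by (subst ln_less_cancel_iff) (auto simp: dist_norm)
        then have "ln (norm (w j - t)) < - x" by simp
        then show ?thesis using False by (simp add: log_kernel_def ln_div)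
      qed (simp add: log_kernel_def)
    qed
  qed
  then show ?thesis using True by (simp add: log_kernel_def tendsto_PInfty)
next
  case False
  have "\<forall>\<^sub>F j in sequentially. w j \<noteq> t" using assms False
    by (intro tendsto_imp_eventually_ne) auto
  have lim: "(\<lambda>j. ereal (ln (1 / norm (w j - t)))) \<longlonglongrightarrow> ereal (ln (1 / norm (z - t)))"
    using assms False by (intro tendsto_intros) auto
  have ev: "\<forall>\<^sub>F j in sequentially. ereal (ln (1 / norm (w j - t))) = log_kernel (w j) t"
    using \<open>\<forall>\<^sub>F j in sequentially. w j \<noteq> t\<close>
    by eventually_elim (auto simp: log_kernel_def)
  have "(\<lambda>j. log_kernel (w j) t) \<longlonglongrightarrow> ereal (ln (1 / norm (z - t)))"
    by (rule Lim_transform_eventually[OF lim ev])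
  then show ?thesis using False by (simp add: log_kernel_def)
qed

text \<open>Lower semicontinuity of the potential, by Fatou's lemma.\<close>

lemma open_level_set: "open {z. \<phi> z < r}"
proof (cases "0 < r")
  case True
  show ?thesis
  proof (rule ccontr)
    assume "\<not> open {z. \<phi> z < r}"
    then obtain z where z: "\<phi> z < r" "\<And>e. 0 < e \<Longrightarrow> \<exists>w. dist w z < e \<and> \<not> \<phi> w < r"
      unfolding open_dist by auto
    have "\<forall>n. \<exists>w. dist w z < 1 / Suc n \<and> \<not> \<phi> w < r" using z(2) by simp
    then obtain w where w: "\<And>n. dist (w n) z < 1 / Suc n" "\<And>n. \<not> \<phi> (w n) < r" by metis
    have lim: "w \<longlonglongrightarrow> z"
    proof (rule metric_LIMSEQ_I)
      fix e :: real assume "0 < e"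
      then obtain k where k: "1 / real (Suc k) < e" by (rule nat_approx_posE)
      have "dist (w n) z < e" if "k \<le> n" for n
      proof -
        have "1 / real (Suc n) \<le> 1 / real (Suc k)" using that by (simp add: frac_le)
        then show ?thesis using w(1)[of n] k by linarith
      qed
      then show "\<exists>k. \<forall>n\<ge>k. dist (w n) z < e" by blast
    qed
    have le: "enn2ereal (pos_part (w n)) \<le> enn2ereal (neg_part (w n)) - ereal (ln r)" for n
      using w(2)[of n] phi_less_iff[OF True] by (simp add: not_less)
    obtain b where b: "0 \<le> b" "neg_part z = ennreal b" using neg_part_finite[of z]
      by (cases "neg_part z") auto
    have pw: "enn2ereal (pos_part (w n)) \<le> ereal (b + norm (w n - z) - ln r)" for n
    proof -
      have "neg_part (w n) \<le> ennreal (b + norm (w n - z))"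
        using neg_part_lipschitz[of "w n" z] b by simp
      then have "enn2ereal (neg_part (w n)) \<le> ereal (b + norm (w n - z))"
        using b by (metis add_nonneg_nonneg enn2ereal_ennreal less_eq_ennreal.rep_eq norm_ge_zero)
      then have "enn2ereal (neg_part (w n)) - ereal (ln r) \<le> ereal (b + norm (w n - z)) - ereal (ln r)"
        by (rule ereal_minus_mono) simp
      from order_trans[OF le this] show ?thesis by simp
    qed
    have wle: "pos_part (w n) \<le> e2ennreal (ereal (b + norm (w n - z) - ln r))" for n
      using e2ennreal_mono[OF pw[of n]] by simp
    have "pos_part z \<le> (\<integral>\<^sup>+ t. liminf (\<lambda>n. e2ennreal (log_kernel (w n) t)) \<partial>\<mu>)"
      unfolding pos_part_def
    proof (rule nn_integral_mono)
      fix t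
      have "(\<lambda>n. e2ennreal (log_kernel (w n) t)) \<longlonglongrightarrow> e2ennreal (log_kernel z t)"
        using continuous_on_tendsto_compose[OF continuous_on_e2ennreal[of UNIV] log_kernel_tendsto[OF lim]]
        by simp
      then show "e2ennreal (log_kernel z t) \<le> liminf (\<lambda>n. e2ennreal (log_kernel (w n) t))"
        by (simp add: lim_imp_Liminf)
    qed
    also have "\<dots> \<le> liminf (\<lambda>n. pos_part (w n))"
      unfolding pos_part_def by (rule nn_integral_liminf) measurable
    also have "\<dots> \<le> liminf (\<lambda>n. e2ennreal (ereal (b + norm (w n - z) - ln r)))"
      using wle by (intro Liminf_mono) auto
    also have "\<dots> = e2ennreal (ereal (b + norm (z - z) - ln r))"
      using lim
      by (intro lim_imp_Liminf continuous_on_tendsto_compose[OF continuous_on_e2ennreal[of UNIV]] tendsto_intros) auto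
    finally have pz: "pos_part z \<le> ennreal (b - ln r)" by simp
    have lt: "ereal (b - ln r) < enn2ereal (pos_part z)" using z(1) phi_less_iff[OF True, of z] b by simp
    show False
    proof (cases "0 \<le> b - ln r")
      case True
      then show ?thesis using pz lt by (metis enn2ereal_ennreal less_eq_ennreal.rep_eq not_less)
    next
      \<comment> \<open>Here \<open>ennreal (b - ln r)\<close> is 0 and the Fatou bound gives no
        contradiction. Instead, the nonnegative \<open>pos_part (w n)\<close> is at most
        \<open>b + norm (w n - z) - ln r\<close>, whose limit is negative.\<close>
      case False
      have "0 \<le> b + norm (w n - z) - ln r" for n
        using order_trans[OF enn2ereal_nonneg pw[of n]] by simp
      moreover have "(\<lambda>n. b + norm (w n - z) - ln r) \<longlonglongrightarrow> b + norm (z - z) - ln r"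
        using lim by (intro tendsto_intros)
      ultimately have "0 \<le> b + norm (z - z) - ln r"
        by (intro tendsto_lowerbound[of _ _ sequentially]) auto
      then show ?thesis using False by simp
    qed
  qed
next
  case False
  then have "{z. \<phi> z < r} = {}" using phi_nonneg by (auto simp: not_less intro: order_trans)
  then show ?thesis by simp
qed

text \<open>A point off the closed support has positive distance from it, so the kernel is bounded
  almost everywhere and the Bochner integral represents the potential.\<close>

lemma phi_off_support:
  assumes z: "z \<notin> K"
  shows "integrable \<mu> (\<lambda>t. ln (norm (z - t)))" "\<phi> z = exp (\<integral>t. ln (norm (z - t)) \<partial>\<mu>)"
proof -
  obtain e where e: "0 < e" "ball z e \<inter> K = {}"
    using closed_K z by (metis Compl_iff disjoint_eq_subset_Compl open_Compl open_contains_ball)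
  define B where "B = \<bar>ln e\<bar> + \<bar>ln (norm z + M + 1)\<bar>"
  have "AE t in \<mu>. norm (ln (norm (z - t))) \<le> B"
    using AE_K
  proof eventually_elim
    case (elim t)
    then have 1: "e \<le> norm (z - t)" using e by (auto simp: dist_norm disjoint_iff not_less)
    have 2: "norm (z - t) \<le> norm z + M + 1" using elim K_bounded norm_triangle_ineq4[of z t] by force
    have "ln e \<le> ln (norm (z - t))" "ln (norm (z - t)) \<le> ln (norm z + M + 1)"
      using 1 2 e(1) by (auto intro!: ln_mono)
    then show ?case by (auto simp: B_def abs_if)
  qed
  then show int: "integrable \<mu> (\<lambda>t. ln (norm (z - t)))"
    by (rule integrable_const_bound) measurable
  obtain r q where rq: "0 \<le> r" "0 \<le> q" "(\<integral>\<^sup>+t. ennreal (ln (norm (z - t))) \<partial>\<mu>) = ennreal r"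
      "(\<integral>\<^sup>+t. ennreal (- ln (norm (z - t))) \<partial>\<mu>) = ennreal q" "(\<integral>t. ln (norm (z - t)) \<partial>\<mu>) = r - q"
    using integrableE[OF int] by metis
  have "pos_part z = (\<integral>\<^sup>+t. ennreal (- ln (norm (z - t))) \<partial>\<mu>)"
    unfolding pos_part_def
  proof (rule nn_integral_cong_AE, use AE_K in eventually_elim)
    case (elim t)
    then have "t \<noteq> z" using z by auto
    then show ?case by (simp add: log_kernel_def ln_div)
  qed
  then have "log_potential \<mu> z = ereal (q - r)"
    using rq by (simp add: potential_eq neg_part_def)
  then show "\<phi> z = exp (\<integral>t. ln (norm (z - t)) \<partial>\<mu>)"
    using rq by (simp add: exp_neg_potential_def)
qed

text \<open>Almost every \<open>t\<close> is at distance at least \<open>norm z - M\<close> from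
  \<open>z\<close>. The resulting growth at infinity makes the level sets bounded.\<close>

lemma phi_ge:
  assumes "M < norm z"
  shows "norm z - M \<le> \<phi> z"
proof -
  have z: "z \<notin> K" using assms K_bounded by auto
  have "ln (norm z - M) = (\<integral>t. ln (norm z - M) \<partial>\<mu>)" by (simp add: prob_space)
  also have "\<dots> \<le> (\<integral>t. ln (norm (z - t)) \<partial>\<mu>)"
  proof (rule integral_mono_AE)
    show "AE t in \<mu>. ln (norm z - M) \<le> ln (norm (z - t))"
      using AE_K
    proof eventually_elim
      case (elim t)
      then have "norm z - M \<le> norm (z - t)" using K_bounded norm_triangle_ineq2[of z t] by force
      then show ?case using assms by (intro ln_mono) auto
    qed
  qed (use phi_off_support[OF z] in auto)
  finally have "exp (ln (norm z - M)) \<le> \<phi> z" using phi_off_support[OF z] by simp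
  then show ?thesis using assms by simp
qed

text \<open>Off the support, \<open>\<phi>\<close> is locally the modulus of a zero-free holomorphic function: integrate the
  expansion of \<open>Ln (1 + (z - z0) / (z0 - t))\<close> in powers of \<open>z - z0\<close>.\<close>

lemma phi_local_modulus:
  assumes e: "0 < e" "ball z0 (2 * e) \<inter> K = {}"
  obtains g where "g holomorphic_on ball z0 e" "\<And>z. z \<in> ball z0 e \<Longrightarrow> \<phi> z = norm (exp (g z))"
proof -
  have far: "AE t in \<mu>. 2 * e \<le> norm (z0 - t)"
    using AE_K by eventually_elim (use e in \<open>auto simp: dist_norm disjoint_iff not_less\<close>)
  \<comment> \<open>The coefficients of \<open>Ln (1 + w)\<close>; division by zero gives
    \<open>a 0 = 0\<close>, the missing constant term.\<close>
  define a :: "nat \<Rightarrow> complex" where "a n = (- 1) ^ Suc n / of_nat n" for n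
  have a: "norm (a n) \<le> 1" for n
    by (cases n) (auto simp: a_def norm_divide norm_power norm_mult divide_simps simp del: of_nat_Suc)
  define f where "f z n t = a n * ((z - z0) / (z0 - t)) ^ n" for z n t
  have meas [measurable]: "f z n \<in> borel_measurable \<mu>" for z n unfolding f_def by measurable
  define g where "g z = (\<integral>t. (\<Sum>n. f z n t) \<partial>\<mu>)" for z
  \<comment> \<open>The doubled radius in the hypothesis gives a geometric majorant independent of
    \<open>t\<close>, which justifies integrating term by term.\<close>
  have ratio: "norm ((z - z0) / (z0 - t)) \<le> 1 / 2" if "z \<in> ball z0 e" "2 * e \<le> norm (z0 - t)" for z t
  proof -
    have "norm (z - z0) / norm (z0 - t) \<le> e / (2 * e)"
      using that e by (intro frac_le) (auto simp: dist_norm norm_minus_commute)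
    then show ?thesis using e by (simp add: norm_divide)
  qed
  have bd: "norm (f z n t) \<le> (1 / 2) ^ n" if "z \<in> ball z0 e" "2 * e \<le> norm (z0 - t)" for z n t
  proof -
    have "norm (f z n t) \<le> 1 * norm ((z - z0) / (z0 - t)) ^ n"
      unfolding f_def norm_mult norm_power using a by (intro mult_right_mono) auto
    also have "\<dots> \<le> (1 / 2) ^ n" using power_mono[OF ratio[OF that]] by simp
    finally show ?thesis .
  qed
  have AE_bd: "AE t in \<mu>. norm (f z n t) \<le> (1 / 2) ^ n" if "z \<in> ball z0 e" for z n
    using far by eventually_elim (rule bd[OF that])
  have int: "integrable \<mu> (f z n)" if "z \<in> ball z0 e" for z n
    using AE_bd[OF that] by (rule integrable_const_bound) measurable
  have sum_AE: "AE t in \<mu>. summable (\<lambda>n. norm (f z n t))" if "z \<in> ball z0 e" for z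
    using far
    by eventually_elim (rule summable_comparison_test'[where g = "\<lambda>n. (1 / 2 :: real) ^ n" and N = 0],
        use bd[OF that] in \<open>auto intro: summable_geometric\<close>)
  have sum_int: "summable (\<lambda>n. \<integral>t. norm (f z n t) \<partial>\<mu>)" if z: "z \<in> ball z0 e" for z
  proof (rule summable_comparison_test'[where g = "\<lambda>n. (1 / 2 :: real) ^ n" and N = 0])
    fix n
    have "(\<integral>t. norm (f z n t) \<partial>\<mu>) \<le> (\<integral>t. (1 / 2) ^ n \<partial>\<mu>)"
      by (rule integral_mono_AE) (use int[OF z] AE_bd[OF z] in auto)
    then show "norm (\<integral>t. norm (f z n t) \<partial>\<mu>) \<le> (1 / 2) ^ n"
      by (simp add: prob_space)
  qed (auto intro: summable_geometric)
  have "g holomorphic_on ball z0 e"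
  proof (rule power_series_holomorphic)
    fix z assume z: "z \<in> ball z0 e"
    have "(\<lambda>n. \<integral>t. f z n t \<partial>\<mu>) sums g z"
      unfolding g_def using int[OF z] sum_AE[OF z] sum_int[OF z] by (rule sums_integral)
    moreover have "(\<integral>t. f z n t \<partial>\<mu>) = (\<integral>t. a n * (1 / (z0 - t)) ^ n \<partial>\<mu>) * (z - z0) ^ n" for n
      unfolding f_def by (subst integral_mult_left_zero[symmetric]) (simp add: power_divide mult_ac)
    ultimately show "(\<lambda>n. (\<integral>t. a n * (1 / (z0 - t)) ^ n \<partial>\<mu>) * (z - z0) ^ n) sums g z" by simp
  qed
  moreover have "\<phi> z = norm (exp (of_real (\<integral>t. ln (norm (z0 - t)) \<partial>\<mu>) + g z))" if z: "z \<in> ball z0 e" for z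
  proof -
    have z0K: "z0 \<notin> K" and zK: "z \<notin> K" using e z by (auto simp: disjoint_iff)
    have int_sum: "integrable \<mu> (\<lambda>t. \<Sum>n. f z n t)"
      using int[OF z] sum_AE[OF z] sum_int[OF z] by (rule integrable_suminf)
    have "AE t in \<mu>. ln (norm (z - t)) = ln (norm (z0 - t)) + Re (\<Sum>n. f z n t)"
      using far
    proof eventually_elim
      case (elim t)
      let ?w = "(z - z0) / (z0 - t)"
      have w: "norm ?w < 1" using ratio[OF z elim] by simp
      then have "(\<lambda>n. f z n t) sums Ln (1 + ?w)" unfolding f_def a_def by (rule Ln_series)
      then have s: "(\<Sum>n. f z n t) = Ln (1 + ?w)" by (rule sums_unique[symmetric])
      have nz: "z0 - t \<noteq> 0" using elim e by auto
      have nz1: "1 + ?w \<noteq> 0"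
      proof
        assume "1 + ?w = 0"
        then have "?w = - 1" by (simp add: add_eq_0_iff)
        then show False using w by simp
      qed
      have "z - t = (z0 - t) * (1 + ?w)" using nz by (simp add: field_simps)
      then have "ln (norm (z - t)) = ln (norm (z0 - t) * norm (1 + ?w))" by (simp add: norm_mult)
      also have "\<dots> = ln (norm (z0 - t)) + ln (norm (1 + ?w))" using nz nz1 by (simp add: ln_mult)
      finally show ?case using nz1 by (simp add: s Re_Ln)
    qed
    then have "(\<integral>t. ln (norm (z - t)) \<partial>\<mu>) = (\<integral>t. ln (norm (z0 - t)) + Re (\<Sum>n. f z n t) \<partial>\<mu>)"
      by (intro integral_cong_AE) (use int_sum in \<open>auto simp: borel_measurable_integrable\<close>)
    also have "\<dots> = (\<integral>t. ln (norm (z0 - t)) \<partial>\<mu>) + (\<integral>t. Re (\<Sum>n. f z n t) \<partial>\<mu>)"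
      using phi_off_support(1)[OF z0K] int_sum by (intro Bochner_Integration.integral_add) auto
    also have "(\<integral>t. Re (\<Sum>n. f z n t) \<partial>\<mu>) = Re (g z)"
      unfolding g_def using int_sum by simp
    finally show ?thesis using phi_off_support(2)[OF zK] by simp
  qed
  ultimately show thesis
    by (intro that[of "\<lambda>z. of_real (\<integral>t. ln (norm (z0 - t)) \<partial>\<mu>) + g z"] holomorphic_intros)
qed

lemma phi_local_modulus':
  assumes "open V" "z0 \<in> V" "V \<inter> K = {}"
  obtains g e where "0 < e" "ball z0 e \<subseteq> V" "g holomorphic_on ball z0 e"
    "\<And>z. z \<in> ball z0 e \<Longrightarrow> \<phi> z = norm (exp (g z))"
proof -
  obtain e where e: "0 < e" "ball z0 e \<subseteq> V" using assms open_contains_ball by blast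
  have "ball z0 (2 * (e / 2)) \<inter> K = {}" using e assms by auto
  then obtain g where "g holomorphic_on ball z0 (e / 2)" "\<And>z. z \<in> ball z0 (e / 2) \<Longrightarrow> \<phi> z = norm (exp (g z))"
    using phi_local_modulus[of "e / 2" z0] e(1) by auto
  moreover have "ball z0 (e / 2) \<subseteq> V" using e by (auto intro: subset_trans[OF subset_ball])
  ultimately show thesis using that e(1) by (meson half_gt_zero)
qed

lemma continuous_on_phi: "continuous_on (- K) \<phi>"
proof (rule continuous_at_imp_continuous_on, rule ballI)
  fix z assume z: "z \<in> - K"
  obtain g e where g: "0 < e" "g holomorphic_on ball z e" "\<And>w. w \<in> ball z e \<Longrightarrow> \<phi> w = norm (exp (g w))"
    by (rule phi_local_modulus'[of "- K" z]) (use closed_K z in auto)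
  have "continuous_on (ball z e) (\<lambda>w. norm (exp (g w)))"
    using g(2) by (intro continuous_intros holomorphic_on_imp_continuous_on)
  moreover have "continuous_on (ball z e) (\<lambda>w. norm (exp (g w))) = continuous_on (ball z e) \<phi>"
    using g(3) by (intro continuous_on_cong) auto
  ultimately have "continuous_on (ball z e) \<phi>" by simp
  then show "isCont \<phi> z" using g(1) by (simp add: continuous_on_eq_continuous_at)
qed

lemma bounded_level_set: "bounded {z. \<phi> z \<le> r}"
proof (rule bounded_subset[OF bounded_cball])
  show "{z. \<phi> z \<le> r} \<subseteq> cball 0 (M + \<bar>r\<bar>)"
  proof
    fix z assume "z \<in> {z. \<phi> z \<le> r}"
    then show "z \<in> cball 0 (M + \<bar>r\<bar>)" using phi_ge[of z] by (cases "M < norm z") auto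
  qed
qed

text \<open>A minimum of \<open>norm (exp (g z))\<close> is a maximum of
  \<open>norm (exp (- g z))\<close>, so the maximum principle makes it locally constant.\<close>

lemma phi_constant_ball:
  assumes V: "open V" "z0 \<in> V" "V \<inter> K = {}" and r: "0 < r" and ge: "\<And>z. z \<in> V \<Longrightarrow> r \<le> \<phi> z" "\<phi> z0 = r"
  obtains e where "0 < e" "\<And>z. z \<in> ball z0 e \<Longrightarrow> \<phi> z = r"
proof -
  obtain g e where g: "0 < e" "ball z0 e \<subseteq> V" "g holomorphic_on ball z0 e" "\<And>z. z \<in> ball z0 e \<Longrightarrow> \<phi> z = norm (exp (g z))"
    using phi_local_modulus'[OF V] by metis
  have "(\<lambda>z. exp (- g z)) constant_on ball z0 e"
  proof (rule maximum_modulus_principle[of _ _ "ball z0 e" z0])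
    show "norm (exp (- g z)) \<le> norm (exp (- g z0))" if "z \<in> ball z0 e" for z
      using ge(1)[of z] ge(2) g that r
      by (auto simp: exp_minus norm_inverse simp del: norm_exp_eq_Re intro!: le_imp_inverse_le)
  qed (use g in \<open>auto intro!: holomorphic_intros\<close>)
  then obtain y where y: "\<And>z. z \<in> ball z0 e \<Longrightarrow> exp (- g z) = y"
    by (auto simp: constant_on_def)
  have "\<phi> z = inverse (norm y)" if "z \<in> ball z0 e" for z
    using g(4)[OF that] y[OF that] by (metis exp_minus inverse_inverse_eq norm_inverse)
  then have "\<phi> z = r" if "z \<in> ball z0 e" for z using that ge(2) g(1) by (metis centre_in_ball)
  then show thesis using that g(1) by blast
qed

text \<open>The interior of \<open>{z. \<phi> z = r}\<close> is bounded, and open and closed relative to the complement of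
  \<open>E\<close>; hence it is empty. So \<open>\<phi>\<close> has no local minimum of value \<open>r\<close> off \<open>E\<close>.\<close>

lemma le_level_subset_closure:
  assumes E: "closed E" "K \<subseteq> E" "E \<subseteq> {z. \<phi> z < r}" and conn: "connectedin riemann_sphere (sphere_compl E)"
  shows "{z. \<phi> z \<le> r} \<subseteq> closure {z. \<phi> z < r}"
proof (rule ccontr)
  assume "\<not> ?thesis"
  then obtain z1 where z1: "\<phi> z1 = r" "z1 \<notin> closure {z. \<phi> z < r}"
    using closure_subset[of "{z. \<phi> z < r}"] by (auto simp: subset_iff le_less)
  obtain x where "x \<in> K" using K_nonempty by blast
  then have r: "0 < r" using E phi_nonneg[of x] by force
  define W where "W = {z \<in> - E. \<exists>e>0. \<forall>w\<in>ball z e. \<phi> w = r}"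
  have "z1 \<in> W"
  proof -
    have V: "open (- closure {z. \<phi> z < r})" "z1 \<in> - closure {z. \<phi> z < r}" using z1 by auto
    have "- closure {z. \<phi> z < r} \<inter> K = {}" using E closure_subset[of "{z. \<phi> z < r}"]
      by blast
    moreover have "r \<le> \<phi> z" if "z \<in> - closure {z. \<phi> z < r}" for z
      using that closure_subset[of "{z. \<phi> z < r}"] by (auto simp: not_less[symmetric])
    ultimately obtain e where "0 < e" "\<And>z. z \<in> ball z1 e \<Longrightarrow> \<phi> z = r"
      using phi_constant_ball[OF V _ r _ z1(1)] by blast
    moreover have "z1 \<notin> E" using E z1 by auto
    ultimately show ?thesis by (auto simp: W_def)
  qed
  have "open W" unfolding open_contains_ball
  proof
    fix z assume "z \<in> W"
    then obtain e where e: "0 < e" "\<forall>w\<in>ball z e. \<phi> w = r" and z: "z \<in> - E"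
      by (auto simp: W_def)
    have "ball z e \<subseteq> W"
    proof
      fix w assume w: "w \<in> ball z e"
      obtain e' where e': "0 < e'" "ball w e' \<subseteq> ball z e" using w open_contains_ball by blast
      have "w \<notin> E" using E(3) e(2) w by auto
      then show "w \<in> W" using e e' by (auto simp: W_def intro!: exI[of _ e'])
    qed
    then show "\<exists>e>0. ball z e \<subseteq> W" using e(1) by blast
  qed
  \<comment> \<open>Near \<open>z\<close> the function \<open>\<phi>\<close> is the modulus of a
    holomorphic function whose modulus is constant near a point of \<open>W\<close>; that function
    is then constant on the whole ball.\<close>
  have clos: "z \<in> W" if z: "z \<in> closure W" "z \<in> - E" for z
  proof -
    have "- E \<inter> K = {}" using E by auto
    then obtain g e where g: "0 < e" "ball z e \<subseteq> - E" "g holomorphic_on ball z e" "\<And>w. w \<in> ball z e \<Longrightarrow> \<phi> w = norm (exp (g w))"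
      using phi_local_modulus'[of "- E" z] E(1) z(2) by (metis open_Compl)
    have "ball z e \<inter> W \<noteq> {}" using z(1) g(1)
      by (metis centre_in_ball disjoint_iff open_Int_closure_eq_empty open_ball)
    then obtain w where w: "w \<in> ball z e" "w \<in> W" by blast
    then obtain d where d: "0 < d" "\<forall>v\<in>ball w d. \<phi> v = r" by (auto simp: W_def)
    have "(\<lambda>v. exp (g v)) constant_on ball z e"
    proof (rule maximum_modulus_principle[of _ _ "ball w d \<inter> ball z e" w])
      show "norm (exp (g v)) \<le> norm (exp (g w))" if "v \<in> ball w d \<inter> ball z e" for v
        using g(4)[of v] g(4)[of w] d w that by simp
    qed (use g w d in \<open>auto intro!: holomorphic_intros\<close>)
    then obtain y where y: "\<And>v. v \<in> ball z e \<Longrightarrow> exp (g v) = y"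
      by (auto simp: constant_on_def)
    have "\<phi> v = r" if "v \<in> ball z e" for v
      using g(4)[OF that] g(4)[OF w(1)] y[OF that] y[OF w(1)] d by (metis centre_in_ball)
    then show ?thesis using g(1) z(2) by (auto simp: W_def)
  qed
  have "W \<subseteq> {z. \<phi> z \<le> r}" by (auto simp: W_def)
  then have "compact (closure W)" using bounded_level_set bounded_subset compact_closure by blast
  \<comment> \<open>As \<open>W\<close> is bounded, the complement of its closure is a neighbourhood
    of infinity. So a nonempty \<open>W\<close> would be separated from infinity in the connected
    set \<open>sphere_compl E\<close>.\<close>
  then have o2: "openin riemann_sphere (insert None (Some ` (- closure W)))"
    unfolding openin_Alexandroff_compactification
    by (intro disjI2 exI[of _ "closure W"]) (auto simp: Compl_eq_Diff_UNIV)
  have o1: "openin riemann_sphere (Some ` W)" using \<open>open W\<close> by simp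
  have S: "sphere_compl E = insert None (Some ` (- E))"
    by (auto simp: sphere_compl_def topspace_Alexandroff_compactification)
  have "sphere_compl E \<subseteq> Some ` W \<union> insert None (Some ` (- closure W))"
    unfolding S using clos by auto
  moreover have "Some ` W \<inter> insert None (Some ` (- closure W)) \<inter> sphere_compl E = {}"
    using closure_subset[of W] by auto
  moreover have "Some ` W \<inter> sphere_compl E \<noteq> {}" using \<open>z1 \<in> W\<close>
    by (auto simp: S W_def)
  moreover have "insert None (Some ` (- closure W)) \<inter> sphere_compl E \<noteq> {}" by (auto simp: S)
  ultimately show False using conn o1 o2 unfolding connectedin by blast
qed

text \<open>The minimum of \<open>\<phi>\<close> over the points outside \<open>\<Omega>\<close> is
  a possible \<open>r'\<close>: it exceeds \<open>r\<close> because all points with value at most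
  \<open>r\<close> lie in \<open>\<Omega>\<close>. Cutting off at \<open>r + 1\<close> makes the set
  compact.\<close>

lemma level_set_in_neighbourhood:
  assumes "open \<Omega>" "closure {z. \<phi> z < r} \<subseteq> \<Omega>" "{z. \<phi> z \<le> r} \<subseteq> closure {z. \<phi> z < r}" "K \<subseteq> {z. \<phi> z < r}"
  obtains r' where "r < r'" "{z. \<phi> z < r'} \<subseteq> \<Omega>"
proof -
  define C where "C = {z \<in> - \<Omega>. \<phi> z \<le> r + 1}"
  have sub: "- \<Omega> \<subseteq> - K" using assms(2,4) closure_subset by blast
  have "closed C" unfolding C_def
    using assms(1)
    by (intro continuous_on_closed_Collect_le continuous_on_subset[OF continuous_on_phi sub]) (auto intro: continuous_intros)
  moreover have "bounded C" by (rule bounded_subset[OF bounded_level_set[of "r + 1"]]) (auto simp: C_def)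
  ultimately have comp: "compact C" by (simp add: compact_eq_bounded_closed)
  show thesis
  proof (cases "C = {}")
    case True
    then show ?thesis using that[of "r + 1"] by (force simp: C_def)
  next
    case False
    have "continuous_on C \<phi>"
      by (rule continuous_on_subset[OF continuous_on_phi]) (use sub in \<open>auto simp: C_def\<close>)
    then obtain x where x: "x \<in> C" "\<And>z. z \<in> C \<Longrightarrow> \<phi> x \<le> \<phi> z"
      using continuous_attains_inf[OF comp False] by metis
    have "r < \<phi> x" using x(1) assms(2,3) by (force simp: C_def)
    moreover have "{z. \<phi> z < \<phi> x} \<subseteq> \<Omega>" using x by (force simp: C_def)
    ultimately show ?thesis using that by blast
  qed
qed

end

section \<open>Meromorphic continuation as a quotient\<close>

lemma poly_eventually_nonzero:
  fixes p :: "complex poly"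
  assumes "p \<noteq> 0"
  shows "\<forall>\<^sub>F w in at z. poly p w \<noteq> 0"
proof -
  have "finite ({w. poly p w = 0} - {z})" using poly_roots_finite[OF assms] by auto
  then have "open (- ({w. poly p w = 0} - {z}))" by (intro open_Compl finite_imp_closed)
  then have "\<forall>\<^sub>F w in at z. w \<in> - ({w. poly p w = 0} - {z})"
    by (intro eventually_at_in_open') auto
  then show ?thesis using eventually_neq_at_within[of z z UNIV] by eventually_elim auto
qed

lemma analytic_on_poly: "poly p analytic_on S" for p :: "complex poly"
  by (rule analytic_on_subset[of _ UNIV]) (auto simp: analytic_on_open intro!: holomorphic_intros)

lemma zorder_poly:
  fixes p :: "complex poly"
  assumes "p \<noteq> 0"
  shows "zorder (poly p) z = int (order z p)"
proof -
  obtain g where g: "p = [:- z, 1:] ^ order z p * g" "\<not> [:- z, 1:] dvd g"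
    using order_decomp[OF assms] by blast
  show ?thesis
  proof (rule zorder_eqI[of UNIV z "poly g"])
    show "poly g z \<noteq> 0" using g(2) by (simp add: poly_eq_0_iff_dvd)
    show "poly p w = poly g w * (w - z) powi int (order z p)" for w
      by (subst g(1)) simp
  qed (auto intro!: holomorphic_intros)
qed

text \<open>A pole excludes that \<open>H\<close> vanishes identically near \<open>z\<close>, so the
  orders subtract, and that of the analytic \<open>H\<close> is nonnegative.\<close>

lemma pole_order_quotient_le:
  fixes p :: "complex poly"
  assumes H: "H analytic_on {z}" and p: "p \<noteq> 0" and pole: "is_pole (\<lambda>w. H w / poly p w) z"
  shows "pole_order (\<lambda>w. H w / poly p w) z \<le> order z p"
proof -
  have "\<forall>\<^sub>F w in at z. H w / poly p w \<noteq> 0" using pole by (rule non_zero_neighbour_pole)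
  then have "\<forall>\<^sub>F w in at z. H w \<noteq> 0" by eventually_elim auto
  then have fH: "\<exists>\<^sub>F w in at z. H w \<noteq> 0" by (intro eventually_frequently) auto
  have fp: "\<exists>\<^sub>F w in at z. poly p w \<noteq> 0"
    using poly_eventually_nonzero[OF p] by (intro eventually_frequently) auto
  have "zorder (\<lambda>w. H w / poly p w) z = zorder H z - zorder (poly p) z"
    using H fH fp by (intro zorder_divide analytic_on_imp_meromorphic_on analytic_on_poly)
  then have "- zorder (\<lambda>w. H w / poly p w) z \<le> int (order z p)"
    using zorder_ge_0[OF H fH] zorder_poly[OF p, of z] by simp
  then show ?thesis by (simp add: pole_order_def)
qed

lemma eq_of_eventually_eq:
  fixes g h :: "complex \<Rightarrow> complex"
  assumes "isCont g z" "isCont h z" "\<forall>\<^sub>F w in at z. g w = h w"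
  shows "g z = h z"
proof -
  have "(g \<longlongrightarrow> g z) (at z)" "(h \<longlongrightarrow> h z) (at z)" using assms
    by (auto simp: isCont_def)
  moreover from this(2) have "(g \<longlongrightarrow> h z) (at z)" using assms(3)
    by (metis (mono_tags, lifting) tendsto_cong)
  ultimately show ?thesis using tendsto_unique trivial_limit_at by blast
qed

text \<open>The values of the continuation at the zeros of \<open>Q\<close> in \<open>V\<close> are those of \<open>f\<close>: a continuation must agree
  with \<open>f\<close> at every point near \<open>E\<close>, while \<open>H z / 0 = 0\<close>.\<close>

lemma in_M_quotient:
  fixes Q :: "complex poly"
  assumes \<Omega>: "open \<Omega>" "H holomorphic_on \<Omega>" "B \<subseteq> \<Omega>" and Q: "Q \<noteq> 0" "degree Q \<le> m"
    and V: "open V" "E \<subseteq> V" "V \<subseteq> \<Omega>" "f holomorphic_on V"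
    and eq: "\<And>z. z \<in> V \<Longrightarrow> \<forall>\<^sub>F w in at z. f w * poly Q w = H w"
  shows "in_M m f E B"
proof -
  define G where "G w = H w / poly Q w" for w
  define F where "F w = (if poly Q w = 0 \<and> w \<in> V then f w else G w)" for w
  have H_an: "H analytic_on {z}" if "z \<in> \<Omega>" for z
    using \<Omega>(1,2) that by (metis analytic_at)
  have F_f: "F w = f w" if w: "w \<in> V" for w
  proof (cases "poly Q w = 0")
    case False
    have "isCont f w" using V(1,4) w by (metis analytic_at analytic_at_imp_isCont)
    moreover have "isCont H w" using H_an[of w] V(3) w by (auto intro: analytic_at_imp_isCont)
    ultimately have "f w * poly Q w = H w" using eq[OF w]
      by (intro eq_of_eventually_eq[where g = "\<lambda>w. f w * poly Q w"]) (auto intro!: continuous_intros)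
    then show ?thesis using False by (simp add: F_def G_def field_simps)
  qed (use w in \<open>simp add: F_def\<close>)
  \<comment> \<open>\<open>F\<close> and \<open>G\<close> differ at most at the finitely many zeros
    of \<open>Q\<close>, so poles and their orders can be computed from \<open>G\<close>.\<close>
  have F_G: "\<forall>\<^sub>F w in at z. F w = G w" for z
    using poly_eventually_nonzero[OF Q(1), of z] by eventually_elim (simp add: F_def)
  have "H analytic_on B" using H_an \<Omega>(3) analytic_on_analytic_at[of H B] by blast
  then have "G meromorphic_on B" unfolding G_def[abs_def]
    by (intro meromorphic_on_divide analytic_on_imp_meromorphic_on analytic_on_poly)
  then have F_mero: "F meromorphic_on B" by (subst meromorphic_on_cong[where g = G, OF F_G refl])
  have pole_iff: "is_pole F z \<longleftrightarrow> is_pole G z" for z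
    by (rule is_pole_cong) (use F_G in auto)
  have zord: "zorder F z = zorder G z" for z
    by (rule zorder_cong) (use F_G in auto)
  have roots: "poles_in F B \<subseteq> {z. poly Q z = 0}"
  proof
    fix z assume "z \<in> poles_in F B"
    then have z: "z \<in> B" "is_pole G z" by (auto simp: poles_in_def pole_iff)
    have "G analytic_on {z}" if "poly Q z \<noteq> 0"
      unfolding G_def[abs_def] using that H_an z(1) \<Omega>(3)
      by (intro analytic_on_divide analytic_on_poly) auto
    then show "z \<in> {z. poly Q z = 0}" using z(2) analytic_at_imp_no_pole by blast
  qed
  have fin: "finite {z. poly Q z = 0}" using poly_roots_finite[OF Q(1)] .
  have "(\<Sum>z\<in>poles_in F B. pole_order F z) \<le> (\<Sum>z\<in>poles_in F B. order z Q)"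
  proof (rule sum_mono)
    fix z assume "z \<in> poles_in F B"
    then have z: "z \<in> B" "is_pole G z" by (auto simp: poles_in_def pole_iff)
    then show "pole_order F z \<le> order z Q"
      using pole_order_quotient_le[of H z Q] H_an[of z] \<Omega>(3) Q(1) zord[of z]
      by (auto simp: G_def[abs_def] pole_order_def)
  qed
  also have "\<dots> \<le> (\<Sum>z | poly Q z = 0. order z Q)" by (rule sum_mono2[OF fin roots]) auto
  also have "\<dots> \<le> m" using sum_order_le_degree[OF Q(1)] Q(2) by linarith
  finally have "(\<Sum>z\<in>poles_in F B. pole_order F z) \<le> m" .
  then show ?thesis
    unfolding in_M_def meromorphic_continuation_def
    using finite_subset[OF roots fin] V(1,2) F_mero F_f by (intro exI[of _ F]) blast
qed

section \<open>Pade approximants\<close>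

text \<open>Coprimality makes the zeros of \<open>P\<close> disjoint from those of \<open>Q\<close>;
  comparing multiplicities in \<open>P * q = p * Q\<close> places them among the zeros of
  \<open>p\<close>, and those of \<open>Q\<close> among those of \<open>q\<close>. Over the complex
  numbers counting zeros gives the degree.\<close>

lemma pade_approximant_degree:
  assumes "pade_approximant \<beta> f E n m P Q"
  shows "degree P \<le> n" "degree Q \<le> m" "Q \<noteq> 0"
proof -
  obtain p q where Q: "Q \<noteq> 0" "coprime P Q" and pq: "degree p \<le> n" "degree q \<le> m" "q \<noteq> 0" "P * q = p * Q"
    using assms by (auto simp: pade_approximant_def pade_pair_def)
  show "Q \<noteq> 0" by (fact Q)
  have disj: "proots P \<inter># proots Q = {#}" if "P \<noteq> 0"
  proof (rule ccontr)
    assume "proots P \<inter># proots Q \<noteq> {#}"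
    then obtain a where "a \<in># proots P \<inter># proots Q" using multiset_nonemptyE by blast
    then have a: "a \<in># proots P" "a \<in># proots Q" by auto
    then have "[:- a, 1:] dvd P" "[:- a, 1:] dvd Q" using that Q(1) by (auto simp: poly_eq_0_iff_dvd)
    then have "is_unit [:- a, 1:]" by (rule coprime_common_divisor[OF Q(2)])
    then show False by (simp add: is_unit_iff_degree)
  qed
  have "degree P \<le> n \<and> degree Q \<le> m"
  proof (cases "P = 0")
    case True
    then show ?thesis using Q by (simp add: is_unit_iff_degree)
  next
    case False
    then have "p \<noteq> 0" using pq(3,4) by (metis mult_eq_0_iff)
    have "proots (P * q) = proots (p * Q)" using pq(4) by simp
    then have eq: "proots P + proots q = proots p + proots Q"
      using False pq(3) \<open>p \<noteq> 0\<close> Q(1) by (simp add: proots_mult)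
    have le: "x \<le> v \<and> y \<le> u" if "min x y = 0" "x + u = v + y" for x y u v :: nat
      using that by (auto simp: min_def split: if_splits)
    have "min (count (proots P) a) (count (proots Q) a) = 0" for a
      using arg_cong[OF disj[OF False], of "\<lambda>X. count X a"] by simp
    moreover have "count (proots P) a + count (proots q) a = count (proots p) a + count (proots Q) a" for a
      using arg_cong[OF eq, of "\<lambda>X. count X a"] by simp
    ultimately have "proots P \<subseteq># proots p \<and> proots Q \<subseteq># proots q"
      unfolding subseteq_mset_def using le by metis
    then have "proots P \<subseteq># proots p" "proots Q \<subseteq># proots q" by auto
    then have "degree P \<le> degree p" "degree Q \<le> degree q"
      by (metis size_mset_mono size_proots_complex)+
    then show ?thesis using pq by linarith
  qed
  then show "degree P \<le> n" "degree Q \<le> m" by auto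
qed

text \<open>The two normalizations differ only at zeros \<open>a\<close> outside \<open>D\<close>
  with \<open>norm a \<le> A\<close>, where z - a = -a (1 - z/a). The condition at 0 ensures that
  this constant is not zero.\<close>

lemma scaled_poly_eq_smult_normalized:
  assumes "1 \<le> A" "D \<subseteq> cball 0 A" "0 \<in># Z \<Longrightarrow> 0 \<in> D"
  shows "\<exists>s. s \<noteq> 0 \<and> norm s \<le> A ^ size Z \<and> scaled_poly A Z =
    smult s ((\<Prod>\<alpha>\<in>#{#\<alpha> \<in># Z. \<alpha> \<in> D#}. [:- \<alpha>, 1:]) * (\<Prod>\<alpha>\<in>#{#\<alpha> \<in># Z. \<alpha> \<notin> D#}. [:1, - (1 / \<alpha>):]))"
  using assms(3)
proof (induction Z)
  case empty
  then show ?case by (intro exI[of _ 1]) (simp add: scaled_poly_def)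
next
  case (add a Z)
  let ?R = "\<lambda>Z. (\<Prod>\<alpha>\<in>#{#\<alpha> \<in># Z. \<alpha> \<in> D#}. [:- \<alpha>, 1:]) * (\<Prod>\<alpha>\<in>#{#\<alpha> \<in># Z. \<alpha> \<notin> D#}. [:1, - (1 / \<alpha>):])"
  obtain s where s: "s \<noteq> 0" "norm s \<le> A ^ size Z" "scaled_poly A Z = smult s (?R Z)"
    using add by auto
  have sc: "scaled_poly A (add_mset a Z) = zero_factor A a * smult s (?R Z)"
    using s(3) by (simp add: scaled_poly_def)
  show ?case
  proof (cases "a \<in> D \<or> A < norm a")
    case True
    have "zero_factor A a * ?R Z = ?R (add_mset a Z)"
      using True assms(2) by (auto simp: zero_factor_def mult_ac simp del: mult_pCons_left mult_pCons_right)
    moreover have "norm s \<le> A ^ size (add_mset a Z)"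
      using s(2) assms(1) by (simp add: mult_le_cancel_right1 order_trans[OF s(2)])
    ultimately show ?thesis using s sc by (intro exI[of _ s]) simp
  next
    case False
    then have a: "norm a \<le> A" "a \<notin> D" "a \<noteq> 0" using add.prems by auto
    have "zero_factor A a = smult (- a) [:1, - (1 / a):]" using a by (simp add: zero_factor_def)
    then have "scaled_poly A (add_mset a Z) = smult (- a * s) (?R (add_mset a Z))"
      using a sc by (simp add: mult_ac del: mult_pCons_left mult_pCons_right smult_pCons)
    moreover have "norm (- a * s) \<le> A ^ size (add_mset a Z)"
      using a s(2) assms(1) by (simp add: norm_mult mult_mono)
    ultimately show ?thesis using a s by (intro exI[of _ "- a * s"]) simp
  qed
qed

lemma normalized_wrt_zero:
  assumes "normalized_wrt D Q" "Q \<noteq> 0" "0 \<in># proots Q"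
  shows "0 \<in> D"
proof (rule ccontr)
  assume "0 \<notin> D"
  have "poly Q 0 = 0" using assms(2,3) by (simp add: set_count_proots)
  moreover have "poly Q 0 \<noteq> 0"
    by (subst assms(1)[unfolded normalized_wrt_def])
      (use \<open>0 \<notin> D\<close> in \<open>auto simp: poly_prod_mset image_mset.compositionality o_def prod_mset_zero_iff\<close>)
  ultimately show False by simp
qed

text \<open>Eventually \<open>S k\<close> is at most \<open>q ^ n k\<close> with a fixed
  \<open>q < 1\<close>, that is, \<open>exp (- 2 * \<delta> * n k)\<close>; half of the exponent
  absorbs the constant \<open>C\<close>.\<close>

lemma root_limit_imp_geometric:
  fixes S :: "nat \<Rightarrow> real" and n :: "nat \<Rightarrow> nat"
  assumes n: "strict_mono n" "\<And>k. 0 < n k" and S: "\<And>k. 0 \<le> S k"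
    and lim: "(\<lambda>k. root (n k) (S k)) \<longlonglongrightarrow> L" "L < 1" and C: "0 < C"
  obtains \<delta> where "0 < \<delta>" "\<forall>\<^sub>F k in sequentially. C * S k \<le> exp (- \<delta> * real (n k))"
proof -
  define q where "q = (max L 0 + 1) / 2"
  have q: "L < q" "0 < q" "q < 1" using lim(2) by (auto simp: q_def max_def)
  define \<delta> where "\<delta> = - ln q / 2"
  have \<delta>: "0 < \<delta>" using q by (simp add: \<delta>_def)
  have "filterlim (\<lambda>k. real (n k)) at_top sequentially"
    using filterlim_subseq[OF n(1)] filterlim_compose filterlim_real_sequentially by blast
  then have "\<forall>\<^sub>F k in sequentially. ln C / \<delta> \<le> real (n k)"
    by (simp add: filterlim_at_top)
  moreover have "\<forall>\<^sub>F k in sequentially. root (n k) (S k) < q"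
    using order_tendstoD(2)[OF lim(1) q(1)] .
  ultimately have "\<forall>\<^sub>F k in sequentially. C * S k \<le> exp (- \<delta> * real (n k))"
  proof eventually_elim
    case (elim k)
    have "S k = root (n k) (S k) ^ n k" using n(2) S by (simp add: real_root_pow_pos2)
    also have "\<dots> \<le> q ^ n k" using elim(2) S n(2)
      by (intro power_mono) (auto intro: real_root_ge_zero)
    also have "\<dots> = exp (- \<delta> * real (n k)) * exp (- \<delta> * real (n k))"
    proof -
      have "q ^ n k = exp (real (n k) * ln q)" using q by (simp add: exp_of_nat_mult)
      then show ?thesis by (simp add: \<delta>_def field_simps flip: exp_add)
    qed
    finally have "C * S k \<le> C * (exp (- \<delta> * real (n k)) * exp (- \<delta> * real (n k)))" using C
      by (intro mult_left_mono) auto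
    also have "\<dots> \<le> exp (\<delta> * real (n k)) * (exp (- \<delta> * real (n k)) * exp (- \<delta> * real (n k)))"
    proof (rule mult_right_mono)
      have "ln C \<le> \<delta> * real (n k)" using elim(1) \<delta> by (simp add: field_simps)
      then show "C \<le> exp (\<delta> * real (n k))" using C by (metis exp_le_cancel_iff exp_ln)
    qed simp
    also have "\<dots> = exp (- \<delta> * real (n k))" by (simp flip: exp_add)
    finally show ?case .
  qed
  then show thesis using that \<delta> by blast
qed

lemma pole_poly_nonzero: "pole_poly F B \<noteq> 0"
  by (cases "finite (poles_in F B)") (auto simp: pole_poly_def)

text \<open>Identity theorem: on a connected domain a meromorphic function either vanishes off a
  sparse set or is nonzero off a sparse set, and vanishing on \<open>S\<close> excludes the
  latter.\<close>

lemma meromorphic_eq_extends: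
  assumes g: "g meromorphic_on D" and D: "open D" "connected D"
    and S: "open S" "S \<noteq> {}" "S \<subseteq> D" "\<And>z. z \<in> S \<Longrightarrow> g z = 0" and z: "z \<in> D"
  shows "\<forall>\<^sub>F w in at z. g w = 0"
proof -
  obtain s where s: "s \<in> S" using S by blast
  have "\<forall>\<^sub>F w in at s. w \<in> S" using S(1) s by (simp add: eventually_at_in_open')
  then have ev0: "\<forall>\<^sub>F w in at s. g w = 0" by eventually_elim (rule S(4))
  have "\<not> (\<forall>\<^sub>F w in cosparse D. g w \<noteq> 0)"
  proof
    assume "\<forall>\<^sub>F w in cosparse D. g w \<noteq> 0"
    then have "\<forall>\<^sub>F w in at s. g w \<noteq> 0" using s S(3)
      by (auto elim: eventually_cosparse_imp_eventually_at)
    then have "\<forall>\<^sub>F w in at s. False" using ev0 by eventually_elim auto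
    then show False by simp
  qed
  then have "\<forall>\<^sub>F w in cosparse D. g w = 0"
    using meromorphic_imp_constant_or_avoid[OF g D, of 0] by blast
  then show ?thesis using z by (intro eventually_cosparse_imp_eventually_at)
qed

lemma sup_norm_upper:
  assumes "compact K" "continuous_on K g" "z \<in> K"
  shows "norm (g z) \<le> sup_norm K g"
proof -
  have "compact (norm ` g ` K)" using assms by (intro compact_continuous_image continuous_intros)
  then have "bdd_above ((\<lambda>z. norm (g z)) ` K)"
    by (simp add: image_image bounded_imp_bdd_above compact_imp_bounded)
  then show ?thesis unfolding sup_norm_def using assms(3) by (intro cSUP_upper)
qed

lemma sup_norm_attained:
  assumes "compact K" "K \<noteq> {}" "continuous_on K g"
  obtains z where "z \<in> K" "sup_norm K g = norm (g z)"
proof -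
  have "continuous_on K (\<lambda>z. norm (g z))" using assms by (intro continuous_intros)
  then obtain z where z: "z \<in> K" "\<And>w. w \<in> K \<Longrightarrow> norm (g w) \<le> norm (g z)"
    using continuous_attains_sup[OF assms(1,2)] by blast
  have "sup_norm K g = norm (g z)" unfolding sup_norm_def
    using z by (intro antisym cSUP_least cSUP_upper bdd_aboveI2) (use assms(2) in auto)
  then show thesis using that z by blast
qed

theorem theorem2:
  fixes E :: "complex set"
    and \<mu> :: "complex measure"
    and \<beta> :: "nat \<Rightarrow> nat \<Rightarrow> complex"
    and m :: nat
    and f F :: "complex \<Rightarrow> complex"
    and P Qn :: "nat \<Rightarrow> complex poly"
    and n :: "nat \<Rightarrow> nat"
  defines "R \<equiv> R_mero m E \<mu> f"
    and "D \<equiv> D_mero m E \<mu> f"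
    and "Q \<equiv> pole_poly F (D_mero m E \<mu> f)"
  assumes "compact E"
    and "connectedin riemann_sphere (sphere_compl E)"
    and "dirichlet_regular (sphere_compl E)"
    and "\<mu> \<in> unit_measures (frontier E)"
    and "\<And>j k. 1 \<le> k \<Longrightarrow> k \<le> j \<Longrightarrow> \<beta> j k \<in> frontier E"
    and "f analytic_on E"
    and "ereal (rho_max E \<mu>) < R" and "R < \<infinity>"
    and "connected D"
    and "meromorphic_continuation f E D F"
    and "strict_mono n" and "\<And>k. 0 < n k"
    and "\<And>k. pade_approximant \<beta> f E (n k) m (P (n k)) (Qn (n k))"
    and "\<And>k. normalized_wrt D (Qn (n k))"
    and "\<And>K. compact K \<Longrightarrow> K \<noteq> {} \<Longrightarrow> K \<subseteq> D - E \<Longrightarrow>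
           (\<lambda>k. root (n k) (sup_norm K (remove_sings (\<lambda>z.
                  poly Q z * F z * poly (Qn (n k)) z - poly Q z * poly (P (n k)) z))))
             \<longlonglongrightarrow> sup_norm K (exp_neg_potential \<mu>) / real_of_ereal R"
    and "limsup (\<lambda>k. ereal (real (n (Suc k)) / real (n k))) < \<infinity>"
  shows "\<exists>z0 \<in> frontier D. \<forall>r>0. 0 < limsup (\<lambda>k. ereal (zero_measure (P (n k)) (ball z0 r)))"
proof (rule ccontr)
  assume contra: "\<not> ?thesis"
  note compact_E = assms(4) and conn = assms(5) and \<mu> = assms(7) and f_an = assms(9) and rho = assms(10)
    and R_fin = assms(11) and D_conn = assms(12) and F_cont = assms(13) and n_mono = assms(14)
    and n_pos = assms(15) and pade = assms(16) and normalized = assms(17) and limit = assms(18) and ratio = assms(19)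

  \<comment> \<open>The domain \<open>D\<close> as a sublevel set\<close>
  let ?\<phi> = "exp_neg_potential \<mu>"
  obtain R0 where R0: "R = ereal R0" using rho R_fin by (cases R) auto
  have D_eq: "D = {z. ?\<phi> z < R0}"
    using R0 by (simp add: D_def D_mero_def R_def level_set_def)
  obtain M where M: "0 \<le> M" "E \<subseteq> cball 0 M"
    using compact_imp_bounded[OF compact_E] by (metis bounded_pos less_imp_le mem_cball_0 subsetI)
  have closed_E: "closed E" using compact_E by (rule compact_imp_closed)
  have frE: "frontier E \<subseteq> E" using closed_E by (rule frontier_subset_closed)
  interpret pot: compactly_supported_measure \<mu> "frontier E" M
  proof (intro compactly_supported_measure.intro compactly_supported_measure_axioms.intro)
    show "prob_space \<mu>" "sets \<mu> = sets borel" "emeasure \<mu> (- frontier E) = 0"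
      using \<mu> by (auto simp: unit_measures_def)
  qed (use M frE in auto)
  obtain x0 where x0: "x0 \<in> E" using pot.K_nonempty frE by blast
  have "bdd_above (?\<phi> ` E)"
    by (rule bdd_aboveI2[of _ _ "2 * M + 1"]) (use pot.phi_le M(2) in \<open>force intro: order_trans\<close>)
  then have phi_rho: "?\<phi> z \<le> rho_max E \<mu>" if "z \<in> E" for z
    unfolding rho_max_def using that by (rule cSUP_upper[rotated])
  have rho_R0: "rho_max E \<mu> < R0" using rho R0 by simp
  have E_D: "E \<subseteq> D" using phi_rho rho_R0 by (force simp: D_eq)
  have open_D: "open D" unfolding D_eq by (rule pot.open_level_set)
  have bounded_D: "bounded D" unfolding D_eq
    by (rule bounded_subset[OF pot.bounded_level_set[of R0]]) auto
  have R0_pos: "0 < R0" using phi_rho[OF x0] rho_R0 pot.phi_nonneg[of x0] by linarith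
  have rho_min_le: "rho_min E \<mu> \<le> rho_max E \<mu>"
  proof -
    have "rho_min E \<mu> \<le> ?\<phi> x0" unfolding rho_min_def
      by (rule cINF_lower[OF bdd_belowI2[of _ 0] x0]) (rule pot.phi_nonneg)
    then show ?thesis using phi_rho[OF x0] by linarith
  qed
  have R_upper: "r \<le> R0" if "rho_min E \<mu> < r" "in_M m f E (level_set \<mu> (ereal r))" for r
  proof -
    have "ereal r \<le> R" unfolding R_def R_mero_def using that by (intro SUP_upper) auto
    then show ?thesis using R0 by simp
  qed

  \<comment> \<open>The continuation on \<open>D\<close> and its good points\<close>
  have F_mero: "F meromorphic_on D" using F_cont by (simp add: meromorphic_continuation_def)
  obtain U where U: "open U" "E \<inter> D \<subseteq> U" "\<And>z. z \<in> U \<Longrightarrow> F z = f z"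
    using F_cont by (auto simp: meromorphic_continuation_def)
  obtain V0 where V0: "open V0" "E \<subseteq> V0" "f holomorphic_on V0"
    using f_an by (auto simp: analytic_on_holomorphic)
  define V where "V = U \<inter> V0 \<inter> D"
  have V: "open V" "E \<subseteq> V" "V \<subseteq> D" "f holomorphic_on V"
    using U V0 E_D open_D by (auto simp: V_def intro: holomorphic_on_subset)
  have F_f: "F z = f z" if "z \<in> V" for z using U(3) that by (auto simp: V_def)
  have ev_V: "\<forall>\<^sub>F w in at z. w \<in> V" if "z \<in> V" for z
    using V(1) that by (rule eventually_at_in_open')
  \<comment> \<open>If \<open>F\<close> vanished off a sparse set, then \<open>f\<close> would be
    continued by 0 to every level set (the quotient 0 / 1), and radii beyond \<open>R0\<close> would
    be admissible.\<close>
  have F_nonzero: "\<forall>\<^sub>F w in cosparse D. F w \<noteq> 0"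
  proof (rule ccontr)
    assume "\<not> ?thesis"
    then have zero: "\<forall>\<^sub>F w in cosparse D. F w = 0"
      using meromorphic_imp_constant_or_avoid[OF F_mero open_D D_conn, of 0] by blast
    have "in_M m f E B" for B
    proof (rule in_M_quotient[of UNIV "\<lambda>_. 0" B 1 m V])
      fix z assume z: "z \<in> V"
      then have "\<forall>\<^sub>F w in at z. F w = 0" using zero V(3) eventually_cosparse_imp_eventually_at
        by blast
      then show "\<forall>\<^sub>F w in at z. f w * poly 1 w = 0"
        using ev_V[OF z] by eventually_elim (simp add: F_f)
    qed (use V in auto)
    then have "max R0 (rho_min E \<mu>) + 1 \<le> R0" by (intro R_upper) auto
    then show False by simp
  qed
  \<comment> \<open>The limit hypothesis concerns compact subsets of \<open>D - E\<close> and
    carries the factor \<open>Q\<close>, which has to be divided out; \<open>F z \<noteq> 0\<close>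
    serves the lower bound for the numerators.\<close>
  define D' where "D' = {z \<in> D - E. F analytic_on {z} \<and> F z \<noteq> 0 \<and> poly Q z \<noteq> 0}"
  have Q_nz: "Q \<noteq> 0" unfolding Q_def by (rule pole_poly_nonzero)
  have cont_F: "continuous_on D' F"
    by (rule continuous_at_imp_continuous_on) (auto simp: D'_def intro: analytic_at_imp_isCont)
  have open_D': "open D'"
  proof (subst open_subopen, rule ballI)
    fix z assume z: "z \<in> D'"
    then obtain S where S: "open S" "z \<in> S" "F holomorphic_on S" by (auto simp: D'_def analytic_at)
    define T where "T = S \<inter> (D - E)"
    have T: "open T" "F holomorphic_on T"
      using S open_D closed_E by (auto simp: T_def intro: holomorphic_on_subset open_Diff)
    define g where "g w = F w * poly Q w" for w
    have "continuous_on T g" unfolding g_def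
      using T(2) by (intro continuous_intros holomorphic_on_imp_continuous_on)
    then have "open (T \<inter> g -` (- {0}))" using T(1) by (intro continuous_open_preimage) auto
    moreover have "z \<in> T \<inter> g -` (- {0})" using z S by (auto simp: T_def g_def D'_def)
    moreover have "T \<inter> g -` (- {0}) \<subseteq> D'"
      using T by (auto simp: T_def g_def D'_def analytic_at)
    ultimately show "\<exists>T. open T \<and> z \<in> T \<and> T \<subseteq> D'" by blast
  qed
  have dense: "W \<inter> D' \<noteq> {}" if W: "open W" "W \<inter> frontier D \<noteq> {}" for W
  proof -
    obtain z0 where z0: "z0 \<in> W" "z0 \<in> frontier D" using W(2) by blast
    \<comment> \<open>\<open>E\<close> lies in the open set \<open>D\<close>, which is disjoint from
      its frontier.\<close>
    have "z0 \<notin> E" using z0(2) open_D E_D by (auto simp: frontier_def interior_open)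
    then have "(W - E) \<inter> closure D \<noteq> {}" using z0 by (auto simp: frontier_def)
    then have "(W - E) \<inter> D \<noteq> {}" using W(1) closed_E
      by (simp add: open_Int_closure_eq_empty open_Diff)
    then obtain z where z: "z \<in> (W - E) \<inter> D" by blast
    have "\<forall>\<^sub>F w in at z. w \<in> (W - E) \<inter> D"
      using W(1) closed_E open_D z by (intro eventually_at_in_open') auto
    moreover have "\<forall>\<^sub>F w in at z. F w \<noteq> 0"
      using F_nonzero z eventually_cosparse_imp_eventually_at by blast
    moreover have "\<forall>\<^sub>F w in at z. F analytic_on {w}"
      using meromorphic_on_imp_analytic_cosparse[OF F_mero] z eventually_cosparse_imp_eventually_at by blast
    ultimately have "\<forall>\<^sub>F w in at z. w \<in> W \<inter> D'"
      using poly_eventually_nonzero[OF Q_nz, of z] by eventually_elim (auto simp: D'_def)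
    then show ?thesis using eventually_happens trivial_limit_at by fastforce
  qed

  \<comment> \<open>Rescaled approximants and their convergence on \<open>D'\<close>\<close>
  obtain B where B: "0 < B" "D \<subseteq> ball 0 B" using bounded_subset_ballD[OF bounded_D] by blast
  define A where "A = max 1 (4 * B)"
  have A: "1 \<le> A" "D \<subseteq> ball 0 (A / 4)" "D \<subseteq> cball 0 A"
    using B by (auto simp: A_def dest!: subsetD)
  define Z where "Z k = proots (Qn (n k))" for k
  have Qn: "degree (P (n k)) \<le> n k" "degree (Qn (n k)) \<le> m" "Qn (n k) \<noteq> 0" for k
    using pade_approximant_degree[OF pade[of k]] by auto
  have size_Z: "size (Z k) \<le> m" for k using Qn(2)[of k] by (simp add: Z_def size_proots_complex)
  \<comment> \<open>Numerator and denominator are multiplied by the same \<open>s k\<close>, so the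
    error is too; the upper bound on \<open>norm (s k)\<close> preserves its decay.\<close>
  have "\<exists>s. s \<noteq> 0 \<and> norm s \<le> A ^ size (Z k) \<and> scaled_poly A (Z k) = smult s (Qn (n k))" for k
    using scaled_poly_eq_smult_normalized[OF A(1) A(3), of "Z k"] normalized[of k] normalized_wrt_zero[OF normalized Qn(3), of k]
    by (simp add: normalized_wrt_def Z_def)
  then obtain s where s: "\<And>k. s k \<noteq> 0" "\<And>k. norm (s k) \<le> A ^ size (Z k)"
      "\<And>k. scaled_poly A (Z k) = smult (s k) (Qn (n k))" by metis
  define p where "p k = smult (s k) (P (n k))" for k
  obtain c0 where "limsup (\<lambda>k. ereal (real (n (Suc k)) / real (n k))) < ereal c0"
    using ratio less_PInf_Ex_of_nat by auto
  then have ev_ratio: "\<forall>\<^sub>F k in sequentially. ereal (real (n (Suc k)) / real (n k)) < ereal c0" by (rule Limsup_lessD)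
  define c where "c = max 1 c0"
  have approx: "\<exists>r>0. geometric_decay n (\<lambda>k w. F w * poly (scaled_poly A (Z k)) w - poly (p k) w) (cball z r)"
    if z: "z \<in> D'" for z
  proof -
    obtain r where r: "0 < r" "cball z r \<subseteq> D'" using open_D' z open_contains_cball by blast
    define K where "K = cball z r"
    have K: "compact K" "K \<noteq> {}" "K \<subseteq> D - E" "K \<subseteq> D'" using r
      by (auto simp: K_def D'_def)
    have K_fr: "K \<subseteq> - frontier E" using K frE by blast
    define g where "g k w = poly Q w * F w * poly (Qn (n k)) w - poly Q w * poly (P (n k)) w" for k w
    \<comment> \<open>On \<open>D'\<close> all ingredients are analytic, so there is nothing to
      remove.\<close>
    have rem: "remove_sings (g k) w = g k w" if "w \<in> K" for k w
      unfolding g_def using that K(4)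
      by (intro remove_sings_at_analytic analytic_on_diff analytic_on_mult analytic_on_poly) (auto simp: D'_def)
    have sup_eq: "sup_norm K (remove_sings (g k)) = sup_norm K (g k)" for k
      unfolding sup_norm_def using rem by simp
    have cont_g: "continuous_on K (g k)" for k
      unfolding g_def by (intro continuous_intros continuous_on_subset[OF cont_F K(4)])
    obtain y where y: "y \<in> K" "sup_norm K ?\<phi> = norm (?\<phi> y)"
      using sup_norm_attained[OF K(1,2) continuous_on_subset[OF pot.continuous_on_phi K_fr]] by blast
    \<comment> \<open>The maximum over the compact \<open>K\<close> is attained inside
      \<open>D\<close>; this strict inequality makes the limit of the roots less than 1.\<close>
    have "?\<phi> y < R0" using y(1) K(3) by (auto simp: D_eq)
    then have lt1: "sup_norm K ?\<phi> / R0 < 1" using y(2) pot.phi_nonneg[of y] R0_pos by simp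
    have lim: "(\<lambda>k. root (n k) (sup_norm K (g k))) \<longlonglongrightarrow> sup_norm K ?\<phi> / R0"
      using limit[OF K(1-3)] R0 by (simp add: sup_eq flip: g_def)
    have sup_nonneg: "0 \<le> sup_norm K (g k)" for k
      using sup_norm_upper[OF K(1) cont_g y(1), of k] norm_ge_zero order_trans by blast
    have "continuous_on K (\<lambda>w. norm (poly Q w))" by (intro continuous_intros)
    then obtain x where x: "x \<in> K" "\<And>w. w \<in> K \<Longrightarrow> norm (poly Q x) \<le> norm (poly Q w)"
      using continuous_attains_inf[OF K(1,2)] by blast
    then have \<kappa>: "0 < norm (poly Q x)" using K(4) by (auto simp: D'_def)
    \<comment> \<open>This constant pays for rescaling by \<open>s k\<close> and for dividing by
      \<open>Q\<close>, whose smallest modulus on \<open>K\<close> is attained at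
      \<open>x\<close>.\<close>
    have C: "0 < A ^ m / norm (poly Q x)" using A(1) \<kappa> by simp
    obtain \<delta> where \<delta>: "0 < \<delta>"
        "\<forall>\<^sub>F k in sequentially. A ^ m / norm (poly Q x) * sup_norm K (g k) \<le> exp (- \<delta> * real (n k))"
      by (rule root_limit_imp_geometric[OF n_mono n_pos sup_nonneg lim lt1 C])
    have "\<forall>\<^sub>F k in sequentially. \<forall>w\<in>K. norm (F w * poly (scaled_poly A (Z k)) w - poly (p k) w) \<le> exp (- \<delta> * real (n k))"
      using \<delta>(2)
    proof eventually_elim
      case (elim k)
      show ?case
      proof
        fix w assume w: "w \<in> K"
        let ?d = "F w * poly (Qn (n k)) w - poly (P (n k)) w"
        have "norm (poly Q x) * norm ?d \<le> norm (poly Q w) * norm ?d" using x(2)[OF w]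
          by (intro mult_right_mono) auto
        also have "\<dots> = norm (g k w)" by (simp add: g_def algebra_simps flip: norm_mult)
        also have "\<dots> \<le> sup_norm K (g k)" using sup_norm_upper[OF K(1) cont_g w] .
        finally have d: "norm ?d \<le> sup_norm K (g k) / norm (poly Q x)" using \<kappa>
          by (simp add: field_simps)
        have "norm (s k) \<le> A ^ m"
          using s(2)[of k] power_increasing[OF size_Z[of k] A(1)] by linarith
        then have "norm (s k) * norm ?d \<le> A ^ m * (sup_norm K (g k) / norm (poly Q x))"
          using d A(1) by (intro mult_mono) auto
        also have "\<dots> \<le> exp (- \<delta> * real (n k))" using elim by simp
        also have "norm (s k) * norm ?d = norm (F w * poly (scaled_poly A (Z k)) w - poly (p k) w)"
          by (simp add: s(3) p_def algebra_simps flip: norm_mult)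
        finally show "norm (F w * poly (scaled_poly A (Z k)) w - poly (p k) w) \<le> exp (- \<delta> * real (n k))" .
      qed
    qed
    then show ?thesis using r(1) \<delta>(1) unfolding geometric_decay_def K_def by blast
  qed
  have few: "\<exists>r>0. \<forall>\<epsilon>>0. \<forall>\<^sub>F k in sequentially.
      real (size {#a \<in># proots (p k). a \<in> ball z0 r#}) \<le> \<epsilon> * real (n k)" if z0: "z0 \<in> frontier D" for z0
  proof -
    obtain r where r: "0 < r" "\<not> 0 < limsup (\<lambda>k. ereal (zero_measure (P (n k)) (ball z0 r)))"
      using contra z0 by blast
    have "\<forall>\<^sub>F k in sequentially. real (size {#a \<in># proots (p k). a \<in> ball z0 r#}) \<le> \<epsilon> * real (n k)" if \<epsilon>: "0 < \<epsilon>" for \<epsilon>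
    proof -
      have "limsup (\<lambda>k. ereal (zero_measure (P (n k)) (ball z0 r))) < ereal \<epsilon>"
        using r(2) \<epsilon>
        by (metis ereal_less(2) le_less_trans not_less)
      from Limsup_lessD[OF this]
      show ?thesis
      proof eventually_elim
        case (elim k)
        let ?Y = "{#a \<in># proots (P (n k)). a \<in> ball z0 r#}"
        have "real (size ?Y) \<le> \<epsilon> * real (degree (P (n k)))"
        proof (cases "degree (P (n k)) = 0")
          case True
          then have "proots (P (n k)) = {#}" by (metis size_eq_0_iff_empty size_proots_complex)
          then show ?thesis using \<epsilon> by simp
        next
          case False
          then show ?thesis using elim by (simp add: zero_measure_def divide_less_eq)
        qed
        \<comment> \<open>\<open>zero_measure\<close> is relative to the actual degree, which is at
          most \<open>n k\<close>.\<close>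
        also have "\<dots> \<le> \<epsilon> * real (n k)" using Qn(1)[of k] \<epsilon>
          by (intro mult_left_mono) auto
        finally show ?case using s(1)[of k] by (simp add: p_def)
      qed
    qed
    then show ?thesis using r(1) by blast
  qed

  \<comment> \<open>Continuation beyond \<open>D\<close> and the contradiction\<close>
  interpret ap: approximation_data p Z n A c m D D' F
  proof
    show "\<forall>\<^sub>F k in sequentially. real (n (Suc k)) \<le> c * real (n k)"
      using ev_ratio
    proof eventually_elim
      case (elim k)
      then have "real (n (Suc k)) < c0 * real (n k)" using n_pos[of k] by (simp add: divide_less_eq)
      also have "\<dots> \<le> c * real (n k)" by (intro mult_right_mono) (auto simp: c_def)
      finally show ?case by simp
    qed
    show "degree (p k) \<le> n k" for k using Qn(1)[of k] by (simp add: p_def)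
    show "D \<noteq> {}" using x0 E_D by blast
    show "D' \<subseteq> D" by (auto simp: D'_def)
    show "F z \<noteq> 0" if "z \<in> D'" for z using that by (simp add: D'_def)
  qed (use n_mono size_Z A open_D D_conn open_D' dense cont_F approx few in \<open>auto simp: c_def\<close>)
  obtain \<Omega> H Qs where \<Omega>: "open \<Omega>" "closure D \<subseteq> \<Omega>" "H holomorphic_on \<Omega>" and Qs: "Qs \<noteq> 0" "degree Qs \<le> m"
    and eq: "\<And>z. z \<in> D' \<Longrightarrow> F z * poly Qs z = H z"
    by (rule ap.holomorphic_numerator) blast
  have D_\<Omega>: "D \<subseteq> \<Omega>" using \<Omega>(2) closure_subset by blast
  \<comment> \<open>The identity is known on \<open>D'\<close>, which leaves out \<open>E\<close>;
    connectedness of \<open>D\<close> carries it to \<open>E\<close>, where the continuation has to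
    agree with \<open>f\<close>.\<close>
  have ident: "\<forall>\<^sub>F w in at z. F w * poly Qs w - H w = 0" if z: "z \<in> D" for z
  proof (rule meromorphic_eq_extends[OF _ open_D D_conn open_D' _ _ _ z])
    have "H analytic_on D" using \<Omega>(1,3) D_\<Omega> by (metis analytic_on_open analytic_on_subset)
    then show "(\<lambda>w. F w * poly Qs w - H w) meromorphic_on D"
      using F_mero
      by (intro meromorphic_on_diff meromorphic_on_mult) (auto intro!: analytic_on_imp_meromorphic_on analytic_on_poly)
    show "D' \<noteq> {}" using ap.exists_point by blast
  qed (auto simp: D'_def eq)
  obtain r' where r': "R0 < r'" "{z. ?\<phi> z < r'} \<subseteq> \<Omega>"
  proof (rule pot.level_set_in_neighbourhood[OF \<Omega>(1), of R0])
    show "closure {z. ?\<phi> z < R0} \<subseteq> \<Omega>" using \<Omega>(2) by (simp add: D_eq)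
    show "{z. ?\<phi> z \<le> R0} \<subseteq> closure {z. ?\<phi> z < R0}"
      using pot.le_level_subset_closure[OF closed_E frE _ conn] E_D by (simp add: D_eq)
    show "frontier E \<subseteq> {z. ?\<phi> z < R0}" using frE E_D by (simp add: D_eq subset_trans)
  qed blast
  have "in_M m f E (level_set \<mu> (ereal r'))"
  proof (rule in_M_quotient[OF \<Omega>(1,3) _ Qs V(1,2) _ V(4)])
    show "level_set \<mu> (ereal r') \<subseteq> \<Omega>" using r'(2) by (simp add: level_set_def)
    show "V \<subseteq> \<Omega>" using V(3) D_\<Omega> by blast
    show "\<forall>\<^sub>F w in at z. f w * poly Qs w = H w" if z: "z \<in> V" for z
    proof -
      have "z \<in> D" using V(3) z by blast
      from ident[OF this] ev_V[OF z] show ?thesis by eventually_elim (simp add: F_f)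
    qed
  qed
  then have "r' \<le> R0" using rho_min_le rho_R0 r'(1) by (intro R_upper) auto
  then show False using r'(1) by simp
qed

end
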